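(* Let $G$ be a path-connected group-like space or a path-connected CW $H$-space, let $m\ge2$, and let $f_i\colon X\to G$ be maps for $1\le i\le m$. Let $F'_m\colon G^m\to G^{m-1}$ be the map $F'_m(x_1,\dots,x_m)=(F'(x_1,x_2),F'(x_2,x_3),\dots,F'(x_{m-1},x_m))$, where $F'\colon G\times G\to G$ is specified in the context, and let $(f_1,\dots,f_m)\colon X\to G^m$ be $x\mapsto(f_1(x),\dots,f_m(x))$. Then $$\mathsf{D}^{\mathcal D}(f_1,\dots,f_m)=\mathsf{cat}_1(F'_m\circ(f_1,\dots,f_m))\quad\text{and}\quad\mathsf{dD}^{\mathcal D}(f_1,\dots,f_m)=\mathsf{dcat}_1(F'_m\circ(f_1,\dots,f_m)).$$
   Context: An $H$-space is a space $G$ with a multiplication $\mu\colon G\times G\to G$ and an identity element $e$ such that $\mu|_{G\times\{e\}}\simeq\mathrm{id}_G\simeq\mu|_{\{e\}\times G}$ (not necessarily homotopy-associative). A group-like space is a homotopy-associative $H$-space with an inversion $\eta\colon G\to G$ such that $\mu\circ(\mathrm{id}\times\eta)\circ\Delta\simeq c_e\simeq\mu\circ(\eta\times\mathrm{id})\circ\Delta$, where $\Delta$ is the diagonal and $c_e$ the constant map at $e$. The map $F'$: if $G$ is group-like, $F'=\mu\circ(\mathrm{id}_G\times\eta)$. If $G$ is a path-connected CW $H$-space, $F'=\mu\circ(\mathrm{id}_G\times\eta')$ where $\eta'\colon G\to G$ is a map (which exists by James) with $\mu\circ(\mathrm{id}_G\times\eta')\circ\Delta\simeq c_e$. For a fibration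 $p\colon E\to B$, $\mathsf{secat}(p)$ is the least $n\ge 0$ such that $B$ is covered by $n+1$ open sets over each of which $p$ has a continuous partial section. For $k\ge1$ let $E_k(p)$ be the space of probability measures $\sum_{i=1}^k\lambda_ie_i$ on $E$ supported on at most $k$ points, all in a single fiber of $p$, as a subspace of the space $\mathcal B_k(E)$ of probability measures with support of size at most $k$ (with the L\'evy--Prokhorov metric topology when $E$ is metrizable; the results are asserted equally for the quotient topology from the symmetric join $\ast^kE/\Sigma_k$), and $p_k\colon E_k(p)\to B$, $p_k(\sum\lambda_ie_i)=p(e_i)$. $\mathsf{dsecat}(p)$ is the least $n\ge0$ such that $p_{n+1}$ has a continuous section. Spaces whose coverings are used are assumed connected, locally path-connected and semi-locally simply connected. For $f\colon X\to Y$ and the universal covering $\widetilde p^Y\colon\widetilde Y\to Y$: $\mathsf{cat}_1(f):=\mathsf{secat}(f^*\widetilde p^Y)$, $\mathsf{dcat}_1(f):=\mathsf{dsecat}(f^*\widetilde p^Y)$. With $\pi=\pi_1(Y,y_0)$, let $\widehat\pi^Y_m\colon\widehat Y^m\to Y^m$ be the connected covering corresponding to the diagonal subgroup $\Delta<\pi^m$. For maps $f_1,\dots,f_m\colon X\to Y$, $\mathsf{D}^{\mathcal D}(f_1,\dots,f_m)$ is the least $n\ge0$ such that $X$ is covered by $n+1$ open sets $U_j$ such that, for each $j$ and each $u_j\in U_j$, the homomorphism $\pi_1(U_j,u_j)\to\pi_1(Y^m,(f_1(u_j),\dots,f_m(u_j)))$ induced by $(f_1,\dots,f_m)|_{U_j}$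 takes values in a subgroup conjugate to $\Delta$; equivalently it is $\mathsf{secat}((f_1,\dots,f_m)^*\widehat\pi^Y_m)$. And $\mathsf{dD}^{\mathcal D}(f_1,\dots,f_m):=\mathsf{dsecat}((f_1,\dots,f_m)^*\widehat\pi^Y_m)$. *)

theory Defs
  imports
    "HOL-Analysis.Analysis"
    "HOL-Probability.Probability"
    "HOL-Homology.Simplices"
    "HOL-Library.Extended_Nat"
begin

text \<open>
  A topological space is a set \<open>S\<close> in a type of class \<open>topological_space\<close>, with the subspace
  topology \<open>top_of_set S\<close>. Homotopies are free (not base-point preserving) unless they are
  homotopies of paths.
\<close>

section \<open>H-spaces, group-like spaces and CW complexes\<close>

abbreviation homotopic_maps ::
    "'a::topological_space set \<Rightarrow> 'b::topological_space set \<Rightarrow> ('a \<Rightarrow> 'b) \<Rightarrow> ('a \<Rightarrow> 'b) \<Rightarrow> bool" where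
  "homotopic_maps S T f g \<equiv> homotopic_with_canon (\<lambda>_. True) S T f g"

definition H_space :: "'g::topological_space set \<Rightarrow> ('g \<times> 'g \<Rightarrow> 'g) \<Rightarrow> 'g \<Rightarrow> bool" where
  "H_space G mu e \<longleftrightarrow>
     e \<in> G \<and> continuous_on (G \<times> G) mu \<and> mu ` (G \<times> G) \<subseteq> G \<and>
     homotopic_maps G G (\<lambda>x. mu (x, e)) (\<lambda>x. x) \<and>
     homotopic_maps G G (\<lambda>x. mu (e, x)) (\<lambda>x. x)"

definition right_inversion ::
    "'g::topological_space set \<Rightarrow> ('g \<times> 'g \<Rightarrow> 'g) \<Rightarrow> 'g \<Rightarrow> ('g \<Rightarrow> 'g) \<Rightarrow> bool" where
  "right_inversion G mu e eta \<longleftrightarrow>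
     continuous_on G eta \<and> eta ` G \<subseteq> G \<and>
     homotopic_maps G G (\<lambda>x. mu (x, eta x)) (\<lambda>_. e)"

definition group_like ::
    "'g::topological_space set \<Rightarrow> ('g \<times> 'g \<Rightarrow> 'g) \<Rightarrow> 'g \<Rightarrow> ('g \<Rightarrow> 'g) \<Rightarrow> bool" where
  "group_like G mu e eta \<longleftrightarrow>
     H_space G mu e \<and>
     homotopic_maps (G \<times> G \<times> G) G (\<lambda>(x, y, z). mu (mu (x, y), z)) (\<lambda>(x, y, z). mu (x, mu (y, z))) \<and>
     right_inversion G mu e eta \<and>
     homotopic_maps G G (\<lambda>x. mu (eta x, x)) (\<lambda>_. e)"

text \<open>The closed and the open unit disc of dimension \<open>n\<close>, in the first \<open>n\<close> coordinates.\<close>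

definition closed_disc :: "nat \<Rightarrow> (nat \<Rightarrow> real) set" where
  "closed_disc n = {x. (\<forall>i\<ge>n. x i = 0) \<and> (\<Sum>i<n. (x i)\<^sup>2) \<le> 1}"

definition open_disc :: "nat \<Rightarrow> (nat \<Rightarrow> real) set" where
  "open_disc n = {x. (\<forall>i\<ge>n. x i = 0) \<and> (\<Sum>i<n. (x i)\<^sup>2) < 1}"

text \<open>
  \<open>Phi\<close> is the set of pairs (dimension, characteristic map). The last two clauses are closure
  finiteness and the weak topology.
\<close>

definition CW_complex :: "'g::topological_space set \<Rightarrow> bool" where
  "CW_complex X \<longleftrightarrow>
     Hausdorff_space (top_of_set X) \<and>
     (\<exists>Phi :: (nat \<times> ((nat \<Rightarrow> real) \<Rightarrow> 'g)) set.
        (\<forall>(n, phi) \<in> Phi. continuous_on (closed_disc n) phi \<and> phi ` closed_disc n \<subseteq> X \<and>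
            (\<exists>psi. homeomorphism (open_disc n) (phi ` open_disc n) phi psi)) \<and>
        pairwise (\<lambda>(n, phi) (k, psi). disjnt (phi ` open_disc n) (psi ` open_disc k)) Phi \<and>
        (\<Union>(n, phi) \<in> Phi. phi ` open_disc n) = X \<and>
        (\<forall>(n, phi) \<in> Phi. \<exists>C. C \<subseteq> Phi \<and> finite C \<and> (\<forall>(k, psi) \<in> C. k < n) \<and>
            phi ` (closed_disc n - open_disc n) \<subseteq> (\<Union>(k, psi) \<in> C. psi ` open_disc k)) \<and>
        (\<forall>A. A \<subseteq> X \<longrightarrow>
            (closedin (top_of_set X) A \<longleftrightarrow>
             (\<forall>(n, phi) \<in> Phi. closedin (top_of_set X) (A \<inter> phi ` closed_disc n)))))"

section \<open>The maps into powers\<close>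

text \<open>The power \<open>Y\<^sup>m\<close> consists of extensional functions on \<open>{1..m}\<close>, with the product topology.\<close>

definition power_space :: "'y set \<Rightarrow> nat \<Rightarrow> (nat \<Rightarrow> 'y) set" where
  "power_space Y m = (\<Pi>\<^sub>E i\<in>{1..m}. Y)"

definition tuple_map :: "nat \<Rightarrow> (nat \<Rightarrow> 'x \<Rightarrow> 'y) \<Rightarrow> 'x \<Rightarrow> (nat \<Rightarrow> 'y)" where
  "tuple_map m f x = (\<lambda>i\<in>{1..m}. f i x)"

definition diagonal_map :: "nat \<Rightarrow> 'y \<Rightarrow> (nat \<Rightarrow> 'y)" where
  "diagonal_map m y = (\<lambda>i\<in>{1..m}. y)"

definition F_two :: "('g \<times> 'g \<Rightarrow> 'g) \<Rightarrow> ('g \<Rightarrow> 'g) \<Rightarrow> 'g \<times> 'g \<Rightarrow> 'g" where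
  "F_two mu eta = mu \<circ> map_prod id eta"

definition F_seq :: "('g \<times> 'g \<Rightarrow> 'g) \<Rightarrow> ('g \<Rightarrow> 'g) \<Rightarrow> nat \<Rightarrow> (nat \<Rightarrow> 'g) \<Rightarrow> (nat \<Rightarrow> 'g)" where
  "F_seq mu eta m x = (\<lambda>i\<in>{1..m - 1}. F_two mu eta (x i, x (Suc i)))"

section \<open>Fundamental groups and coverings\<close>

definition loop_class :: "'a::topological_space set \<Rightarrow> (real \<Rightarrow> 'a) \<Rightarrow> (real \<Rightarrow> 'a) set" where
  "loop_class S g = {h. homotopic_paths S g h}"

text \<open>The underlying set of the fundamental group.\<close>

definition pi1 :: "'a::topological_space set \<Rightarrow> 'a \<Rightarrow> (real \<Rightarrow> 'a) set set" where
  "pi1 S x =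
     loop_class S ` {g. path g \<and> path_image g \<subseteq> S \<and> pathstart g = x \<and> pathfinish g = x}"

text \<open>
  The homomorphism induced by \<open>f\<close> into \<open>\<pi>\<^sub>1(T)\<close>, and the isomorphism
  \<open>\<pi>\<^sub>1(S, pathfinish s) \<rightarrow> \<pi>\<^sub>1(S, pathstart s)\<close>, \<open>[g] \<mapsto> [s g s\<^sup>-\<^sup>1]\<close>, both as maps on homotopy classes.
\<close>

definition pi1_map ::
    "'b::topological_space set \<Rightarrow> ('a::topological_space \<Rightarrow> 'b) \<Rightarrow> (real \<Rightarrow> 'a) set \<Rightarrow> (real \<Rightarrow> 'b) set" where
  "pi1_map T f c = (\<Union>g\<in>c. loop_class T (f \<circ> g))"

definition pi1_transport ::
    "'a::topological_space set \<Rightarrow> (real \<Rightarrow> 'a) \<Rightarrow> (real \<Rightarrow> 'a) set \<Rightarrow> (real \<Rightarrow> 'a) set" where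
  "pi1_transport S s c = (\<Union>g\<in>c. loop_class S (s +++ g +++ reversepath s))"

definition semilocally_simply_connected :: "'a::topological_space set \<Rightarrow> bool" where
  "semilocally_simply_connected S \<longleftrightarrow>
     (\<forall>x\<in>S. \<exists>U. openin (top_of_set S) U \<and> x \<in> U \<and>
        (\<forall>g. path g \<and> path_image g \<subseteq> U \<and> pathstart g = x \<and> pathfinish g = x \<longrightarrow>
             homotopic_paths S g (\<lambda>_. x)))"

definition universal_covering ::
    "'u::topological_space set \<Rightarrow> ('u \<Rightarrow> 'y::topological_space) \<Rightarrow> 'y set \<Rightarrow> bool" where
  "universal_covering U q Y \<longleftrightarrow> covering_space U q Y \<and> simply_connected U"

text \<open>
  The diagonal subgroup of \<open>\<pi>\<^sub>1(Y, y0)\<^sup>m\<close>, identified with \<open>\<pi>\<^sub>1(Y\<^sup>m, (y0, \<dots>, y0))\<close>: the tuple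
  \<open>(a, \<dots>, a)\<close> is the image of \<open>a\<close> under the diagonal map.
\<close>

definition diagonal_subgroup ::
    "'y::topological_space set \<Rightarrow> nat \<Rightarrow> 'y \<Rightarrow> (real \<Rightarrow> nat \<Rightarrow> 'y) set set" where
  "diagonal_subgroup Y m y0 = pi1_map (power_space Y m) (diagonal_map m) ` pi1 Y y0"

definition diagonal_covering ::
    "'h::topological_space set \<Rightarrow> ('h \<Rightarrow> nat \<Rightarrow> 'y::topological_space) \<Rightarrow> 'y set \<Rightarrow> nat \<Rightarrow> 'y \<Rightarrow> bool" where
  "diagonal_covering H r Y m y0 \<longleftrightarrow>
     covering_space H r (power_space Y m) \<and> connected H \<and>
     (\<exists>h0\<in>H. r h0 = diagonal_map m y0 \<and>
        pi1_map (power_space Y m) r ` pi1 H h0 = diagonal_subgroup Y m y0)"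

text \<open>Total space of the pullback of \<open>p : E \<rightarrow> Y\<close> along \<open>f : X \<rightarrow> Y\<close>; its projection to \<open>X\<close> is \<open>fst\<close>.\<close>

definition pullback :: "'x set \<Rightarrow> ('x \<Rightarrow> 'y) \<Rightarrow> 'e set \<Rightarrow> ('e \<Rightarrow> 'y) \<Rightarrow> ('x \<times> 'e) set" where
  "pullback X f E p = {(x, z). x \<in> X \<and> z \<in> E \<and> f x = p z}"

section \<open>Sectional category and distributional sectional category\<close>

text \<open>All invariants are infinite if there is no \<open>n\<close> as required (\<open>Inf {} = \<infinity>\<close> in \<open>enat\<close>).\<close>

definition secat ::
    "'e::topological_space set \<Rightarrow> ('e \<Rightarrow> 'b::topological_space) \<Rightarrow> 'b set \<Rightarrow> enat" where
  "secat E p B = Inf {enat n | n.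
     \<exists>V :: nat \<Rightarrow> 'b set. (\<Union>j\<le>n. V j) = B \<and>
       (\<forall>j\<le>n. openin (top_of_set B) (V j) \<and>
          (\<exists>s. continuous_on (V j) s \<and> s ` V j \<subseteq> E \<and> (\<forall>b\<in>V j. p (s b) = b)))}"

definition measures_upto :: "'e set \<Rightarrow> nat \<Rightarrow> 'e pmf set" where
  "measures_upto E k = {M. set_pmf M \<subseteq> E \<and> finite (set_pmf M) \<and> card (set_pmf M) \<le> k}"

definition fibre_measures :: "'e set \<Rightarrow> ('e \<Rightarrow> 'b) \<Rightarrow> nat \<Rightarrow> 'e pmf set" where
  "fibre_measures E p k = {M \<in> measures_upto E k. \<exists>b. \<forall>x\<in>set_pmf M. p x = b}"

definition fibre_projection :: "('e \<Rightarrow> 'b) \<Rightarrow> 'e pmf \<Rightarrow> 'b" where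
  "fibre_projection p M = the_elem (p ` set_pmf M)"

text \<open>
  The first argument \<open>T\<close> gives the topology \<open>T E k\<close> on the space \<open>measures_upto E k\<close> of measures;
  the two choices of interest follow below.
\<close>

definition dsecat ::
    "('e set \<Rightarrow> nat \<Rightarrow> 'e pmf topology) \<Rightarrow> 'e set \<Rightarrow> ('e \<Rightarrow> 'b::topological_space) \<Rightarrow> 'b set \<Rightarrow> enat" where
  "dsecat T E p B = Inf {enat n | n.
     \<exists>s. continuous_map (top_of_set B) (subtopology (T E (n + 1)) (fibre_measures E p (n + 1))) s \<and>
       (\<forall>b\<in>B. fibre_projection p (s b) = b)}"

text \<open>
  The measure \<open>\<Sum>\<^sub>i l i \<cdot> \<delta>(x i)\<close>, and the topology coinduced from \<open>E\<^sup>k \<times> \<Delta>\<^sup>k\<^sup>-\<^sup>1\<close>, that is, the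
  quotient topology from the \<open>k\<close>-fold symmetric join of \<open>E\<close> (itself a quotient of
  \<open>E\<^sup>k \<times> \<Delta>\<^sup>k\<^sup>-\<^sup>1\<close>); \<open>k \<ge> 1\<close> is intended.
\<close>

definition weighted_sum :: "(nat \<Rightarrow> 'e) \<times> (nat \<Rightarrow> real) \<Rightarrow> 'e pmf" where
  "weighted_sum = (\<lambda>(x, l). map_pmf x (embed_pmf l))"

definition join_domain :: "'e set \<Rightarrow> nat \<Rightarrow> ((nat \<Rightarrow> 'e) \<times> (nat \<Rightarrow> real)) set" where
  "join_domain E k = (\<Pi>\<^sub>E i\<in>{..<k}. E) \<times> standard_simplex (k - 1)"

definition symmetric_join_topology :: "'e::topological_space set \<Rightarrow> nat \<Rightarrow> 'e pmf topology" where
  "symmetric_join_topology E k = topology (\<lambda>W. W \<subseteq> measures_upto E k \<and>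
     openin (top_of_set (join_domain E k)) {z \<in> join_domain E k. weighted_sum z \<in> W})"

lemma openin_symmetric_join_topology:
  "openin (symmetric_join_topology E k) W \<longleftrightarrow> W \<subseteq> measures_upto E k \<and>
     openin (top_of_set (join_domain E k)) {z \<in> join_domain E k. weighted_sum z \<in> W}"
proof -
  let ?D = "join_domain E k"
  have "openin (top_of_set ?D) {z \<in> ?D. weighted_sum z \<in> S \<inter> T}"
    if "openin (top_of_set ?D) {z \<in> ?D. weighted_sum z \<in> S}"
       "openin (top_of_set ?D) {z \<in> ?D. weighted_sum z \<in> T}" for S T
  proof -
    have "{z \<in> ?D. weighted_sum z \<in> S \<inter> T} =
        {z \<in> ?D. weighted_sum z \<in> S} \<inter> {z \<in> ?D. weighted_sum z \<in> T}"
      by auto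
    then show ?thesis using openin_Int[OF that] by simp
  qed
  moreover have "openin (top_of_set ?D) {z \<in> ?D. weighted_sum z \<in> \<Union>K}"
    if "\<forall>S\<in>K. openin (top_of_set ?D) {z \<in> ?D. weighted_sum z \<in> S}" for K
  proof -
    have "{z \<in> ?D. weighted_sum z \<in> \<Union>K} = (\<Union>S\<in>K. {z \<in> ?D. weighted_sum z \<in> S})"
      by auto
    then show ?thesis using that by (auto intro!: openin_Union)
  qed
  ultimately have "istopology (\<lambda>W. W \<subseteq> measures_upto E k \<and>
     openin (top_of_set ?D) {z \<in> ?D. weighted_sum z \<in> W})"
    unfolding istopology_def by blast
  then show ?thesis
    by (simp add: symmetric_join_topology_def topology_inverse')
qed

text \<open>The Levy--Prokhorov distance with respect to a metric \<open>d\<close> on \<open>E\<close>, over the Borel sets of \<open>E\<close>.\<close>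

definition levy_prokhorov ::
    "('e::topological_space \<Rightarrow> 'e \<Rightarrow> real) \<Rightarrow> 'e set \<Rightarrow> 'e pmf \<Rightarrow> 'e pmf \<Rightarrow> real" where
  "levy_prokhorov d E M N = Inf {r. r > 0 \<and>
     (\<forall>A \<in> sets (restrict_space borel E).
        measure_pmf.prob M A \<le> measure_pmf.prob N {x\<in>E. \<exists>a\<in>A. d a x < r} + r \<and>
        measure_pmf.prob N A \<le> measure_pmf.prob M {x\<in>E. \<exists>a\<in>A. d a x < r} + r)}"

definition levy_prokhorov_topology ::
    "('e::topological_space \<Rightarrow> 'e \<Rightarrow> real) \<Rightarrow> 'e set \<Rightarrow> nat \<Rightarrow> 'e pmf topology" where
  "levy_prokhorov_topology d E k = Metric_space.mtopology (measures_upto E k) (levy_prokhorov d E)"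

definition metrizes :: "('e::topological_space \<Rightarrow> 'e \<Rightarrow> real) \<Rightarrow> 'e set \<Rightarrow> bool" where
  "metrizes d E \<longleftrightarrow> Metric_space E d \<and> Metric_space.mtopology E d = top_of_set E"

section \<open>The invariants of maps\<close>

text \<open>
  In \<open>cat_one\<close> and \<open>dcat_one\<close>, \<open>q : U \<rightarrow> Y\<close> is the universal covering of the codomain of \<open>f\<close>.
\<close>

definition cat_one ::
    "'x::topological_space set \<Rightarrow> ('x \<Rightarrow> 'y) \<Rightarrow> 'u::topological_space set \<Rightarrow> ('u \<Rightarrow> 'y) \<Rightarrow> enat" where
  "cat_one X f U q = secat (pullback X f U q) fst X"

definition dcat_one ::
    "(('x \<times> 'u) set \<Rightarrow> nat \<Rightarrow> ('x \<times> 'u) pmf topology) \<Rightarrow>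
     'x::topological_space set \<Rightarrow> ('x \<Rightarrow> 'y) \<Rightarrow> 'u set \<Rightarrow> ('u \<Rightarrow> 'y) \<Rightarrow> enat" where
  "dcat_one T X f U q = dsecat T (pullback X f U q) fst X"

text \<open>
  Conjugacy of subgroups of \<open>\<pi>\<^sub>1(Y\<^sup>m)\<close> at different base points is by the class of a path \<open>s\<close>
  between them.
\<close>

definition diag_dist ::
    "'x::topological_space set \<Rightarrow> 'y::topological_space set \<Rightarrow> 'y \<Rightarrow> nat \<Rightarrow> (nat \<Rightarrow> 'x \<Rightarrow> 'y) \<Rightarrow> enat" where
  "diag_dist X Y y0 m f = Inf {enat n | n.
     \<exists>V :: nat \<Rightarrow> 'x set. (\<Union>j\<le>n. V j) = X \<and>
       (\<forall>j\<le>n. openin (top_of_set X) (V j) \<and>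
          (\<forall>u\<in>V j. \<exists>s. path s \<and> path_image s \<subseteq> power_space Y m \<and>
             pathstart s = tuple_map m f u \<and> pathfinish s = diagonal_map m y0 \<and>
             pi1_map (power_space Y m) (tuple_map m f) ` pi1 (V j) u
               \<subseteq> pi1_transport (power_space Y m) s ` diagonal_subgroup Y m y0))}"

text \<open>In the following two, \<open>r : H \<rightarrow> Y\<^sup>m\<close> is the covering corresponding to the diagonal subgroup.\<close>

definition diag_dist_secat ::
    "'x::topological_space set \<Rightarrow> nat \<Rightarrow> (nat \<Rightarrow> 'x \<Rightarrow> 'y) \<Rightarrow>
     'h::topological_space set \<Rightarrow> ('h \<Rightarrow> nat \<Rightarrow> 'y) \<Rightarrow> enat" where
  "diag_dist_secat X m f H r = secat (pullback X (tuple_map m f) H r) fst X"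

definition ddiag_dist ::
    "(('x \<times> 'h) set \<Rightarrow> nat \<Rightarrow> ('x \<times> 'h) pmf topology) \<Rightarrow>
     'x::topological_space set \<Rightarrow> nat \<Rightarrow> (nat \<Rightarrow> 'x \<Rightarrow> 'y) \<Rightarrow> 'h set \<Rightarrow> ('h \<Rightarrow> nat \<Rightarrow> 'y) \<Rightarrow> enat" where
  "ddiag_dist T X m f H r = dsecat T (pullback X (tuple_map m f) H r) fst X"

end

theory Submission
  imports Defs
begin

text \<open>
  Both sides of each equation are invariants of a covering of \<open>X\<close> that is pulled back from \<open>G\<^sup>m\<close>: on the
  left from the covering \<open>r : H \<rightarrow> G\<^sup>m\<close> of the diagonal subgroup, on the right from the pullback of the
  universal covering \<open>q : U \<rightarrow> G\<^sup>m\<^sup>-\<^sup>1\<close> along \<open>F_seq\<close>. The idea is that the homomorphism induced by \<open>F_seq\<close> on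
  fundamental groups has the diagonal as its kernel, so that the two coverings of \<open>G\<^sup>m\<close> dominate one
  another.

  The kernel is computed with loops (\<open>diagonal_on_loops_iff_null\<close>). A diagonal loop goes to a null loop, as
  \<open>mu (x, eta x)\<close> is homotopic to a constant. Conversely, if \<open>mu (a, eta \<circ> b)\<close> is null for loops \<open>a\<close> and \<open>b\<close>, then,
  compared with the null loop \<open>mu (b, eta \<circ> b)\<close>, the right translates of \<open>a\<close> and \<open>b\<close> by a point are homotopic;
  right translations are homotopic to the identity, so \<open>a\<close> and \<open>b\<close> are homotopic
  (\<open>F_two_null_imp_homotopic\<close>). Hence all components of a loop in the kernel agree up to homotopy.

  By the lifting criterion for coverings (\<open>lifting_criterion\<close>), a map \<open>f\<close> from a locally path connected space
  to \<open>G\<^sup>m\<close> lifts to \<open>H\<close> if and only if it carries loops to conjugates of diagonal loops, and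
  \<open>F_seq \<circ> f\<close> lifts to \<open>U\<close> if and only if it kills loops. These are the same condition
  (\<open>has_lift_diagonal_iff_universal\<close>). Applied to \<open>r\<close>, and to the projection of the pullback of \<open>U\<close> to
  \<open>G\<^sup>m\<close>, this gives maps over \<open>G\<^sup>m\<close> between both coverings in both directions. Pulled back to \<open>X\<close>, they become
  fibrewise maps of the coverings of \<open>X\<close>.

  Fibrewise maps decrease the sectional category, and also its distributional version as soon as
  the push-forward of measures is continuous. For the symmetric join it is induced by a map before passing
  to the quotient; for the Levy-Prokhorov metric continuity follows from the finiteness of supports
  (\<open>lp_close_map_pmf\<close>). Finally, on an open set \<open>V\<close> of a locally path connected \<open>X\<close>, the condition on
  fundamental groups in the homotopic distance is the criterion for a lift of \<open>V\<close> to \<open>H\<close>, that is, for a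
  local section of the pullback (\<open>diag_dist_eq_secat\<close>).
\<close>

section \<open>Homotopies of paths in arbitrary spaces\<close>

text \<open>
  One predicate for all side conditions of the path operations, so that a single fact about a path
  discharges them.
\<close>

definition path_in :: "'a::topological_space set \<Rightarrow> 'a \<Rightarrow> 'a \<Rightarrow> (real \<Rightarrow> 'a) \<Rightarrow> bool" where
  "path_in S x y p \<longleftrightarrow> path p \<and> path_image p \<subseteq> S \<and> pathstart p = x \<and> pathfinish p = y"

lemma path_in_const: "x \<in> S \<Longrightarrow> path_in S x x (\<lambda>_. x)"
  by (auto simp: path_in_def path_def path_image_def pathstart_def pathfinish_def)

lemma path_in_reversepath: "path_in S x y p \<Longrightarrow> path_in S y x (reversepath p)"
  by (auto simp: path_in_def)

lemma path_in_join: "path_in S x y p \<Longrightarrow> path_in S y z q \<Longrightarrow> path_in S x z (p +++ q)"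
  by (simp add: path_in_def subset_path_image_join)

lemma path_in_compose:
  assumes "path_in S x y p" "continuous_on S f" "f ` S \<subseteq> T"
  shows "path_in T (f x) (f y) (f \<circ> p)"
  using assms unfolding path_in_def path_image_compose
  by (auto intro!: path_continuous_image intro: continuous_on_subset simp: pathstart_compose pathfinish_compose)

lemma path_in_endpoints: "path_in S x y p \<Longrightarrow> x \<in> S \<and> y \<in> S"
  unfolding path_in_def by (metis pathstart_in_path_image pathfinish_in_path_image subsetD)

lemma path_in_mem: "path_in S x y p \<Longrightarrow> t \<in> {0..1} \<Longrightarrow> p t \<in> S"
  by (auto simp: path_in_def path_image_def)

lemma homotopic_paths_refl_in: "path_in S x y p \<Longrightarrow> homotopic_paths S p p"
  by (simp add: path_in_def)

lemma homotopic_paths_join_in: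
  assumes "homotopic_paths S p p'" "homotopic_paths S q q'" "path_in S x y p" "path_in S y z q"
  shows "homotopic_paths S (p +++ q) (p' +++ q')"
  using assms by (simp add: homotopic_paths_join path_in_def)

lemma homotopic_paths_assoc_in:
  assumes "path_in S x y p" "path_in S y z q" "path_in S z w r"
  shows "homotopic_paths S (p +++ (q +++ r)) ((p +++ q) +++ r)"
  using assms by (simp add: homotopic_paths_assoc path_in_def)

text \<open>
  The main source of path homotopies below: in a convex set paths with the same ends are
  homotopic along segments, and a continuous map carries this homotopy into any space. The unit and
  inverse laws come from \<open>K = {0..1}\<close>, the relations between translations from a square.
\<close>

lemma homotopic_paths_image_of_convex:
  fixes K :: "'k::real_normed_vector set"
  assumes "convex K" "path_in K a b \<phi>" "path_in K a b \<psi>" "continuous_on K h" "h ` K \<subseteq> S"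
  shows "homotopic_paths S (h \<circ> \<phi>) (h \<circ> \<psi>)"
proof -
  have "homotopic_paths K \<phi> \<psi>"
    using assms(1-3) by (intro homotopic_paths_linear closed_segment_subset)
      (auto simp: path_in_def path_image_def)
  then show ?thesis
    using assms(4,5) by (intro homotopic_paths_continuous_image) auto
qed

lemma homotopic_paths_reparametrized:
  assumes "path_in S x y p" "path_in {0..1::real} a b \<phi>" "path_in {0..1} a b \<psi>"
  shows "homotopic_paths S (p \<circ> \<phi>) (p \<circ> \<psi>)"
  using assms(1) by (intro homotopic_paths_image_of_convex[OF _ assms(2,3)])
    (auto simp: path_in_def path_def path_image_def)

lemma path_in_linepath: "path_in K a b (linepath a b)" if "closed_segment a b \<subseteq> K"
  using that by (simp add: path_in_def)

text \<open>
  Write each side as \<open>p\<close> composed with a path in the unit interval; the same idea gives the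
  other unit law and the inverse law.
\<close>

lemma homotopic_paths_const_right:
  assumes "path_in S x y p"
  shows "homotopic_paths S (p +++ (\<lambda>_. y)) p"
proof -
  have "path_in {0..1} 0 1 (linepath 0 (1::real) +++ linepath 1 1)"
    by (rule path_in_join; rule path_in_linepath) (auto simp: closed_segment_eq_real_ivl)
  from homotopic_paths_reparametrized[OF assms this path_in_linepath[of "0::real" 1]]
  have "homotopic_paths S (p \<circ> (linepath 0 1 +++ linepath 1 1)) (p \<circ> linepath 0 1)"
    by (auto simp: closed_segment_eq_real_ivl)
  moreover have "p \<circ> linepath 0 1 = p" "p \<circ> linepath 1 1 = (\<lambda>_. y)"
    using assms by (auto simp: linepath_def path_in_def pathfinish_def)
  ultimately show ?thesis by (simp add: path_compose_join)
qed

lemma homotopic_paths_rev_right: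
  assumes "path_in S x y p"
  shows "homotopic_paths S (p +++ reversepath p) (\<lambda>_. x)"
proof -
  have "path_in {0..1} 0 0 (linepath 0 (1::real) +++ linepath 1 0)"
    by (rule path_in_join; rule path_in_linepath) (auto simp: closed_segment_eq_real_ivl)
  from homotopic_paths_reparametrized[OF assms this path_in_linepath[of "0::real" 0]]
  have "homotopic_paths S (p \<circ> (linepath 0 1 +++ linepath 1 0)) (p \<circ> linepath 0 0)" by auto
  moreover have "p \<circ> linepath 0 1 = p" "p \<circ> linepath 1 0 = reversepath p" "p \<circ> linepath 0 0 = (\<lambda>_. x)"
    using assms by (auto simp: linepath_def path_in_def pathstart_def reversepath_def)
  ultimately show ?thesis by (simp add: path_compose_join)
qed

lemma homotopic_paths_const_left:
  assumes "path_in S x y p"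
  shows "homotopic_paths S ((\<lambda>_. x) +++ p) p"
proof -
  have "path_in {0..1} 0 1 (linepath 0 (0::real) +++ linepath 0 1)"
    by (rule path_in_join; rule path_in_linepath) (auto simp: closed_segment_eq_real_ivl)
  from homotopic_paths_reparametrized[OF assms this path_in_linepath[of "0::real" 1]]
  have "homotopic_paths S (p \<circ> (linepath 0 0 +++ linepath 0 1)) (p \<circ> linepath 0 1)"
    by (auto simp: closed_segment_eq_real_ivl)
  moreover have "p \<circ> linepath 0 1 = p" "p \<circ> linepath 0 0 = (\<lambda>_. x)"
    using assms by (auto simp: linepath_def path_in_def pathstart_def)
  ultimately show ?thesis by (simp add: path_compose_join)
qed

lemma homotopic_paths_cancel_right:
  assumes p: "path_in S x y p" and q: "path_in S y z q"
  shows "homotopic_paths S ((p +++ q) +++ reversepath q) p"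
proof -
  note r = path_in_reversepath[OF q]
  have "homotopic_paths S ((p +++ q) +++ reversepath q) (p +++ (q +++ reversepath q))"
    by (rule homotopic_paths_sym[OF homotopic_paths_assoc_in[OF p q r]])
  also have "homotopic_paths S (p +++ (q +++ reversepath q)) (p +++ (\<lambda>_. y))"
    by (rule homotopic_paths_join_in[OF homotopic_paths_refl_in[OF p] homotopic_paths_rev_right[OF q] p
        path_in_join[OF q r]])
  also have "homotopic_paths S (p +++ (\<lambda>_. y)) p"
    by (rule homotopic_paths_const_right[OF p])
  finally show ?thesis .
qed

lemma homotopic_paths_cancel_left:
  assumes p: "path_in S x y p" and q: "path_in S x z q"
  shows "homotopic_paths S (p +++ (reversepath p +++ q)) q"
proof -
  note r = path_in_reversepath[OF p]
  have "homotopic_paths S (p +++ (reversepath p +++ q)) ((p +++ reversepath p) +++ q)"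
    by (rule homotopic_paths_assoc_in[OF p r q])
  also have "homotopic_paths S ((p +++ reversepath p) +++ q) ((\<lambda>_. x) +++ q)"
    by (rule homotopic_paths_join_in[OF homotopic_paths_rev_right[OF p] homotopic_paths_refl_in[OF q]
        path_in_join[OF p r] q])
  also have "homotopic_paths S ((\<lambda>_. x) +++ q) q"
    by (rule homotopic_paths_const_left[OF q])
  finally show ?thesis .
qed

lemma homotopic_paths_join_cancel_right:
  assumes "homotopic_paths S (p +++ r) (q +++ r)" "path_in S x y p" "path_in S x y q" "path_in S y z r"
  shows "homotopic_paths S p q"
proof -
  have "homotopic_paths S ((p +++ r) +++ reversepath r) ((q +++ r) +++ reversepath r)"
    by (rule homotopic_paths_join_in[OF assms(1) homotopic_paths_refl_in])
      (use assms in \<open>blast intro: path_in_join path_in_reversepath\<close>)+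
  then show ?thesis
    using homotopic_paths_cancel_right assms homotopic_paths_sym homotopic_paths_trans by metis
qed

lemma homotopic_paths_join_cancel_left:
  assumes "homotopic_paths S (r +++ p) (r +++ q)" "path_in S x y p" "path_in S x y q" "path_in S z x r"
  shows "homotopic_paths S p q"
proof -
  note r = path_in_reversepath[OF assms(4)]
  have "homotopic_paths S (reversepath r +++ (r +++ p)) (reversepath r +++ (r +++ q))"
    by (rule homotopic_paths_join_in[OF homotopic_paths_refl_in assms(1)])
      (use assms r in \<open>blast intro: path_in_join\<close>)+
  then show ?thesis
    using homotopic_paths_cancel_left[OF r] assms homotopic_paths_sym homotopic_paths_trans
    by (metis reversepath_reversepath)
qed

text \<open>
  The representative of \<open>[s g s\<^sup>-\<^sup>1]\<close> that occurs in the definition of \<open>pi1_transport\<close>.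
\<close>

definition conjugate_path :: "(real \<Rightarrow> 'a) \<Rightarrow> (real \<Rightarrow> 'a) \<Rightarrow> real \<Rightarrow> 'a::topological_space" where
  "conjugate_path s g = s +++ (g +++ reversepath s)"

lemma path_in_conjugate: "path_in S x y s \<Longrightarrow> path_in S y y g \<Longrightarrow> path_in S x x (conjugate_path s g)"
  unfolding conjugate_path_def by (intro path_in_join path_in_reversepath)

lemma compose_conjugate_path: "f \<circ> conjugate_path s g = conjugate_path (f \<circ> s) (f \<circ> g)"
  unfolding conjugate_path_def path_compose_join by (auto simp: reversepath_def comp_def)

lemma homotopic_paths_conjugate:
  assumes "homotopic_paths S g g'" "path_in S x y s" "path_in S y y g"
  shows "homotopic_paths S (conjugate_path s g) (conjugate_path s g')"
  unfolding conjugate_path_def using assms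
  by (meson homotopic_paths_join_in homotopic_paths_refl_in path_in_join path_in_reversepath)

lemma homotopic_paths_conjugate_const:
  assumes s: "path_in S x y s"
  shows "homotopic_paths S (conjugate_path s (\<lambda>_. y)) (\<lambda>_. x)"
proof -
  note r = path_in_reversepath[OF s]
  have "y \<in> S" using path_in_endpoints[OF s] by simp
  then have "homotopic_paths S (conjugate_path s (\<lambda>_. y)) (s +++ reversepath s)"
    unfolding conjugate_path_def
    by (intro homotopic_paths_join_in[OF homotopic_paths_refl_in[OF s] homotopic_paths_const_left[OF r] s
        path_in_join[OF path_in_const r]])
  also have "homotopic_paths S (s +++ reversepath s) (\<lambda>_. x)"
    by (rule homotopic_paths_rev_right[OF s])
  finally show ?thesis .
qed

lemma homotopic_paths_conjugate_inverse:
  assumes s: "path_in S x y s" and g: "path_in S x x g"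
  shows "homotopic_paths S g (conjugate_path s (conjugate_path (reversepath s) g))"
proof -
  note r = path_in_reversepath[OF s]
  let ?c = "conjugate_path (reversepath s) g"
  have c: "path_in S y y ?c" by (rule path_in_conjugate[OF r g])
  have gs: "path_in S x y (g +++ s)" by (rule path_in_join[OF g s])
  have "homotopic_paths S (conjugate_path s ?c) ((s +++ ?c) +++ reversepath s)"
    unfolding conjugate_path_def[of s] by (rule homotopic_paths_assoc_in[OF s c r])
  also have "homotopic_paths S \<dots> ((g +++ s) +++ reversepath s)"
  proof (rule homotopic_paths_join_in[OF _ homotopic_paths_refl_in[OF r] path_in_join[OF s c] r])
    show "homotopic_paths S (s +++ ?c) (g +++ s)"
      using homotopic_paths_cancel_left[OF s gs] by (simp add: conjugate_path_def)
  qed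
  also have "homotopic_paths S \<dots> g"
    by (rule homotopic_paths_cancel_right[OF g s])
  finally show ?thesis by (rule homotopic_paths_sym)
qed

lemma conjugate_null_iff: 
  assumes s: "path_in S x y s" and g: "path_in S y y g"
  shows "homotopic_paths S (conjugate_path s g) (\<lambda>_. x) \<longleftrightarrow> homotopic_paths S g (\<lambda>_. y)"
proof
  assume "homotopic_paths S g (\<lambda>_. y)"
  then show "homotopic_paths S (conjugate_path s g) (\<lambda>_. x)"
    using homotopic_paths_conjugate[OF _ s g] homotopic_paths_conjugate_const[OF s] homotopic_paths_trans
    by blast
next
  note r = path_in_reversepath[OF s]
  assume a: "homotopic_paths S (conjugate_path s g) (\<lambda>_. x)"
  have "homotopic_paths S g (conjugate_path (reversepath s) (conjugate_path s g))"
    using homotopic_paths_conjugate_inverse[OF r g] by simp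
  also have "homotopic_paths S \<dots> (conjugate_path (reversepath s) (\<lambda>_. x))"
    by (rule homotopic_paths_conjugate[OF a r path_in_conjugate[OF s g]])
  also have "homotopic_paths S \<dots> (\<lambda>_. y)"
    by (rule homotopic_paths_conjugate_const[OF r])
  finally show "homotopic_paths S g (\<lambda>_. y)" .
qed

text \<open>
  Two ways around a square, and the diagonal, are paths with common ends in a convex set.
\<close>

lemma homotopic_paths_square:
  fixes h :: "real \<times> real \<Rightarrow> 'a::topological_space"
  assumes h: "continuous_on ({0..1} \<times> {0..1}) h" "h ` ({0..1} \<times> {0..1}) \<subseteq> S"
  shows "homotopic_paths S ((\<lambda>t. h (0, t)) +++ (\<lambda>t. h (t, 1))) ((\<lambda>t. h (t, 0)) +++ (\<lambda>t. h (1, t)))"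
    and "homotopic_paths S (\<lambda>t. h (t, t)) ((\<lambda>t. h (t, 0)) +++ (\<lambda>t. h (1, t)))"
proof -
  let ?K = "{0..1::real} \<times> {0..1::real}"
  have K: "convex ?K" by (intro convex_Times convex_real_interval)
  have l: "path_in ?K a b (linepath a b)" if "a \<in> ?K" "b \<in> ?K" for a b
    using that closed_segment_subset[OF that K] by (rule_tac path_in_linepath)
  have p: "path_in ?K (0,0) (1,1) (linepath (0,0) (0,1) +++ linepath (0,1) (1,1))"
      "path_in ?K (0,0) (1,1) (linepath (0,0) (1,0) +++ linepath (1,0) (1,1))"
      "path_in ?K (0,0) (1,1) (linepath (0,0) (1,1))"
    using path_in_join[OF l l] l by auto
  have e: "h \<circ> linepath (0,0) (0,1) = (\<lambda>t. h (0, t))" "h \<circ> linepath (0,1) (1,1) = (\<lambda>t. h (t, 1))"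
     "h \<circ> linepath (0,0) (1,0) = (\<lambda>t. h (t, 0))" "h \<circ> linepath (1,0) (1,1) = (\<lambda>t. h (1, t))"
     "h \<circ> linepath (0,0) (1,1) = (\<lambda>t. h (t, t))"
    by (auto simp: linepath_def)
  show "homotopic_paths S ((\<lambda>t. h (0, t)) +++ (\<lambda>t. h (t, 1))) ((\<lambda>t. h (t, 0)) +++ (\<lambda>t. h (1, t)))"
    using homotopic_paths_image_of_convex[OF K p(1,2) h] by (simp only: path_compose_join e)
  show "homotopic_paths S (\<lambda>t. h (t, t)) ((\<lambda>t. h (t, 0)) +++ (\<lambda>t. h (1, t)))"
    using homotopic_paths_image_of_convex[OF K p(3,2) h] by (simp only: path_compose_join e)
qed

text \<open>
  A free homotopy moves base points along a track \<open>\<tau>\<close>, which depends only on the base point and not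
  on the loop; this uniformity makes it possible to compare two loops afterwards.
\<close>

lemma homotopic_maps_paths:
  fixes \<phi> \<psi> :: "'a::topological_space \<Rightarrow> 'b::topological_space"
  assumes h: "homotopic_maps S T \<phi> \<psi>" and y: "y \<in> S"
  obtains \<tau> where "path_in T (\<phi> y) (\<psi> y) \<tau>"
    and "\<And>g. path_in S y y g \<Longrightarrow> homotopic_paths T ((\<phi> \<circ> g) +++ \<tau>) (\<tau> +++ (\<psi> \<circ> g))"
proof -
  obtain k :: "real \<times> 'a \<Rightarrow> 'b" where "continuous_map (prod_topology (top_of_set {0..1}) (top_of_set S)) (top_of_set T) k \<and>
     (\<forall>x. k (0, x) = \<phi> x) \<and> (\<forall>x. k (1, x) = \<psi> x)"
    using h unfolding homotopic_with_def by blast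
  then have k: "continuous_on ({0..1} \<times> S) k" "k ` ({0..1} \<times> S) \<subseteq> T"
     "\<And>x. k (0, x) = \<phi> x" "\<And>x. k (1, x) = \<psi> x"
    by auto
  have cont: "continuous_on {0..1} (\<lambda>t. k (t, y))"
    by (rule continuous_on_compose2[OF k(1)]) (use y in \<open>auto intro!: continuous_intros\<close>)
  show thesis
  proof
    show "path_in T (\<phi> y) (\<psi> y) (\<lambda>t. k (t, y))"
      using cont k(2-4) y by (auto simp: path_in_def path_def path_image_def pathstart_def pathfinish_def)
    fix g assume g: "path_in S y y g"
    then have g': "continuous_on {0..1} g" "g ` {0..1} \<subseteq> S" "g 0 = y" "g 1 = y"
      by (auto simp: path_in_def path_def path_image_def pathstart_def pathfinish_def)
    have "continuous_on ({0..1} \<times> {0..1}) (\<lambda>z. k (fst z, g (snd z)))"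
      by (rule continuous_on_compose2[OF k(1)])
        (use g' in \<open>auto intro!: continuous_intros continuous_on_compose2[OF g'(1)]\<close>)
    moreover have "(\<lambda>z. k (fst z, g (snd z))) ` ({0..1} \<times> {0..1}) \<subseteq> T"
      using g' k(2) by fastforce
    ultimately show "homotopic_paths T ((\<phi> \<circ> g) +++ (\<lambda>t. k (t, y))) ((\<lambda>t. k (t, y)) +++ (\<psi> \<circ> g))"
      using homotopic_paths_square(1)[of "\<lambda>z. k (fst z, g (snd z))" T] g' k(3,4) by (simp add: comp_def)
  qed
qed

text \<open>
  Pushed along the track \<open>\<tau>\<close>, the loop becomes constant, so the relation of the square reads
  \<open>[\<phi> \<circ> g] [\<tau>] = [\<tau>]\<close>, and \<open>[\<tau>]\<close> cancels.
\<close>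

lemma homotopic_maps_const_null:
  assumes h: "homotopic_maps S T \<phi> (\<lambda>_. c)" and g: "path_in S y y g"
  shows "homotopic_paths T (\<phi> \<circ> g) (\<lambda>_. \<phi> y)"
proof -
  have y: "y \<in> S" using path_in_endpoints[OF g] by simp
  obtain \<tau> where \<tau>: "path_in T (\<phi> y) c \<tau>" "homotopic_paths T ((\<phi> \<circ> g) +++ \<tau>) (\<tau> +++ ((\<lambda>_. c) \<circ> g))"
    using homotopic_maps_paths[OF h y] g by metis
  have \<phi>: "path_in T (\<phi> y) (\<phi> y) (\<phi> \<circ> g)"
    using path_in_compose[OF g] homotopic_with_imp_continuous[OF h] homotopic_with_imp_subset1[OF h] by blast
  have "homotopic_paths T ((\<phi> \<circ> g) +++ \<tau>) \<tau>"
    using \<tau>(2) homotopic_paths_const_right[OF \<tau>(1)] homotopic_paths_trans by (fastforce simp: comp_def)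
  also have "homotopic_paths T \<tau> ((\<lambda>_. \<phi> y) +++ \<tau>)"
    by (rule homotopic_paths_sym[OF homotopic_paths_const_left[OF \<tau>(1)]])
  finally show ?thesis
    using homotopic_paths_join_cancel_right \<phi> \<tau>(1) path_in_const path_in_endpoints[OF \<tau>(1)] by metis
qed

text \<open>
  Simple connectivity is formulated with free homotopies of loops; the base point
  then travels along a loop \<open>\<tau>\<close>, which cancels as before.
\<close>

lemma simply_connected_loop_null:
  fixes S :: "'a::topological_space set"
  assumes "simply_connected S" "path_in S x x g"
  shows "homotopic_paths S g (\<lambda>_. x)"
proof -
  have "homotopic_loops S g (\<lambda>_. x)"
    using assms path_in_endpoints[OF assms(2)] path_in_const[of x S]
    unfolding simply_connected_def path_in_def by auto
  then obtain h :: "real \<times> real \<Rightarrow> 'a" where "continuous_on ({0..1} \<times> {0..1}) h \<and> h \<in> {0..1} \<times> {0..1} \<rightarrow> S \<and>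
      (\<forall>t\<in>{0..1}. h (0, t) = g t) \<and> (\<forall>t\<in>{0..1}. h (1, t) = x) \<and> (\<forall>t\<in>{0..1}. h (t, 1) = h (t, 0))"
    unfolding homotopic_loops pathstart_def pathfinish_def comp_def
    by (elim exE) (erule that)
  then have h: "continuous_on ({0..1} \<times> {0..1}) h" "h ` ({0..1} \<times> {0..1}) \<subseteq> S"
      "\<And>t. t \<in> {0..1} \<Longrightarrow> h (0, t) = g t" "\<And>t. t \<in> {0..1} \<Longrightarrow> h (1, t) = x"
      "\<And>t. t \<in> {0..1} \<Longrightarrow> h (t, 1) = h (t, 0)"
    by auto
  let ?\<tau> = "\<lambda>t. h (t, 0)"
  have "continuous_on {0..1} ?\<tau>"
    by (rule continuous_on_compose2[OF h(1)]) (auto intro!: continuous_intros)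
  then have \<tau>: "path_in S x x ?\<tau>"
    using h assms(2) by (auto simp: path_in_def path_def path_image_def pathstart_def pathfinish_def)
  have xS: "path_in S x x (\<lambda>_. x)" using path_in_const path_in_endpoints[OF assms(2)] by metis
  have e: "homotopic_paths S p q" if "path_in S x x p" "\<And>t. t \<in> {0..1} \<Longrightarrow> p t = q t" for p q
    using that by (intro homotopic_paths_eq) (auto simp: path_in_def)
  have "homotopic_paths S (g +++ ?\<tau>) ((\<lambda>t. h (0, t)) +++ (\<lambda>t. h (t, 1)))"
    by (rule e[OF path_in_join[OF assms(2) \<tau>]]) (auto simp: joinpaths_def h)
  also have "homotopic_paths S \<dots> (?\<tau> +++ (\<lambda>t. h (1, t)))"
    by (rule homotopic_paths_square(1)[OF h(1,2)])
  also have "homotopic_paths S \<dots> (?\<tau> +++ (\<lambda>_. x))"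
    by (rule homotopic_paths_sym[OF e[OF path_in_join[OF \<tau> xS]]]) (auto simp: joinpaths_def h)
  also have "homotopic_paths S \<dots> ?\<tau>"
    by (rule homotopic_paths_const_right[OF \<tau>])
  also have "homotopic_paths S \<dots> ((\<lambda>_. x) +++ ?\<tau>)"
    by (rule homotopic_paths_sym[OF homotopic_paths_const_left[OF \<tau>]])
  finally show ?thesis
    using homotopic_paths_join_cancel_right assms(2) \<tau> xS by metis
qed

section \<open>Coverings: uniqueness of lifts, lifting of paths, monodromy\<close>

lemma covering_space_sheets:
  assumes "covering_space C p S" "x \<in> S"
  obtains W \<V> where "x \<in> W" "openin (top_of_set S) W" "\<Union>\<V> = C \<inter> p -` W"
    "\<And>V. V \<in> \<V> \<Longrightarrow> openin (top_of_set C) V" "pairwise disjnt \<V>"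
    "\<And>V. V \<in> \<V> \<Longrightarrow> \<exists>q. homeomorphism V W p q"
  using assms unfolding covering_space_def by meson

text \<open>
  Around each point, either both lifts stay in one sheet, where the projection is injective, or they
  stay in two disjoint sheets. So the set of agreement and its complement are both open. Disjointness
  of the sheets replaces separation of the total space.
\<close>

lemma lifts_agree:
  fixes p :: "'c::topological_space \<Rightarrow> 'b::topological_space" and T :: "'a::topological_space set"
  assumes cov: "covering_space C p S" and T: "connected T"
    and g1: "continuous_on T g1" "g1 ` T \<subseteq> C" and g2: "continuous_on T g2" "g2 ` T \<subseteq> C"
    and eq: "\<And>x. x \<in> T \<Longrightarrow> p (g1 x) = p (g2 x)"
    and a: "a \<in> T" "g1 a = g2 a" and x: "x \<in> T"
  shows "g1 x = g2 x"
proof -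
  have pre: "openin (top_of_set T) {y \<in> T. g y \<in> V}"
    if "continuous_on T g" "g ` T \<subseteq> C" "openin (top_of_set C) V" for g V
    using continuous_openin_preimage[OF that(1) _ that(3)] that(2)
    by (simp add: image_subset_iff_funcset vimage_def Int_def)
  have *: "\<exists>V1 V2. g1 y \<in> V1 \<and> g2 y \<in> V2 \<and> openin (top_of_set C) V1 \<and> openin (top_of_set C) V2 \<and>
      (V1 \<inter> V2 = {} \<or> g1 y = g2 y \<and> inj_on p (V1 \<union> V2))" if y: "y \<in> T" for y
  proof -
    have in_C: "g1 y \<in> C" "g2 y \<in> C" using y g1 g2 by auto
    then have "p (g1 y) \<in> S" using cov covering_space_imp_surjective by blast
    from covering_space_sheets[OF cov this] obtain W \<V> where W: "p (g1 y) \<in> W" "openin (top_of_set S) W" "\<Union>\<V> = C \<inter> p -` W"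
      "\<And>V. V \<in> \<V> \<Longrightarrow> openin (top_of_set C) V" "pairwise disjnt \<V>"
      "\<And>V. V \<in> \<V> \<Longrightarrow> \<exists>q. homeomorphism V W p q" by metis
    have "g1 y \<in> \<Union>\<V>" "g2 y \<in> \<Union>\<V>" using W(1,3) in_C eq[OF y] by auto
    then obtain V1 V2 where V: "V1 \<in> \<V>" "g1 y \<in> V1" "V2 \<in> \<V>" "g2 y \<in> V2" by auto
    show ?thesis
    proof (cases "V1 = V2")
      case True
      have "inj_on p V1" using W(6)[OF V(1)] by (metis homeomorphism_apply1 inj_onI)
      then show ?thesis using True V W(4) eq[OF y] by (metis Un_absorb inj_onD)
    next
      case False
      then have "V1 \<inter> V2 = {}" using W(5) V by (auto simp: pairwise_def disjnt_def)
      then show ?thesis using V W(4) by blast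
    qed
  qed
  have "openin (top_of_set T) {y \<in> T. g1 y = g2 y}"
  proof (subst openin_subopen, safe)
    fix y assume y: "y \<in> T" "g1 y = g2 y"
    obtain V1 V2 where V: "g1 y \<in> V1" "g2 y \<in> V2" "openin (top_of_set C) V1" "openin (top_of_set C) V2"
      "inj_on p (V1 \<union> V2)" using *[OF y(1)] y(2) by auto
    show "\<exists>N. openin (top_of_set T) N \<and> y \<in> N \<and> N \<subseteq> {y \<in> T. g1 y = g2 y}"
      using V y eq
      by (intro exI[of _ "{y \<in> T. g1 y \<in> V1} \<inter> {y \<in> T. g2 y \<in> V2}"])
        (auto intro!: openin_Int pre g1 g2 dest: inj_onD)
  qed
  moreover have "openin (top_of_set T) {y \<in> T. g1 y \<noteq> g2 y}"
  proof (subst openin_subopen, safe)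
    fix y assume y: "y \<in> T" "g1 y \<noteq> g2 y"
    obtain V1 V2 where V: "g1 y \<in> V1" "g2 y \<in> V2" "openin (top_of_set C) V1" "openin (top_of_set C) V2"
      "V1 \<inter> V2 = {}" using *[OF y(1)] y(2) by auto
    show "\<exists>N. openin (top_of_set T) N \<and> y \<in> N \<and> N \<subseteq> {y \<in> T. g1 y \<noteq> g2 y}"
      using V y
      by (intro exI[of _ "{y \<in> T. g1 y \<in> V1} \<inter> {y \<in> T. g2 y \<in> V2}"])
        (auto intro!: openin_Int pre g1 g2)
  qed
  ultimately have "{y \<in> T. g1 y \<noteq> g2 y} = {}"
    using T a unfolding connected_openin by blast
  then show ?thesis using x by blast
qed

text \<open>
  The property carried through the subdivision of a square: all lifting problems over \<open>A\<close> with one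
  prescribed value are solvable. Prescribing the value at an arbitrary point of \<open>A\<close>, not at a fixed
  corner, makes the property symmetric under gluing.
\<close>

definition lifts_over :: "'c::topological_space set \<Rightarrow> ('c \<Rightarrow> 'b) \<Rightarrow> ('a::topological_space \<Rightarrow> 'b::topological_space) \<Rightarrow> 'a set \<Rightarrow> bool" where
  "lifts_over C p h A \<longleftrightarrow> (\<forall>x\<in>A. \<forall>c\<in>C. p c = h x \<longrightarrow>
     (\<exists>k. continuous_on A k \<and> k ` A \<subseteq> C \<and> (\<forall>y\<in>A. p (k y) = h y) \<and> k x = c))"

lemma lifts_overE:
  assumes "lifts_over C p h A" "x \<in> A" "c \<in> C" "p c = h x"
  obtains k where "continuous_on A k" "k ` A \<subseteq> C" "\<And>y. y \<in> A \<Longrightarrow> p (k y) = h y" "k x = c"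
proof -
  have "\<exists>k. continuous_on A k \<and> k ` A \<subseteq> C \<and> (\<forall>y\<in>A. p (k y) = h y) \<and> k x = c"
    using assms by (simp add: lifts_over_def)
  then show thesis
    using that by (elim exE conjE) simp
qed

text \<open>
  Lift over the piece that contains the prescribed point, then over the other one with the value
  already found at a common point; on the connected intersection both lifts agree.
\<close>

lemma lifts_over_Un:
  assumes cov: "covering_space C p S" and L: "lifts_over C p h A" "lifts_over C p h B"
    and cl: "closed A" "closed B" and AB: "connected (A \<inter> B)" "A \<inter> B \<noteq> {}"
  shows "lifts_over C p h (A \<union> B)"
proof -
  have *: "\<exists>k. continuous_on (A \<union> B) k \<and> k ` (A \<union> B) \<subseteq> C \<and> (\<forall>y\<in>A \<union> B. p (k y) = h y) \<and> k x = c"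
    if L: "lifts_over C p h A" "lifts_over C p h B" and cl: "closed A" "closed B"
      and AB: "connected (A \<inter> B)" "A \<inter> B \<noteq> {}" and x: "x \<in> A" "c \<in> C" "p c = h x" for A B x c
  proof -
    obtain k where k: "continuous_on A k" "k ` A \<subseteq> C" "\<And>y. y \<in> A \<Longrightarrow> p (k y) = h y" "k x = c"
      using lifts_overE[OF L(1) x] by metis
    obtain z where z: "z \<in> A" "z \<in> B" using AB by blast
    have kz: "k z \<in> C" "p (k z) = h z" using k z by auto
    obtain l where l: "continuous_on B l" "l ` B \<subseteq> C" "\<And>y. y \<in> B \<Longrightarrow> p (l y) = h y" "l z = k z"
      using lifts_overE[OF L(2) z(2) kz] by metis
    have agree: "k y = l y" if "y \<in> A \<inter> B" for y
    proof (rule lifts_agree[OF cov AB(1), of k l z])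
      show "continuous_on (A \<inter> B) k" "continuous_on (A \<inter> B) l"
        using k l by (auto intro: continuous_on_subset)
    qed (use k l z that in auto)
    let ?m = "\<lambda>y. if y \<in> A then k y else l y"
    have "continuous_on (A \<union> B) ?m"
      using cl k l agree by (intro continuous_on_cases) auto
    then show ?thesis
      using k l x by (intro exI[of _ ?m]) auto
  qed
  have BA: "connected (B \<inter> A)" "B \<inter> A \<noteq> {}" using AB by (simp_all add: Int_commute)
  show ?thesis
    unfolding lifts_over_def[of C p h "A \<union> B"]
  proof (intro ballI impI)
    fix x c assume "x \<in> A \<union> B" and c: "c \<in> C" "p c = h x"
    then consider "x \<in> A" | "x \<in> B" by blast
    then show "\<exists>k. continuous_on (A \<union> B) k \<and> k ` (A \<union> B) \<subseteq> C \<and> (\<forall>y\<in>A \<union> B. p (k y) = h y) \<and> k x = c"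
      using *[OF L cl AB _ c] *[OF L(2,1) cl(2,1) BA _ c] by cases (simp_all add: Un_commute)
  qed
qed

text \<open>
  Over an evenly covered set, follow the inverse of the projection on the sheet of the given value.
\<close>

lemma lifts_over_evenly_covered:
  assumes cov: "covering_space C p S" and h: "continuous_on K h" "h ` K \<subseteq> S" and x: "x \<in> K"
  obtains N where "openin (top_of_set K) N" "x \<in> N" "\<And>A. A \<subseteq> N \<Longrightarrow> lifts_over C p h A"
proof -
  have "h x \<in> S" using h x by auto
  from covering_space_sheets[OF cov this] obtain W \<V> where W: "h x \<in> W" "openin (top_of_set S) W" "\<Union>\<V> = C \<inter> p -` W"
    "\<And>V. V \<in> \<V> \<Longrightarrow> openin (top_of_set C) V" "\<And>V. V \<in> \<V> \<Longrightarrow> \<exists>q. homeomorphism V W p q" by metis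
  show thesis
  proof
    show "openin (top_of_set K) (K \<inter> h -` W)"
      using continuous_openin_preimage[OF h(1) _ W(2)] h(2) by (simp add: image_subset_iff_funcset)
    show "x \<in> K \<inter> h -` W" using x W by auto
    fix A assume A: "A \<subseteq> K \<inter> h -` W"
    show "lifts_over C p h A"
      unfolding lifts_over_def
    proof safe
      fix y c assume y: "y \<in> A" "c \<in> C" "p c = h y"
      then have "c \<in> \<Union>\<V>" using W A by auto
      then obtain V q where V: "c \<in> V" "V \<in> \<V>" "homeomorphism V W p q"
        using W(5) by (metis UnionE)
      have VC: "V \<subseteq> C" using W V openin_imp_subset by blast
      have "continuous_on A (q \<circ> h)"
        using A continuous_on_subset[OF h(1)] homeomorphism_cont2[OF V(3)]
        by (intro continuous_on_compose) (auto intro: continuous_on_subset)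
      moreover have "(q \<circ> h) ` A \<subseteq> C" using A VC homeomorphism_image2[OF V(3)] by auto
      moreover have "p ((q \<circ> h) z) = h z" if "z \<in> A" for z
        using that A homeomorphism_apply2[OF V(3)] by auto
      moreover have "(q \<circ> h) y = c" using homeomorphism_apply1[OF V(3) V(1)] y by simp
      ultimately show "\<exists>k. continuous_on A k \<and> k ` A \<subseteq> C \<and> (\<forall>y\<in>A. p (k y) = h y) \<and> k y = c" by blast
    qed
  qed
qed

text \<open>
  The tube argument by two applications of the Bolzano induction principle for intervals. The inner one
  shows for each \<open>x\<close> that some neighbourhood of \<open>x\<close> yields liftable strips of full height; the width of
  the strip is part of the statement that is extended upwards. The outer one glues strips.
\<close>

lemma lifts_over_square:
  fixes h :: "real \<times> real \<Rightarrow> 'b::topological_space"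
  assumes cov: "covering_space C p S"
    and h: "continuous_on ({0..1} \<times> {0..1}) h" "h ` ({0..1} \<times> {0..1}) \<subseteq> S"
  shows "lifts_over C p h ({0..1} \<times> {0..1})"
proof -
  let ?L = "lifts_over C p h"
  \<comment> \<open>the strips over intervals around \<open>x\<close> of length below \<open>\<delta>\<close> with vertical range \<open>{c..d}\<close>\<close>
  let ?strip = "\<lambda>x c d. \<exists>\<delta>>0. \<forall>a b. 0 \<le> a \<and> b \<le> 1 \<and> a \<le> x \<and> x \<le> b \<and> b - a < \<delta> \<longrightarrow> ?L ({a..b} \<times> {c..d})"
  have strip: "?strip x 0 1" if x: "0 \<le> x" "x \<le> 1" for x
  proof -
    have "0 \<le> (0::real) \<and> (1::real) \<le> 1 \<longrightarrow> ?strip x 0 1"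
    proof (rule Bolzano[where P = "\<lambda>c d. 0 \<le> c \<and> d \<le> 1 \<longrightarrow> ?strip x c d"])
      fix c d e :: real
      assume ih: "0 \<le> c \<and> d \<le> 1 \<longrightarrow> ?strip x c d" "0 \<le> d \<and> e \<le> 1 \<longrightarrow> ?strip x d e" and cde: "c \<le> d" "d \<le> e"
      show "0 \<le> c \<and> e \<le> 1 \<longrightarrow> ?strip x c e"
      proof
        assume "0 \<le> c \<and> e \<le> 1"
        then obtain \<delta> \<epsilon> where \<delta>: "\<delta> > 0" "\<And>a b. 0 \<le> a \<Longrightarrow> b \<le> 1 \<Longrightarrow> a \<le> x \<Longrightarrow> x \<le> b \<Longrightarrow> b - a < \<delta> \<Longrightarrow> ?L ({a..b} \<times> {c..d})"
          and \<epsilon>: "\<epsilon> > 0" "\<And>a b. 0 \<le> a \<Longrightarrow> b \<le> 1 \<Longrightarrow> a \<le> x \<Longrightarrow> x \<le> b \<Longrightarrow> b - a < \<epsilon> \<Longrightarrow> ?L ({a..b} \<times> {d..e})"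
          using ih cde by force
        show "?strip x c e"
        proof (intro exI[of _ "min \<delta> \<epsilon>"] conjI allI impI)
          fix a b assume ab: "0 \<le> a \<and> b \<le> 1 \<and> a \<le> x \<and> x \<le> b \<and> b - a < min \<delta> \<epsilon>"
          have "{a..b} \<times> {c..d} \<inter> {a..b} \<times> {d..e} = {a..b} \<times> {d}"
            using cde by auto
          then have "?L ({a..b} \<times> {c..d} \<union> {a..b} \<times> {d..e})"
            using ab \<delta> \<epsilon> by (intro lifts_over_Un[OF cov] closed_Times) (auto intro!: connected_Times)
          moreover have "{a..b} \<times> {c..d} \<union> {a..b} \<times> {d..e} = {a..b} \<times> {c..e}"
            using cde by auto
          ultimately show "?L ({a..b} \<times> {c..e})" by simp
        qed (use \<delta> \<epsilon> in auto)
      qed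
    next
      fix y :: real assume y: "0 \<le> y" "y \<le> 1"
      obtain N where N: "openin (top_of_set ({0..1} \<times> {0..1})) N" "(x, y) \<in> N" "\<And>A. A \<subseteq> N \<Longrightarrow> ?L A"
        using lifts_over_evenly_covered[OF cov h, of "(x,y)"] x y by auto
      then obtain r where r: "r > 0" "ball (x,y) r \<inter> {0..1} \<times> {0..1} \<subseteq> N"
        unfolding openin_contains_ball by blast
      have sub: "{a..b} \<times> {c..d} \<subseteq> N"
        if ab: "0 \<le> a" "b \<le> 1" "a \<le> x" "x \<le> b" "b - a < r / 2"
          and cd: "0 \<le> c" "d \<le> 1" "c \<le> y" "y \<le> d" "d - c < r / 2" for a b c d
      proof safe
        fix s t assume st: "s \<in> {a..b}" "t \<in> {c..d}"
        have "dist (x, y) (s, t) \<le> \<bar>x - s\<bar> + \<bar>y - t\<bar>"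
          unfolding dist_Pair_Pair dist_real_def by (rule sqrt_sum_squares_le_sum_abs[THEN order_trans]) auto
        also have "\<dots> < r" using st ab cd by auto
        finally show "(s, t) \<in> N" using st ab cd r(2) by auto
      qed
      show "\<exists>e>0. \<forall>c d. c \<le> y \<and> y \<le> d \<and> d - c < e \<longrightarrow> (0 \<le> c \<and> d \<le> 1 \<longrightarrow> ?strip x c d)"
        using r(1) sub N(3) by (intro exI[of _ "r/2"] conjI allI impI) auto
    qed simp
    then show ?thesis by simp
  qed
  have "0 \<le> (0::real) \<and> (1::real) \<le> 1 \<longrightarrow> ?L ({0..1} \<times> {0..1})"
  proof (rule Bolzano[where P = "\<lambda>a b. 0 \<le> a \<and> b \<le> 1 \<longrightarrow> ?L ({a..b} \<times> {0..1})"])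
    fix a b c :: real
    assume ih: "0 \<le> a \<and> b \<le> 1 \<longrightarrow> ?L ({a..b} \<times> {0..1})" "0 \<le> b \<and> c \<le> 1 \<longrightarrow> ?L ({b..c} \<times> {0..1})"
      and abc: "a \<le> b" "b \<le> c"
    show "0 \<le> a \<and> c \<le> 1 \<longrightarrow> ?L ({a..c} \<times> {0..1})"
    proof
      assume ac: "0 \<le> a \<and> c \<le> 1"
      have "{a..b} \<times> {0..1} \<inter> {b..c} \<times> {0..1} = {b} \<times> {0..1::real}"
        using abc by auto
      then have "?L ({a..b} \<times> {0..1} \<union> {b..c} \<times> {0..1})"
        using ih abc ac by (intro lifts_over_Un[OF cov] closed_Times) (auto intro!: connected_Times)
      moreover have "{a..b} \<times> {0..1} \<union> {b..c} \<times> {0..1::real} = {a..c} \<times> {0..1}"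
        using abc by auto
      ultimately show "?L ({a..c} \<times> {0..1})" by simp
    qed
  next
    fix x :: real assume "0 \<le> x" "x \<le> 1"
    from strip[OF this] show "\<exists>d>0. \<forall>a b. a \<le> x \<and> x \<le> b \<and> b - a < d \<longrightarrow> 0 \<le> a \<and> b \<le> 1 \<longrightarrow> ?L ({a..b} \<times> {0..1})"
      by blast
  qed simp
  then show ?thesis by simp
qed

text \<open>
  A path is a map on the square that ignores the second coordinate.
\<close>

lemma covering_path_lift:
  assumes cov: "covering_space C p S" and g: "path_in S (p c) y g" and c: "c \<in> C"
  obtains k d where "path_in C c d k" "\<And>t. t \<in> {0..1} \<Longrightarrow> p (k t) = g t" "p d = y"
proof -
  let ?I = "{0..1} :: real set"
  have g': "continuous_on ?I g" "g ` ?I \<subseteq> S" "g 0 = p c" "g 1 = y"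
    using g by (auto simp: path_in_def path_def path_image_def pathstart_def pathfinish_def)
  have "continuous_on (?I \<times> ?I) (g \<circ> fst)" "(g \<circ> fst) ` (?I \<times> ?I) \<subseteq> S"
    using g' by (auto intro!: continuous_on_compose2[OF g'(1)] continuous_intros simp: comp_def)
  note L = lifts_over_square[OF cov this]
  have c0: "p c = (g \<circ> fst) (0, 0 :: real)" using g' by simp
  have "(0, 0) \<in> ?I \<times> ?I" by simp
  from lifts_overE[OF L this c c0] obtain k where k: "continuous_on (?I \<times> ?I) k" "k ` (?I \<times> ?I) \<subseteq> C"
      "\<And>z. z \<in> ?I \<times> ?I \<Longrightarrow> p (k z) = (g \<circ> fst) z" "k (0, 0) = c"
    by metis
  have "continuous_on ?I (\<lambda>t. k (t, 0))"
    by (rule continuous_on_compose2[OF k(1)]) (auto intro!: continuous_intros)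
  then have "path_in C c (k (1, 0)) (\<lambda>t. k (t, 0))"
    using k by (auto simp: path_in_def path_def path_image_def pathstart_def pathfinish_def)
  then show thesis
    using that k(3) g'(4) by auto
qed

text \<open>
  Lift the whole homotopy. The lift is constant on the two sides on which the homotopy is constant,
  and by uniqueness its other two sides are the given lifts.
\<close>

lemma covering_monodromy:
  fixes p :: "'c::topological_space \<Rightarrow> 'b::topological_space"
  assumes cov: "covering_space C p S" and hom: "homotopic_paths S g1 g2"
    and k1: "path_in C c d1 k1" "\<And>t. t \<in> {0..1} \<Longrightarrow> p (k1 t) = g1 t"
    and k2: "path_in C c d2 k2" "\<And>t. t \<in> {0..1} \<Longrightarrow> p (k2 t) = g2 t"
  shows "d1 = d2"
proof -
  let ?I = "{0..1} :: real set"
  obtain h :: "real \<times> real \<Rightarrow> 'b" where "continuous_on (?I \<times> ?I) h \<and> h \<in> ?I \<times> ?I \<rightarrow> S \<and>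
      (\<forall>t\<in>?I. h (0, t) = g1 t) \<and> (\<forall>t\<in>?I. h (1, t) = g2 t) \<and>
      (\<forall>t\<in>?I. h (t, 0) = g1 0 \<and> h (t, 1) = g1 1)"
    using hom unfolding homotopic_paths pathstart_def pathfinish_def comp_def
    by (elim exE) (erule that)
  then have h: "continuous_on (?I \<times> ?I) h" "h ` (?I \<times> ?I) \<subseteq> S" 
      "\<And>t. t \<in> ?I \<Longrightarrow> h (0, t) = g1 t" "\<And>t. t \<in> ?I \<Longrightarrow> h (1, t) = g2 t" 
      "\<And>t. t \<in> ?I \<Longrightarrow> h (t, 0) = g1 0" "\<And>t. t \<in> ?I \<Longrightarrow> h (t, 1) = g1 1"
    by (auto simp del: atLeastAtMost_iff)
  have k1': "continuous_on ?I k1" "k1 ` ?I \<subseteq> C" "k1 0 = c" "k1 1 = d1" "c \<in> C"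
   and k2': "continuous_on ?I k2" "k2 ` ?I \<subseteq> C" "k2 0 = c" "k2 1 = d2"
    using k1(1) k2(1) path_in_endpoints by (auto simp: path_in_def path_def path_image_def pathstart_def pathfinish_def)
  have I: "0 \<in> ?I" "1 \<in> ?I" "connected ?I" by auto
  have "p c = h (0, 0)" using k1(2)[OF I(1)] k1'(3) h(3)[OF I(1)] by simp
  moreover have "(0, 0) \<in> ?I \<times> ?I" by simp
  ultimately obtain k where k: "continuous_on (?I \<times> ?I) k" "k ` (?I \<times> ?I) \<subseteq> C"
      "\<And>z. z \<in> ?I \<times> ?I \<Longrightarrow> p (k z) = h z" "k (0, 0) = c"
    using lifts_overE[OF lifts_over_square[OF cov h(1,2)] _ k1'(5)] by metis
  have lift: "l1 t = l2 t" if "continuous_on ?I l1" "l1 ` ?I \<subseteq> C" "continuous_on ?I l2" "l2 ` ?I \<subseteq> C"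
     "\<And>t. t \<in> ?I \<Longrightarrow> p (l1 t) = p (l2 t)" "l1 0 = l2 0" "t \<in> ?I" for l1 l2 :: "real \<Rightarrow> _" and t
    using lifts_agree[OF cov I(3) that(1-5) I(1) that(6,7)] .
  have c1: "continuous_on ?I (\<lambda>t. k (a, t))" if "a \<in> ?I" for a
    using that by (intro continuous_on_compose2[OF k(1)]) (auto intro!: continuous_intros)
  have c2: "continuous_on ?I (\<lambda>t. k (t, a))" if "a \<in> ?I" for a
    using that by (intro continuous_on_compose2[OF k(1)]) (auto intro!: continuous_intros)
  have bot: "k (t, 0) = c" if "t \<in> ?I" for t
    by (rule lift[OF c2 _ continuous_on_const _ _ _ that])
      (use I k k1' h in \<open>auto simp del: atLeastAtMost_iff\<close>)
  have "k1 t = k (0, t)" if "t \<in> ?I" for t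
    by (rule lift[OF k1'(1,2) c1 _ _ _ that])
      (use I k k1' k1(2) h in \<open>auto simp del: atLeastAtMost_iff\<close>)
  moreover have "k2 t = k (1, t)" if "t \<in> ?I" for t
    by (rule lift[OF k2'(1,2) c1 _ _ _ that])
      (use I k k2' k2(2) h bot in \<open>auto simp del: atLeastAtMost_iff\<close>)
  moreover have "k (t, 1) = k (0, 1)" if "t \<in> ?I" for t
    by (rule lift[OF c2 _ continuous_on_const _ _ _ that])
      (use I k k1' h in \<open>auto simp del: atLeastAtMost_iff\<close>)
  ultimately show ?thesis using I k1'(4) k2'(4) by metis
qed

section \<open>The lifting criterion\<close>

lemma continuous_on_open_neighbourhoods:
  assumes "\<And>x. x \<in> S \<Longrightarrow> \<exists>N. openin (top_of_set S) N \<and> x \<in> N \<and> continuous_on N f"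
  shows "continuous_on S f"
  unfolding continuous_on_def
proof
  fix x assume x: "x \<in> S"
  obtain N where N: "openin (top_of_set S) N" "x \<in> N" "continuous_on N f"
    using assms[OF x] by blast
  then obtain O' where O: "open O'" "N = S \<inter> O'" by (auto simp: openin_open)
  have "at x within N = at x within S"
    using N O by (intro at_within_nhd[of x O']) auto
  then show "(f \<longlongrightarrow> f x) (at x within S)"
    using N unfolding continuous_on_def by metis
qed

definition has_lift ::
    "'c::topological_space set \<Rightarrow> ('c \<Rightarrow> 'b) \<Rightarrow> 'a::topological_space set \<Rightarrow> ('a \<Rightarrow> 'b) \<Rightarrow> bool" where
  "has_lift C p P f \<longleftrightarrow> (\<exists>l. continuous_on P l \<and> l ` P \<subseteq> C \<and> (\<forall>x\<in>P. p (l x) = f x))"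

text \<open>
  Let \<open>E\<close> be the set of pairs \<open>(y, c)\<close> with \<open>f y = p c\<close>. A path in \<open>E\<close> is a path in \<open>P\<close> together with a lift
  of its image. Choose a base point \<open>b\<close> in each path component of \<open>P\<close> and a point over \<open>f b\<close>
  as in the hypothesis. The graph of the lift is the union of the path components in \<open>E\<close> of the chosen
  pairs: monodromy and the hypothesis on loops show that it contains at most one point over each \<open>y\<close>.
  As base points are chosen for all components, \<open>P\<close> may be disconnected, which is needed for open
  subsets and for pullbacks.
\<close>

theorem lifting_criterion:
  fixes p :: "'c::topological_space \<Rightarrow> 'b::topological_space" and f :: "'a::topological_space \<Rightarrow> 'b"
  assumes cov: "covering_space C p S" and P: "locally path_connected P"
    and f: "continuous_on P f" "f ` P \<subseteq> S"
    and base: "\<And>z. z \<in> P \<Longrightarrow> \<exists>a\<in>C. p a = f z \<and>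
       (\<forall>g. path_in P z z g \<longrightarrow> (\<exists>q. path_in C a a q \<and> homotopic_paths S (f \<circ> g) (p \<circ> q)))"
  shows "has_lift C p P f"
proof -
  obtain A where A: "\<And>z. z \<in> P \<Longrightarrow> A z \<in> C" "\<And>z. z \<in> P \<Longrightarrow> p (A z) = f z"
    "\<And>z g. z \<in> P \<Longrightarrow> path_in P z z g \<Longrightarrow> \<exists>q. path_in C (A z) (A z) q \<and> homotopic_paths S (f \<circ> g) (p \<circ> q)"
    using base by metis
  have p: "continuous_on C p" "p ` C \<subseteq> S"
    using covering_space_imp_continuous[OF cov] covering_space_imp_surjective[OF cov] by auto
  define reach where "reach z y c \<longleftrightarrow> (\<exists>g k. path_in P z y g \<and> path_in C (A z) c k \<and>
     (\<forall>t\<in>{0..1}. p (k t) = f (g t)))" for z y c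
  have reach_unique: "c = d" if z: "z \<in> P" and c: "reach z y c" and d: "reach z y d" for z y c d
  proof -
    obtain g k where g: "path_in P z y g" and k: "path_in C (A z) c k" "\<And>t. t \<in> {0..1} \<Longrightarrow> p (k t) = f (g t)"
      using c unfolding reach_def by blast
    obtain g' k' where g': "path_in P z y g'" and k': "path_in C (A z) d k'" "\<And>t. t \<in> {0..1} \<Longrightarrow> p (k' t) = f (g' t)"
      using d unfolding reach_def by blast
    obtain q where q: "path_in C (A z) (A z) q"
      and hom: "homotopic_paths S (f \<circ> (g +++ reversepath g')) (p \<circ> q)"
      using A(3)[OF z path_in_join[OF g path_in_reversepath[OF g']]] by blast
    have fg: "path_in S (f z) (f y) (f \<circ> g)" "path_in S (f z) (f y) (f \<circ> g')"
      using path_in_compose f g g' by blast+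
    have e: "f \<circ> (g +++ reversepath g') = (f \<circ> g) +++ reversepath (f \<circ> g')"
      unfolding path_compose_join by (auto simp: reversepath_def comp_def)
    \<comment> \<open>replace the loop \<open>g g'\<^sup>-\<^sup>1\<close> by the projection of a loop \<open>q\<close> in \<open>C\<close>; then \<open>k\<close> and \<open>q k'\<close> lift homotopic paths\<close>
    have "homotopic_paths S (f \<circ> g) (((f \<circ> g) +++ reversepath (f \<circ> g')) +++ (f \<circ> g'))"
      using homotopic_paths_sym[OF homotopic_paths_cancel_right[OF fg(1) path_in_reversepath[OF fg(2)]]] by simp
    also have "homotopic_paths S \<dots> ((p \<circ> q) +++ (f \<circ> g'))"
      by (rule homotopic_paths_join_in[OF hom[unfolded e] homotopic_paths_refl_in[OF fg(2)]
          path_in_join[OF fg(1) path_in_reversepath[OF fg(2)]] fg(2)])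
    finally have "homotopic_paths S (f \<circ> g) ((p \<circ> q) +++ (f \<circ> g'))" .
    from covering_monodromy[OF cov this k(1) _ path_in_join[OF q k'(1)]] show "c = d"
      using k(2) k'(2) by (auto simp: joinpaths_def)
  qed
  \<comment> \<open>one base point for each path component of the domain\<close>
  define b where "b y = (SOME z. z \<in> path_component_set P y)" for y
  have b: "path_component P y (b y)" if "y \<in> P" for y
    unfolding b_def using someI[of "\<lambda>z. z \<in> path_component_set P y" y] that by (auto simp: path_component_refl)
  have b_eq: "b y' = b y" if "path_component P y y'" for y y'
    using path_component_eq[of y' P y] that unfolding b_def by simp
  have bP: "b y \<in> P" if "y \<in> P" for y using path_component_mem(2)[OF b[OF that]] .
  define l where "l y = (THE c. reach (b y) y c)" for y
  have l: "reach (b y) y (l y)" if y: "y \<in> P" for y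
  proof -
    obtain g where g: "path_in P (b y) y g"
      using path_component_sym[OF b[OF y]] unfolding path_component_def path_in_def by blast
    have "path_in S (p (A (b y))) (f y) (f \<circ> g)"
      using path_in_compose[OF g f] A(2)[OF bP[OF y]] by simp
    from covering_path_lift[OF cov this A(1)[OF bP[OF y]]] obtain k c where
      "path_in C (A (b y)) c k" "\<And>t. t \<in> {0..1} \<Longrightarrow> p (k t) = (f \<circ> g) t" by metis
    then have "reach (b y) y c" using g unfolding reach_def comp_def by blast
    then show ?thesis unfolding l_def using theI[of "reach (b y) y"] reach_unique[OF bP[OF y]] by metis
  qed
  have lC: "l y \<in> C" "p (l y) = f y" if y: "y \<in> P" for y
  proof -
    obtain g k where g: "path_in P (b y) y g" and k: "path_in C (A (b y)) (l y) k" "\<forall>t\<in>{0..1}. p (k t) = f (g t)"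
      using l[OF y] unfolding reach_def by blast
    show "l y \<in> C" using path_in_endpoints[OF k(1)] by simp
    have "p (k 1) = f (g 1)" using k(2) by simp
    then show "p (l y) = f y" using k(1) g by (simp add: path_in_def pathfinish_def)
  qed
  have "continuous_on P l"
  proof (rule continuous_on_open_neighbourhoods)
    fix y assume y: "y \<in> P"
    have "f y \<in> S" using f y by auto
    from covering_space_sheets[OF cov this] obtain W \<V> where W: "f y \<in> W" "openin (top_of_set S) W" "\<Union>\<V> = C \<inter> p -` W"
      "\<And>V. V \<in> \<V> \<Longrightarrow> openin (top_of_set C) V" "\<And>V. V \<in> \<V> \<Longrightarrow> \<exists>q. homeomorphism V W p q" by metis
    have "l y \<in> \<Union>\<V>" using W lC[OF y] by auto
    then obtain V q where V: "l y \<in> V" "V \<in> \<V>" "homeomorphism V W p q" using W(5) by (metis UnionE)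
    have VC: "V \<subseteq> C" using W V openin_imp_subset by blast
    have "openin (top_of_set P) (P \<inter> f -` W)"
      using continuous_openin_preimage[OF f(1) _ W(2)] f(2) by (simp add: image_subset_iff_funcset)
    then obtain N where N: "openin (top_of_set P) N" "path_connected N" "y \<in> N" "N \<subseteq> P \<inter> f -` W"
      using P y W(1) unfolding locally_path_connected by (meson IntI vimageI)
    have qf: "continuous_on N (q \<circ> f)" "(q \<circ> f) ` N \<subseteq> C"
    proof -
      show "continuous_on N (q \<circ> f)"
        using N(4) continuous_on_subset[OF f(1)] homeomorphism_cont2[OF V(3)]
        by (intro continuous_on_compose) (auto intro: continuous_on_subset)
      show "(q \<circ> f) ` N \<subseteq> C"
        using N(4) VC homeomorphism_image2[OF V(3)] by auto
    qed
    \<comment> \<open>near \<open>y\<close> the lift is \<open>q \<circ> f\<close>: prolong paths from the base point to \<open>y\<close> inside \<open>N\<close>\<close>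
    have "l y' = (q \<circ> f) y'" if y': "y' \<in> N" for y'
    proof -
      obtain \<gamma> where \<gamma>: "path_in N y y' \<gamma>"
        using N(2,3) y' unfolding path_connected_def path_in_def by blast
      have \<gamma>P: "path_in P y y' \<gamma>" using \<gamma> N(4) unfolding path_in_def by blast
      then have "b y' = b y" using b_eq unfolding path_component_def path_in_def by blast
      moreover have "reach (b y) y' ((q \<circ> f) y')"
      proof -
        obtain g k where g: "path_in P (b y) y g" and k: "path_in C (A (b y)) (l y) k" "\<forall>t\<in>{0..1}. p (k t) = f (g t)"
          using l[OF y] unfolding reach_def by blast
        have "(q \<circ> f) y = l y" using homeomorphism_apply1[OF V(3) V(1)] lC[OF y] by simp
        then have "path_in C (l y) ((q \<circ> f) y') ((q \<circ> f) \<circ> \<gamma>)"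
          using path_in_compose[OF \<gamma> qf] by simp
        then have "path_in C (A (b y)) ((q \<circ> f) y') (k +++ ((q \<circ> f) \<circ> \<gamma>))"
          by (rule path_in_join[OF k(1)])
        moreover have "p (q (f (\<gamma> t))) = f (\<gamma> t)" if "t \<in> {0..1}" for t
          using path_in_mem[OF \<gamma> that] N(4) homeomorphism_apply2[OF V(3)] by auto
        then have "\<forall>t\<in>{0..1}. p ((k +++ ((q \<circ> f) \<circ> \<gamma>)) t) = f ((g +++ \<gamma>) t)"
          using k(2) by (auto simp: joinpaths_def)
        ultimately show ?thesis
          unfolding reach_def using path_in_join[OF g \<gamma>P] by blast
      qed
      ultimately show ?thesis using l[of y'] reach_unique[OF bP[OF y]] y' N(4) by auto
    qed
    then have "continuous_on N l" using qf(1) continuous_on_cong by metis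
    then show "\<exists>N. openin (top_of_set P) N \<and> y \<in> N \<and> continuous_on N l" using N by blast
  qed
  then show ?thesis unfolding has_lift_def using lC by blast
qed

lemma connected_locally_path_connected_imp_path_connected:
  assumes "connected S" "locally path_connected S"
  shows "path_connected S"
  unfolding path_connected_component
proof (intro ballI)
  fix x y assume "x \<in> S" "y \<in> S"
  have "path_component_set S x = {} \<or> path_component_set S x = S"
    using assms openin_path_component_locally_path_connected closedin_path_component_locally_path_connected
    unfolding connected_clopen by metis
  then show "path_component S x y" using \<open>x \<in> S\<close> \<open>y \<in> S\<close> path_component_refl by blast
qed

lemma locally_path_connected_local_homeomorphism:
  assumes B: "locally path_connected B"
    and loc: "\<And>x. x \<in> E \<Longrightarrow> \<exists>V W p q. x \<in> V \<and> openin (top_of_set E) V \<and> openin (top_of_set B) W \<and> homeomorphism V W p q"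
  shows "locally path_connected E"
  unfolding locally_def
proof (intro allI impI, elim conjE)
  fix w x assume w: "openin (top_of_set E) w" "x \<in> w"
  then have "x \<in> E" using openin_imp_subset by blast
  then obtain V W p q where V: "x \<in> V" "openin (top_of_set E) V" "openin (top_of_set B) W" "homeomorphism V W p q"
    using loc by metis
  have "openin (top_of_set V) (V \<inter> w)"
    using V(2) w(1) openin_imp_subset by (metis Int_lower1 openin_Int openin_subset_trans)
  then have "openin (top_of_set W) (p ` (V \<inter> w))"
    using homeomorphism_imp_open_map V(4) by blast
  then have "openin (top_of_set B) (p ` (V \<inter> w))" using openin_trans V(3) by blast
  moreover have "p x \<in> p ` (V \<inter> w)" using V w by blast
  ultimately obtain u where u: "openin (top_of_set B) u" "path_connected u" "p x \<in> u" "u \<subseteq> p ` (V \<inter> w)"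
    using B unfolding locally_path_connected by meson
  have uW: "u \<subseteq> W" using u(4) homeomorphism_image1[OF V(4)] by blast
  have "openin (top_of_set W) u" using u(1) uW V(3) openin_imp_subset by (metis openin_subset_trans)
  then have "openin (top_of_set V) (q ` u)"
    using homeomorphism_imp_open_map homeomorphism_symD V(4) by blast
  then have "openin (top_of_set E) (q ` u)" using openin_trans V(2) by blast
  moreover have "path_connected (q ` u)"
    using u(2) uW homeomorphism_cont2[OF V(4)] by (meson path_connected_continuous_image continuous_on_subset)
  moreover have "x \<in> q ` u" using u(3) homeomorphism_apply1[OF V(4) V(1)] by (metis imageI)
  moreover have "q ` u \<subseteq> w" using u(4) homeomorphism_apply1[OF V(4)] by force
  ultimately show "\<exists>U T. openin (top_of_set E) U \<and> path_connected T \<and> x \<in> U \<and> U \<subseteq> T \<and> T \<subseteq> w" by blast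
qed

lemma locally_path_connected_covering:
  assumes "covering_space C p S" "locally path_connected S"
  shows "locally path_connected C"
  using covering_space_local_homeomorphism[OF assms(1)]
  by (intro locally_path_connected_local_homeomorphism[OF assms(2)]) metis

text \<open>
  Over the preimage of an evenly covered set a sheet of the pullback is the graph of a local inverse
  of the covering composed with \<open>f\<close>.
\<close>

lemma locally_path_connected_pullback:
  assumes cov: "covering_space C p S" and P: "locally path_connected P"
    and f: "continuous_on P f" "f ` P \<subseteq> S"
  shows "locally path_connected (pullback P f C p)"
proof (rule locally_path_connected_local_homeomorphism[OF P])
  let ?E = "pullback P f C p"
  fix z assume "z \<in> ?E"
  then obtain x c where z: "z = (x, c)" "x \<in> P" "c \<in> C" "f x = p c" by (auto simp: pullback_def)
  obtain T W q where T: "c \<in> T" "openin (top_of_set C) T" "p c \<in> W" "openin (top_of_set S) W" "homeomorphism T W p q"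
    using covering_space_local_homeomorphism[OF cov z(3)] by metis
  have TC: "T \<subseteq> C" using T(2) openin_imp_subset by blast
  define V where "V = {y \<in> ?E. snd y \<in> T}"
  define N where "N = P \<inter> f -` W"
  have "snd \<in> ?E \<rightarrow> C" by (auto simp: pullback_def)
  from continuous_openin_preimage[OF continuous_on_snd[OF continuous_on_id] this T(2)]
  have "openin (top_of_set ?E) V" by (simp add: V_def vimage_def Int_def)
  moreover have "openin (top_of_set P) N"
    unfolding N_def using continuous_openin_preimage[OF f(1) _ T(4)] f(2) by (simp add: image_subset_iff_funcset)
  moreover have "homeomorphism V N fst (\<lambda>x. (x, q (f x)))"
  proof (rule homeomorphismI)
    show "continuous_on V fst" by (intro continuous_intros)
    have "continuous_on N (q \<circ> f)"
      using continuous_on_subset[OF f(1)] homeomorphism_cont2[OF T(5)] unfolding N_def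
      by (intro continuous_on_compose) (auto intro: continuous_on_subset)
    then show "continuous_on N (\<lambda>x. (x, q (f x)))" by (auto intro!: continuous_intros simp: comp_def)
    show "fst ` V \<subseteq> N" using homeomorphism_image1[OF T(5)] by (auto simp: V_def N_def pullback_def)
    show "(\<lambda>x. (x, q (f x))) ` N \<subseteq> V"
      using homeomorphism_image2[OF T(5)] homeomorphism_apply2[OF T(5)] TC by (auto simp: V_def N_def pullback_def)
    show "(fst y, q (f (fst y))) = y" if "y \<in> V" for y
      using that homeomorphism_apply1[OF T(5)] by (auto simp: V_def pullback_def)
  qed auto
  moreover have "z \<in> V" using z T by (auto simp: V_def pullback_def)
  ultimately show "\<exists>V W p q. z \<in> V \<and> openin (top_of_set ?E) V \<and> openin (top_of_set P) W \<and> homeomorphism V W p q"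
    by blast
qed

section \<open>Loops in an H-space with a right inversion\<close>

text \<open>
  A self-map that is freely homotopic to the identity is injective on fundamental groups: up to
  conjugation by the track of the base point it induces the identity.
\<close>

lemma homotopic_maps_homotopic_paths_cancel:
  assumes h: "homotopic_maps S S \<phi> (\<lambda>x. x)" and a: "path_in S y y a" and b: "path_in S y y b"
    and ab: "homotopic_paths S (\<phi> \<circ> a) (\<phi> \<circ> b)"
  shows "homotopic_paths S a b"
proof -
  have y: "y \<in> S" using path_in_endpoints[OF a] by simp
  obtain \<tau> where \<tau>: "path_in S (\<phi> y) y \<tau>"
    "\<And>g. path_in S y y g \<Longrightarrow> homotopic_paths S ((\<phi> \<circ> g) +++ \<tau>) (\<tau> +++ ((\<lambda>x. x) \<circ> g))"
    using homotopic_maps_paths[OF h y] by metis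
  have id: "(\<lambda>x. x) \<circ> g = g" for g :: "real \<Rightarrow> 'a" by auto
  have \<phi>: "path_in S (\<phi> y) (\<phi> y) (\<phi> \<circ> a)"
    using path_in_compose[OF a] homotopic_with_imp_continuous[OF h] homotopic_with_imp_subset1[OF h] by blast
  have "homotopic_paths S (\<tau> +++ a) ((\<phi> \<circ> a) +++ \<tau>)"
    using \<tau>(2)[OF a] homotopic_paths_sym unfolding id by blast
  also have "homotopic_paths S \<dots> ((\<phi> \<circ> b) +++ \<tau>)"
    by (rule homotopic_paths_join_in[OF ab homotopic_paths_refl_in[OF \<tau>(1)] \<phi> \<tau>(1)])
  also have "homotopic_paths S \<dots> (\<tau> +++ b)"
    using \<tau>(2)[OF b] unfolding id .
  finally show ?thesis by (rule homotopic_paths_join_cancel_left[OF _ a b \<tau>(1)])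
qed

text \<open>
  Move the factor \<open>d\<close> to the unit along a path.
\<close>

lemma H_space_right_translation:
  assumes H: "H_space G mu e" and G: "path_connected G" and d: "d \<in> G"
  shows "homotopic_maps G G (\<lambda>x. mu (x, d)) (\<lambda>x. x)"
proof -
  have e: "e \<in> G" and mu: "continuous_on (G \<times> G) mu" "mu ` (G \<times> G) \<subseteq> G"
    and unit: "homotopic_maps G G (\<lambda>x. mu (x, e)) (\<lambda>x. x)"
    using H by (auto simp: H_space_def)
  obtain s where s: "path_in G d e s"
    using G d e unfolding path_connected_def path_in_def by metis
  then have s': "continuous_on {0..1} s" "\<And>t. t \<in> {0..1} \<Longrightarrow> s t \<in> G" "s 0 = d" "s 1 = e"
    by (auto simp: path_in_def path_def path_image_def pathstart_def pathfinish_def)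
  have "homotopic_maps G G (\<lambda>x. mu (x, d)) (\<lambda>x. mu (x, e))"
    unfolding homotopic_with_def
  proof (intro exI conjI)
    have "continuous_on ({0..1} \<times> G) (\<lambda>z. mu (snd z, s (fst z)))"
      by (rule continuous_on_compose2[OF mu(1)])
        (use s' in \<open>auto intro!: continuous_intros continuous_on_compose2[OF s'(1)]\<close>)
    then show "continuous_map (prod_topology (top_of_set {0..1}) (top_of_set G)) (top_of_set G)
        (\<lambda>z. mu (snd z, s (fst z)))"
      using mu(2) s'(2) by force
  qed (auto simp: s')
  then show ?thesis using unit homotopic_with_trans by blast
qed

text \<open>
  The diagonal of the square of products is homotopic to two of its sides.
\<close>

lemma paths_multiply:
  assumes mu: "continuous_on (G \<times> G) mu" "mu ` (G \<times> G) \<subseteq> G"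
    and a: "path_in G x x' a" and b: "path_in G y y' b"
  shows "homotopic_paths G (\<lambda>t. mu (a t, b t)) ((\<lambda>t. mu (a t, y)) +++ (\<lambda>t. mu (x', b t)))"
proof -
  have a': "continuous_on {0..1} a" "\<And>t. t \<in> {0..1} \<Longrightarrow> a t \<in> G" "a 1 = x'"
   and b': "continuous_on {0..1} b" "\<And>t. t \<in> {0..1} \<Longrightarrow> b t \<in> G" "b 0 = y"
    using a b by (auto simp: path_in_def path_def path_image_def pathstart_def pathfinish_def)
  have "continuous_on ({0..1} \<times> {0..1}) (\<lambda>z. mu (a (fst z), b (snd z)))"
    by (rule continuous_on_compose2[OF mu(1)])
      (use a' b' in \<open>auto intro!: continuous_intros continuous_on_compose2[OF a'(1)] continuous_on_compose2[OF b'(1)]\<close>)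
  moreover have "(\<lambda>z. mu (a (fst z), b (snd z))) ` ({0..1} \<times> {0..1}) \<subseteq> G"
    using mu(2) a' b' by fastforce
  ultimately show ?thesis
    using homotopic_paths_square(2)[of "\<lambda>z. mu (a (fst z), b (snd z))" G] a'(3) b'(3) by simp
qed

lemma F_two_diagonal_null:
  assumes inv: "right_inversion G mu e eta" and a: "path_in G y y a"
  shows "homotopic_paths G (\<lambda>t. F_two mu eta (a t, a t)) (\<lambda>_. F_two mu eta (y, y))"
  using homotopic_maps_const_null[OF _ a, of G "\<lambda>x. mu (x, eta x)" e] inv
  by (simp add: right_inversion_def F_two_def comp_def)

text \<open>
  This is the injectivity behind the theorem: if \<open>a b\<^sup>-\<^sup>1\<close> is trivial then \<open>a = b\<close> in the fundamental group.
  Put \<open>d = eta y\<close>. By the product formula the null loops \<open>mu (a, eta \<circ> b)\<close> and \<open>mu (b, eta \<circ> b)\<close> are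
  \<open>mu (a, d)\<close> and \<open>mu (b, d)\<close> followed by the same loop. Hence \<open>mu (a, d)\<close> and \<open>mu (b, d)\<close> are homotopic,
  and right translation by \<open>d\<close> is injective on loops.
\<close>

lemma F_two_null_imp_homotopic:
  assumes H: "H_space G mu e" and inv: "right_inversion G mu e eta" and G: "path_connected G"
    and a: "path_in G y y a" and b: "path_in G y y b"
    and null: "homotopic_paths G (\<lambda>t. F_two mu eta (a t, b t)) (\<lambda>_. F_two mu eta (y, y))"
  shows "homotopic_paths G a b"
proof -
  have mu: "continuous_on (G \<times> G) mu" "mu ` (G \<times> G) \<subseteq> G" using H by (auto simp: H_space_def)
  have eta: "continuous_on G eta" "eta ` G \<subseteq> G" using inv by (auto simp: right_inversion_def)
  let ?d = "eta y"
  have y: "y \<in> G" using path_in_endpoints[OF a] by simp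
  then have d: "?d \<in> G" using eta by auto
  have eb: "path_in G ?d ?d (eta \<circ> b)" by (rule path_in_compose[OF b eta])
  have ra: "path_in G (mu (y, ?d)) (mu (y, ?d)) ((\<lambda>x. mu (x, ?d)) \<circ> c)" if "path_in G y y c" for c
    by (rule path_in_compose[OF that])
      (use mu d in \<open>auto intro!: continuous_intros continuous_on_compose2[OF mu(1)]\<close>)
  have le: "path_in G (mu (y, ?d)) (mu (y, ?d)) ((\<lambda>x. mu (y, x)) \<circ> (eta \<circ> b))"
    by (rule path_in_compose[OF eb])
      (use mu y in \<open>auto intro!: continuous_intros continuous_on_compose2[OF mu(1)]\<close>)
  have split: "homotopic_paths G (\<lambda>t. F_two mu eta (c t, b t))
      (((\<lambda>x. mu (x, ?d)) \<circ> c) +++ ((\<lambda>x. mu (y, x)) \<circ> (eta \<circ> b)))" if "path_in G y y c" for c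
    using paths_multiply[OF mu that eb] by (simp add: F_two_def comp_def)
  have "homotopic_paths G (((\<lambda>x. mu (x, ?d)) \<circ> a) +++ ((\<lambda>x. mu (y, x)) \<circ> (eta \<circ> b)))
     (((\<lambda>x. mu (x, ?d)) \<circ> b) +++ ((\<lambda>x. mu (y, x)) \<circ> (eta \<circ> b)))"
    using split[OF a] split[OF b] null F_two_diagonal_null[OF inv b] homotopic_paths_sym homotopic_paths_trans
    by meson
  then have "homotopic_paths G ((\<lambda>x. mu (x, ?d)) \<circ> a) ((\<lambda>x. mu (x, ?d)) \<circ> b)"
    by (rule homotopic_paths_join_cancel_right[OF _ ra[OF a] ra[OF b] le])
  then show ?thesis
    by (rule homotopic_maps_homotopic_paths_cancel[OF H_space_right_translation[OF H G d] a b])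
qed

section \<open>Power spaces\<close>

lemma continuous_on_power_component: "continuous_on S (\<lambda>x :: nat \<Rightarrow> 'y::topological_space. x i)"
  by (rule continuous_on_subset[OF continuous_on_product_coordinates]) simp

lemma continuous_on_into_power:
  fixes f :: "'a::topological_space \<Rightarrow> nat \<Rightarrow> 'y::topological_space"
  assumes "\<And>i. i \<in> {1..m} \<Longrightarrow> continuous_on S (\<lambda>x. f x i)" "\<And>x. x \<in> S \<Longrightarrow> f x \<in> power_space Y m"
  shows "continuous_on S f"
proof (rule continuous_on_coordinatewise_then_product)
  fix i
  show "continuous_on S (\<lambda>x. f x i)"
  proof (cases "i \<in> {1..m}")
    case False
    then have "f x i = undefined" if "x \<in> S" for x
      using assms(2)[OF that] unfolding power_space_def by (meson PiE_arb)
    then show ?thesis using continuous_on_cong[of S S "\<lambda>x. f x i" "\<lambda>_. undefined"] by simp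
  qed (rule assms(1))
qed

lemma path_in_power_component:
  assumes "path_in (power_space Y m) x y g" "i \<in> {1..m}"
  shows "path_in Y (x i) (y i) (\<lambda>t. g t i)"
proof -
  have "(\<lambda>z. z i) ` power_space Y m \<subseteq> Y" using assms(2) by (auto simp: power_space_def)
  from path_in_compose[OF assms(1) continuous_on_power_component this] show ?thesis by (simp add: comp_def)
qed

lemma path_in_powerI:
  assumes "\<And>t. t \<in> {0..1} \<Longrightarrow> g t \<in> power_space Y m" "x \<in> power_space Y m" "y \<in> power_space Y m"
    and "\<And>i. i \<in> {1..m} \<Longrightarrow> path_in Y (x i) (y i) (\<lambda>t. g t i)"
  shows "path_in (power_space Y m) x y g"
  unfolding path_in_def
proof (intro conjI)
  show "path g"
    unfolding path_def using assms by (intro continuous_on_into_power[where m = m and Y = Y]) (auto simp: path_in_def path_def)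
  show "path_image g \<subseteq> power_space Y m" using assms(1) by (auto simp: path_image_def)
  have "g 0 = x"
    using assms(1)[of 0] assms(2,4) unfolding power_space_def
    by (intro PiE_ext) (auto simp: path_in_def pathstart_def)
  then show "pathstart g = x" by (simp add: pathstart_def)
  have "g 1 = y"
    using assms(1)[of 1] assms(3,4) unfolding power_space_def
    by (intro PiE_ext) (auto simp: path_in_def pathfinish_def)
  then show "pathfinish g = y" by (simp add: pathfinish_def)
qed

lemma power_space_ext:
  "u \<in> power_space Y m \<Longrightarrow> v \<in> power_space Y m \<Longrightarrow> (\<And>i. i \<in> {1..m} \<Longrightarrow> u i = v i) \<Longrightarrow> u = v"
  unfolding power_space_def by (rule PiE_ext)

text \<open>
  The homotopies of the components form a homotopy of tuples; outside \<open>{1..m}\<close> all tuples have the same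
  default value, so restriction to \<open>{1..m}\<close> keeps the prescribed ends.
\<close>

lemma homotopic_paths_powerI:
  fixes Y :: "'y::topological_space set"
  assumes g: "path_in (power_space Y m) x y g" and k: "path_in (power_space Y m) x y k"
    and gk: "\<And>i. i \<in> {1..m} \<Longrightarrow> homotopic_paths Y (\<lambda>t. g t i) (\<lambda>t. k t i)"
  shows "homotopic_paths (power_space Y m) g k"
proof -
  let ?I = "{0..1} :: real set"
  let ?Q = "\<lambda>i (h :: real \<times> real \<Rightarrow> 'y). continuous_on (?I \<times> ?I) h \<and> h \<in> ?I \<times> ?I \<rightarrow> Y \<and>
      (\<forall>t\<in>?I. h (0, t) = g t i) \<and> (\<forall>t\<in>?I. h (1, t) = k t i) \<and>
      (\<forall>t\<in>?I. h (t, 0) = g 0 i \<and> h (t, 1) = g 1 i)"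
  have "\<forall>i\<in>{1..m}. \<exists>h. ?Q i h"
    using gk unfolding homotopic_paths pathstart_def pathfinish_def comp_def by simp
  then obtain h where "\<forall>i\<in>{1..m}. ?Q i (h i)" using bchoice[of "{1..m}" ?Q] by blast
  then have h: "\<And>i. i \<in> {1..m} \<Longrightarrow> continuous_on (?I \<times> ?I) (h i)"
     "\<And>i. i \<in> {1..m} \<Longrightarrow> h i \<in> ?I \<times> ?I \<rightarrow> Y" "\<And>i t. i \<in> {1..m} \<Longrightarrow> t \<in> ?I \<Longrightarrow> h i (0, t) = g t i"
     "\<And>i t. i \<in> {1..m} \<Longrightarrow> t \<in> ?I \<Longrightarrow> h i (1, t) = k t i" "\<And>i t. i \<in> {1..m} \<Longrightarrow> t \<in> ?I \<Longrightarrow> h i (t, 0) = g 0 i"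
     "\<And>i t. i \<in> {1..m} \<Longrightarrow> t \<in> ?I \<Longrightarrow> h i (t, 1) = g 1 i"
    by blast+
  define H where "H z = (\<lambda>i\<in>{1..m}. h i z)" for z
  have Hin: "H z \<in> power_space Y m" if "z \<in> ?I \<times> ?I" for z
    using h(2) that unfolding H_def power_space_def restrict_PiE_iff by (blast dest: funcset_mem)
  have gin: "g t \<in> power_space Y m" and kin: "k t \<in> power_space Y m" if "t \<in> ?I" for t
    using path_in_mem g k that by blast+
  have z: "(0, t) \<in> ?I \<times> ?I" "(1, t) \<in> ?I \<times> ?I" "(t, 0) \<in> ?I \<times> ?I" "(t, 1) \<in> ?I \<times> ?I" if "t \<in> ?I" for t
    using that by auto
  have I: "0 \<in> ?I" "1 \<in> ?I" by auto
  show ?thesis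
    unfolding homotopic_paths pathstart_def pathfinish_def
  proof (intro exI[of _ H] conjI ballI)
    show "continuous_on (?I \<times> ?I) H"
    proof (rule continuous_on_into_power[where m = m and Y = Y, OF _ Hin])
      fix i assume "i \<in> {1..m}"
      then show "continuous_on (?I \<times> ?I) (\<lambda>z. H z i)" using h(1) by (simp add: H_def)
    qed
    show "H \<in> ?I \<times> ?I \<rightarrow> power_space Y m" using Hin by auto
    show "H (0, t) = g t" if "t \<in> ?I" for t
      by (rule power_space_ext[OF Hin[OF z(1)] gin]) (use that h(3) in \<open>auto simp: H_def\<close>)
    show "H (1, t) = k t" if "t \<in> ?I" for t
      by (rule power_space_ext[OF Hin[OF z(2)] kin]) (use that h(4) in \<open>auto simp: H_def\<close>)
    show "(H \<circ> Pair t) 0 = g 0" if "t \<in> ?I" for t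
      unfolding comp_def by (rule power_space_ext[OF Hin[OF z(3)] gin]) (use that h(5) in \<open>auto simp: H_def\<close>)
    show "(H \<circ> Pair t) 1 = g 1" if "t \<in> ?I" for t
      unfolding comp_def by (rule power_space_ext[OF Hin[OF z(4)] gin]) (use that h(6) in \<open>auto simp: H_def\<close>)
  qed
qed

lemma path_connected_PiE:
  fixes v :: "nat \<Rightarrow> 'y::topological_space set"
  assumes "\<And>i. i \<in> {1..m} \<Longrightarrow> path_connected (v i)"
  shows "path_connected (\<Pi>\<^sub>E i\<in>{1..m}. v i)"
  unfolding path_connected_def
proof (intro ballI)
  fix x y assume xy: "x \<in> (\<Pi>\<^sub>E i\<in>{1..m}. v i)" "y \<in> (\<Pi>\<^sub>E i\<in>{1..m}. v i)"
  have "\<exists>g. path_in (v i) (x i) (y i) g" if "i \<in> {1..m}" for i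
    using assms[OF that] PiE_mem[OF xy(1) that] PiE_mem[OF xy(2) that]
    unfolding path_connected_def path_in_def by blast
  then obtain g where g: "\<And>i. i \<in> {1..m} \<Longrightarrow> path_in (v i) (x i) (y i) (g i)" by metis
  let ?g = "\<lambda>t. \<lambda>i\<in>{1..m}. g i t"
  have "path_in (power_space UNIV m) x y ?g"
  proof (rule path_in_powerI)
    show "path_in UNIV (x i) (y i) (\<lambda>t. ?g t i)" if "i \<in> {1..m}" for i
      using g[OF that] that unfolding path_in_def by simp
    show "?g t \<in> power_space UNIV m" for t by (simp add: power_space_def)
    show "x \<in> power_space UNIV m" "y \<in> power_space UNIV m"
      using xy unfolding power_space_def by (meson PiE_mono subset_UNIV subsetD)+
  qed
  moreover have "path_image ?g \<subseteq> (\<Pi>\<^sub>E i\<in>{1..m}. v i)"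
    using path_in_mem[OF g] by (auto simp: path_image_def)
  ultimately show "\<exists>g. path g \<and> path_image g \<subseteq> (\<Pi>\<^sub>E i\<in>{1..m}. v i) \<and> pathstart g = x \<and> pathfinish g = y"
    unfolding path_in_def by blast
qed

lemma path_connected_power_space: "path_connected Y \<Longrightarrow> path_connected (power_space Y m)"
  unfolding power_space_def by (rule path_connected_PiE)

lemma locally_path_connected_power_space:
  fixes Y :: "'y::topological_space set"
  assumes Y: "locally path_connected Y"
  shows "locally path_connected (power_space Y m)"
  unfolding locally_def
proof (intro allI impI, elim conjE)
  fix w x assume w: "openin (top_of_set (power_space Y m)) w" "x \<in> w"
  then obtain A where A: "open A" "w = power_space Y m \<inter> A" by (auto simp: openin_open)
  have xA: "x \<in> A" using A(2) w(2) by blast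
  have "\<exists>X. x \<in> Pi\<^sub>E UNIV X \<and> (\<forall>i. openin euclidean (X i)) \<and>
      finite {i. X i \<noteq> topspace (euclidean :: 'y topology)} \<and> Pi\<^sub>E UNIV X \<subseteq> A"
    by (rule product_topology_open_contains_basis[OF A(1)[unfolded open_fun_def] xA])
  then obtain X where "x \<in> Pi\<^sub>E UNIV X" "\<forall>i. openin euclidean (X i)" "Pi\<^sub>E UNIV X \<subseteq> A"
    by (elim exE conjE) (erule that)
  then have X: "x \<in> Pi\<^sub>E UNIV X" "\<And>i. open (X i)" "Pi\<^sub>E UNIV X \<subseteq> A"
    by (simp_all flip: open_openin)
  have xY: "x \<in> power_space Y m" using w(2) A(2) by simp
  have "\<exists>u. openin (top_of_set Y) u \<and> path_connected u \<and> x i \<in> u \<and> u \<subseteq> Y \<inter> X i" if "i \<in> {1..m}" for i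
  proof -
    have "openin (top_of_set Y) (Y \<inter> X i)" using X(2) by (simp add: openin_open_Int)
    moreover have "x i \<in> Y \<inter> X i"
      using PiE_mem[OF xY[unfolded power_space_def] that] PiE_mem[OF X(1) UNIV_I] by blast
    ultimately show ?thesis
      by (intro Y[unfolded locally_path_connected, rule_format] conjI)
  qed
  then obtain u where "\<forall>i\<in>{1..m}. openin (top_of_set Y) (u i) \<and> path_connected (u i) \<and> x i \<in> u i \<and> u i \<subseteq> Y \<inter> X i"
    using bchoice[of "{1..m}" "\<lambda>i u. openin (top_of_set Y) u \<and> path_connected u \<and> x i \<in> u \<and> u \<subseteq> Y \<inter> X i"]
    by auto
  then have u: "\<And>i. i \<in> {1..m} \<Longrightarrow> openin (top_of_set Y) (u i)" "\<And>i. i \<in> {1..m} \<Longrightarrow> path_connected (u i)"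
      "\<And>i. i \<in> {1..m} \<Longrightarrow> x i \<in> u i" "\<And>i. i \<in> {1..m} \<Longrightarrow> u i \<subseteq> Y \<inter> X i" by blast+
  let ?U = "\<Pi>\<^sub>E i\<in>{1..m}. u i"
  have UY: "?U \<subseteq> power_space Y m"
    unfolding power_space_def using u(4) by (intro PiE_mono) blast
  have sub: "openin (top_of_set (power_space Y m)) {z \<in> power_space Y m. z i \<in> u i}" if "i \<in> {1..m}" for i
  proof -
    have "(\<lambda>z. z i) \<in> power_space Y m \<rightarrow> Y" using that by (auto simp: power_space_def)
    from continuous_openin_preimage[OF continuous_on_power_component this u(1)[OF that]]
    show ?thesis by (simp add: vimage_def Int_def)
  qed
  have "openin (top_of_set (power_space Y m)) {z \<in> power_space Y m. \<forall>i\<in>J. z i \<in> u i}"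
    if "finite J" "J \<subseteq> {1..m}" for J
    using that
  proof (induction J)
    case (insert i J)
    have "{z \<in> power_space Y m. \<forall>j\<in>insert i J. z j \<in> u j} =
        {z \<in> power_space Y m. z i \<in> u i} \<inter> {z \<in> power_space Y m. \<forall>j\<in>J. z j \<in> u j}" by blast
    then show ?case using insert sub[of i] by (simp add: openin_Int)
  qed simp
  from this[of "{1..m}"]
  have "openin (top_of_set (power_space Y m)) {z \<in> power_space Y m. \<forall>i\<in>{1..m}. z i \<in> u i}" by simp
  moreover have "{z \<in> power_space Y m. \<forall>i\<in>{1..m}. z i \<in> u i} = ?U"
  proof (intro equalityI subsetI)
    fix z assume "z \<in> {z \<in> power_space Y m. \<forall>i\<in>{1..m}. z i \<in> u i}"
    then show "z \<in> ?U" unfolding power_space_def PiE_iff by blast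
  next
    fix z assume "z \<in> ?U"
    then show "z \<in> {z \<in> power_space Y m. \<forall>i\<in>{1..m}. z i \<in> u i}" using UY PiE_mem by blast
  qed
  ultimately have "openin (top_of_set (power_space Y m)) ?U" by metis
  moreover have "x \<in> ?U" using u(3) xY unfolding power_space_def PiE_iff by blast
  moreover have "?U \<subseteq> w"
  proof
    fix z assume z: "z \<in> ?U"
    have zY: "z \<in> power_space Y m" using z UY by blast
    have "z i \<in> X i" for i
    proof (cases "i \<in> {1..m}")
      case True then show ?thesis using PiE_mem[OF z True] u(4) by blast
    next
      case False
      then have "z i = x i" using zY xY unfolding power_space_def by (metis PiE_arb)
      then show ?thesis using PiE_mem[OF X(1) UNIV_I] by simp
    qed
    then have "z \<in> Pi\<^sub>E UNIV X" by (simp add: PiE_UNIV_domain)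
    then show "z \<in> w" using zY X(3) unfolding A(2) by blast
  qed
  ultimately show "\<exists>U V. openin (top_of_set (power_space Y m)) U \<and> path_connected V \<and> x \<in> U \<and> U \<subseteq> V \<and> V \<subseteq> w"
    using path_connected_PiE[OF u(2)] by (intro exI[of _ ?U] conjI) auto
qed

section \<open>Loops that are conjugate to diagonal loops\<close>

lemma diagonal_map_in_power: "y \<in> Y \<Longrightarrow> diagonal_map m y \<in> power_space Y m"
  by (simp add: diagonal_map_def power_space_def)

lemma path_in_diagonal:
  assumes "path_in Y x y a"
  shows "path_in (power_space Y m) (diagonal_map m x) (diagonal_map m y) (diagonal_map m \<circ> a)"
proof (rule path_in_compose[OF assms])
  show "continuous_on Y (diagonal_map m)"
    by (rule continuous_on_into_power[where m = m and Y = Y])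
      (auto simp: diagonal_map_def power_space_def)
qed (auto intro: diagonal_map_in_power)

lemma F_two_continuous:
  assumes H: "H_space G mu e" and inv: "right_inversion G mu e eta"
  shows "continuous_on (G \<times> G) (F_two mu eta)" "F_two mu eta ` (G \<times> G) \<subseteq> G"
proof -
  have mu: "continuous_on (G \<times> G) mu" "mu ` (G \<times> G) \<subseteq> G" using H by (auto simp: H_space_def)
  have eta: "continuous_on G eta" "eta ` G \<subseteq> G" using inv by (auto simp: right_inversion_def)
  have "continuous_on (G \<times> G) (\<lambda>z. mu (fst z, eta (snd z)))"
    by (rule continuous_on_compose2[OF mu(1)])
      (use eta in \<open>auto intro!: continuous_intros continuous_on_compose2[OF eta(1)]\<close>)
  moreover have "F_two mu eta = (\<lambda>z. mu (fst z, eta (snd z)))" by (auto simp: F_two_def)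
  ultimately show "continuous_on (G \<times> G) (F_two mu eta)" by simp
  show "F_two mu eta ` (G \<times> G) \<subseteq> G" using mu(2) eta(2) by (fastforce simp: F_two_def)
qed

lemma F_seq_apply: "i \<in> {1..m - 1} \<Longrightarrow> F_seq mu eta m x i = F_two mu eta (x i, x (Suc i))"
  by (simp add: F_seq_def)

lemma F_seq_continuous:
  assumes H: "H_space G mu e" and inv: "right_inversion G mu e eta"
  shows "continuous_on (power_space G m) (F_seq mu eta m)"
    and "F_seq mu eta m ` power_space G m \<subseteq> power_space G (m - 1)"
proof -
  note F = F_two_continuous[OF H inv]
  have comp: "x i \<in> G" "x (Suc i) \<in> G" if "x \<in> power_space G m" "i \<in> {1..m - 1}" for x i
    using that by (auto simp: power_space_def)
  have in_G: "F_two mu eta (x i, x (Suc i)) \<in> G" if "x \<in> power_space G m" "i \<in> {1..m - 1}" for x i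
    using F(2) comp[OF that] by blast
  then show im: "F_seq mu eta m ` power_space G m \<subseteq> power_space G (m - 1)"
    unfolding F_seq_def power_space_def[of G "m - 1"] by (auto intro!: restrict_PiE_iff[THEN iffD2])
  show "continuous_on (power_space G m) (F_seq mu eta m)"
  proof (rule continuous_on_into_power)
    fix i assume i: "i \<in> {1..m - 1}"
    have "continuous_on (power_space G m) (\<lambda>x. F_two mu eta (x i, x (Suc i)))"
      by (rule continuous_on_compose2[OF F(1)])
        (use comp[OF _ i] in \<open>auto intro!: continuous_intros continuous_on_power_component\<close>)
    then show "continuous_on (power_space G m) (\<lambda>x. F_seq mu eta m x i)"
      by (simp only: F_seq_apply[OF i])
  qed (use im in auto)
qed

text \<open>
  The condition in the definition of the homotopic distance, on loops instead of subgroups: \<open>f\<close> carries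
  the loops at each point into a conjugate of the diagonal subgroup.
\<close>

definition diagonal_on_loops ::
    "'g::topological_space set \<Rightarrow> nat \<Rightarrow> 'g \<Rightarrow> 'x::topological_space set \<Rightarrow> ('x \<Rightarrow> nat \<Rightarrow> 'g) \<Rightarrow> bool" where
  "diagonal_on_loops G m y0 P f \<longleftrightarrow>
     (\<forall>z\<in>P. \<exists>s. path_in (power_space G m) (f z) (diagonal_map m y0) s \<and>
        (\<forall>g. path_in P z z g \<longrightarrow> (\<exists>a. path_in G y0 y0 a \<and>
           homotopic_paths (power_space G m) (f \<circ> g) (conjugate_path s (diagonal_map m \<circ> a)))))"

definition null_on_loops :: "'y::topological_space set \<Rightarrow> 'x::topological_space set \<Rightarrow> ('x \<Rightarrow> 'y) \<Rightarrow> bool" where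
  "null_on_loops Y P f \<longleftrightarrow> (\<forall>z g. path_in P z z g \<longrightarrow> homotopic_paths Y (f \<circ> g) (\<lambda>_. f z))"

text \<open>
  Each component of the image is the quotient of two neighbouring components of the loop, so these are
  homotopic, and hence all components are homotopic to the first one.
\<close>

lemma F_seq_null_imp_diagonal:
  assumes H: "H_space G mu e" and inv: "right_inversion G mu e eta" and G: "path_connected G"
    and m: "m \<ge> 1" and a: "path_in (power_space G m) (diagonal_map m y) (diagonal_map m y) \<alpha>"
    and null: "homotopic_paths (power_space G (m - 1)) (F_seq mu eta m \<circ> \<alpha>) (\<lambda>_. F_seq mu eta m (diagonal_map m y))"
  shows "homotopic_paths (power_space G m) \<alpha> (diagonal_map m \<circ> (\<lambda>t. \<alpha> t 1))"
proof -
  have comp: "path_in G y y (\<lambda>t. \<alpha> t i)" if "i \<in> {1..m}" for i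
    using path_in_power_component[OF a that] that by (simp add: diagonal_map_def)
  have step: "homotopic_paths G (\<lambda>t. \<alpha> t i) (\<lambda>t. \<alpha> t (Suc i))" if i: "i \<in> {1..m - 1}" for i
  proof (rule F_two_null_imp_homotopic[OF H inv G])
    show "path_in G y y (\<lambda>t. \<alpha> t i)" "path_in G y y (\<lambda>t. \<alpha> t (Suc i))" using comp i by auto
    have "(\<lambda>x. x i) \<in> power_space G (m - 1) \<rightarrow> G" using i by (auto simp: power_space_def)
    from homotopic_paths_continuous_image[OF null continuous_on_power_component this]
    have "homotopic_paths G (\<lambda>t. F_seq mu eta m (\<alpha> t) i) (\<lambda>_. F_seq mu eta m (diagonal_map m y) i)"
      by (simp add: comp_def)
    moreover have "i \<in> {1..m}" "Suc i \<in> {1..m}" using i by auto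
    ultimately show "homotopic_paths G (\<lambda>t. F_two mu eta (\<alpha> t i, \<alpha> t (Suc i))) (\<lambda>_. F_two mu eta (y, y))"
      unfolding F_seq_apply[OF i] by (simp add: diagonal_map_def)
  qed
  have one: "homotopic_paths G (\<lambda>t. \<alpha> t (Suc i)) (\<lambda>t. \<alpha> t 1)" if "Suc i \<in> {1..m}" for i
    using that
  proof (induction i)
    case 0
    then show ?case using comp[OF 0] homotopic_paths_refl_in by simp
  next
    case (Suc i)
    have "homotopic_paths G (\<lambda>t. \<alpha> t (Suc (Suc i))) (\<lambda>t. \<alpha> t (Suc i))"
      using Suc.prems by (intro homotopic_paths_sym[OF step]) auto
    also have "homotopic_paths G (\<lambda>t. \<alpha> t (Suc i)) (\<lambda>t. \<alpha> t 1)"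
      using Suc by auto
    finally show ?case .
  qed
  show ?thesis
  proof (rule homotopic_paths_powerI[OF a path_in_diagonal[OF comp]])
    show "1 \<in> {1..m}" using m by simp
    fix i assume i: "i \<in> {1..m}"
    then obtain j where "i = Suc j" by (cases i) auto
    then show "homotopic_paths G (\<lambda>t. \<alpha> t i) (\<lambda>t. (diagonal_map m \<circ> (\<lambda>t. \<alpha> t 1)) t i)"
      using one[of j] i by (simp add: diagonal_map_def)
  qed
qed

lemma F_seq_diagonal_null:
  assumes H: "H_space G mu e" and inv: "right_inversion G mu e eta" and a: "path_in G y y a"
  shows "homotopic_paths (power_space G (m - 1)) (F_seq mu eta m \<circ> (diagonal_map m \<circ> a))
     (\<lambda>_. F_seq mu eta m (diagonal_map m y))"
proof -
  let ?w = "F_seq mu eta m (diagonal_map m y)"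
  note F = F_seq_continuous[OF H inv, of m]
  have w: "path_in (power_space G (m - 1)) ?w ?w (F_seq mu eta m \<circ> (diagonal_map m \<circ> a))"
    by (rule path_in_compose[OF path_in_diagonal[OF a] F])
  show ?thesis
  proof (rule homotopic_paths_powerI[OF w path_in_const])
    show "?w \<in> power_space G (m - 1)" using path_in_endpoints[OF w] by simp
    fix i assume i: "i \<in> {1..m - 1}"
    then have "i \<in> {1..m}" "Suc i \<in> {1..m}" by auto
    then show "homotopic_paths G (\<lambda>t. (F_seq mu eta m \<circ> (diagonal_map m \<circ> a)) t i) (\<lambda>_. ?w i)"
      unfolding comp_def F_seq_apply[OF i] using F_two_diagonal_null[OF inv a] by (simp add: diagonal_map_def)
  qed
qed

text \<open>
  In terms of fundamental groups: the kernel of the homomorphism induced by \<open>F_seq\<close> is the diagonal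
  subgroup, transported to any base point by conjugation.
\<close>

theorem diagonal_on_loops_iff_null:
  assumes H: "H_space G mu e" and inv: "right_inversion G mu e eta" and G: "path_connected G"
    and m: "m \<ge> 1" and y0: "y0 \<in> G"
    and f: "continuous_on P f" "f ` P \<subseteq> power_space G m"
  shows "diagonal_on_loops G m y0 P f \<longleftrightarrow> null_on_loops (power_space G (m - 1)) P (F_seq mu eta m \<circ> f)"
proof -
  let ?F = "F_seq mu eta m" and ?S = "power_space G m" and ?T = "power_space G (m - 1)" and ?d = "diagonal_map m y0"
  note F = F_seq_continuous[OF H inv, of m]
  have F': "?F \<in> ?S \<rightarrow> ?T" using F(2) by auto
  show ?thesis
  proof
    assume D: "diagonal_on_loops G m y0 P f"
    show "null_on_loops ?T P (?F \<circ> f)"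
      unfolding null_on_loops_def
    proof (intro allI impI)
      fix z g assume g: "path_in P z z g"
      have z: "z \<in> P" using path_in_endpoints[OF g] by simp
      obtain s a where s: "path_in ?S (f z) ?d s" and a: "path_in G y0 y0 a"
        and fg: "homotopic_paths ?S (f \<circ> g) (conjugate_path s (diagonal_map m \<circ> a))"
        using D z g unfolding diagonal_on_loops_def by blast
      have "homotopic_paths ?T (?F \<circ> (f \<circ> g)) (?F \<circ> conjugate_path s (diagonal_map m \<circ> a))"
        by (rule homotopic_paths_continuous_image[OF fg F(1) F'])
      also have "homotopic_paths ?T (?F \<circ> conjugate_path s (diagonal_map m \<circ> a)) (\<lambda>_. ?F (f z))"
        unfolding compose_conjugate_path
        using conjugate_null_iff[OF path_in_compose[OF s F] path_in_compose[OF path_in_diagonal[OF a] F]]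
          F_seq_diagonal_null[OF H inv a] by blast
      finally show "homotopic_paths ?T ((?F \<circ> f) \<circ> g) (\<lambda>_. (?F \<circ> f) z)" by (simp add: comp_def)
    qed
  next
    assume N: "null_on_loops ?T P (?F \<circ> f)"
    show "diagonal_on_loops G m y0 P f"
      unfolding diagonal_on_loops_def
    proof
      fix z assume z: "z \<in> P"
      have fz: "f z \<in> ?S" using z f by auto
      obtain s where s: "path_in ?S (f z) ?d s"
        using path_connected_power_space[OF G, of m] fz diagonal_map_in_power[OF y0, of m]
        unfolding path_connected_def path_in_def by blast
      note r = path_in_reversepath[OF s]
      show "\<exists>s. path_in ?S (f z) ?d s \<and> (\<forall>g. path_in P z z g \<longrightarrow> (\<exists>a. path_in G y0 y0 a \<and>
           homotopic_paths ?S (f \<circ> g) (conjugate_path s (diagonal_map m \<circ> a))))"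
      proof (intro exI[of _ s] conjI allI impI s)
        fix g assume g: "path_in P z z g"
        define \<alpha> where "\<alpha> = conjugate_path (reversepath s) (f \<circ> g)"
        have fg: "path_in ?S (f z) (f z) (f \<circ> g)" by (rule path_in_compose[OF g f])
        have \<alpha>: "path_in ?S ?d ?d \<alpha>" unfolding \<alpha>_def by (rule path_in_conjugate[OF r fg])
        have "homotopic_paths ?T (?F \<circ> (f \<circ> g)) (\<lambda>_. ?F (f z))"
          using N g unfolding null_on_loops_def by (auto simp: comp_assoc)
        then have "homotopic_paths ?T (?F \<circ> \<alpha>) (\<lambda>_. ?F ?d)"
          unfolding \<alpha>_def compose_conjugate_path
          using conjugate_null_iff[OF path_in_compose[OF r F] path_in_compose[OF fg F]] by blast
        then have diag: "homotopic_paths ?S \<alpha> (diagonal_map m \<circ> (\<lambda>t. \<alpha> t 1))"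
          by (rule F_seq_null_imp_diagonal[OF H inv G m \<alpha>])
        have "homotopic_paths ?S (f \<circ> g) (conjugate_path s \<alpha>)"
          unfolding \<alpha>_def by (rule homotopic_paths_conjugate_inverse[OF s fg])
        also have "homotopic_paths ?S (conjugate_path s \<alpha>) (conjugate_path s (diagonal_map m \<circ> (\<lambda>t. \<alpha> t 1)))"
          by (rule homotopic_paths_conjugate[OF diag s \<alpha>])
        finally have "homotopic_paths ?S (f \<circ> g) (conjugate_path s (diagonal_map m \<circ> (\<lambda>t. \<alpha> t 1)))" .
        moreover have "path_in G y0 y0 (\<lambda>t. \<alpha> t 1)"
          using path_in_power_component[OF \<alpha>, of 1] m by (simp add: diagonal_map_def)
        ultimately show "\<exists>a. path_in G y0 y0 a \<and> homotopic_paths ?S (f \<circ> g) (conjugate_path s (diagonal_map m \<circ> a))"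
          by blast
      qed
    qed
  qed
qed

section \<open>Lifting to the universal and to the diagonal covering\<close>

text \<open>
  The universal covering has no loops but null-homotopic ones, so the lifting criterion asks that
  \<open>f\<close> kills all loops.
\<close>

theorem has_lift_universal_iff_null:
  assumes U: "universal_covering U q Y" and P: "locally path_connected P"
    and f: "continuous_on P f" "f ` P \<subseteq> Y"
  shows "has_lift U q P f \<longleftrightarrow> null_on_loops Y P f"
proof
  have cov: "covering_space U q Y" and sc: "simply_connected U" using U by (auto simp: universal_covering_def)
  have q: "continuous_on U q" "q ` U \<subseteq> Y" "q ` U = Y"
    using covering_space_imp_continuous[OF cov] covering_space_imp_surjective[OF cov] by auto
  {
    assume "has_lift U q P f"
    then obtain l where l: "continuous_on P l" "l ` P \<subseteq> U" "\<And>x. x \<in> P \<Longrightarrow> q (l x) = f x"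
      unfolding has_lift_def by blast
    show "null_on_loops Y P f"
      unfolding null_on_loops_def
    proof (intro allI impI)
      fix z g assume g: "path_in P z z g"
      have z: "z \<in> P" using path_in_endpoints[OF g] by simp
      have "homotopic_paths U (l \<circ> g) (\<lambda>_. l z)"
        by (rule simply_connected_loop_null[OF sc path_in_compose[OF g l(1,2)]])
      from homotopic_paths_continuous_image[OF this q(1), of Y]
      have "homotopic_paths Y (q \<circ> (l \<circ> g)) (\<lambda>_. f z)"
        using q(2) l(3)[OF z] by (simp add: comp_def image_subset_iff_funcset)
      moreover have "homotopic_paths Y (f \<circ> g) (q \<circ> (l \<circ> g))"
      proof (rule homotopic_paths_eq)
        show "(f \<circ> g) t = (q \<circ> (l \<circ> g)) t" if "t \<in> {0..1}" for t
          using l(3) path_in_mem[OF g that] by simp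
      qed (use path_in_compose[OF g f] in \<open>auto simp: path_in_def\<close>)
      ultimately show "homotopic_paths Y (f \<circ> g) (\<lambda>_. f z)" by (metis homotopic_paths_trans)
    qed
  }
  assume N: "null_on_loops Y P f"
  show "has_lift U q P f"
  proof (rule lifting_criterion[OF cov P f])
    fix z assume z: "z \<in> P"
    then obtain a where a: "a \<in> U" "q a = f z" using f q(3) by fastforce
    have "path_in U a a (\<lambda>_. a) \<and> homotopic_paths Y (f \<circ> g) (q \<circ> (\<lambda>_. a))" if "path_in P z z g" for g
      using N that a path_in_const[OF a(1)] unfolding null_on_loops_def by (simp add: comp_def)
    then show "\<exists>a\<in>U. q a = f z \<and> (\<forall>g. path_in P z z g \<longrightarrow> (\<exists>k. path_in U a a k \<and> homotopic_paths Y (f \<circ> g) (q \<circ> k)))"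
      using a by blast
  qed
qed

text \<open>
  Only \<open>g\<close> is assumed to be a path: its class contains \<open>g\<close>, hence is not empty.
\<close>

lemma loop_class_eq_iff:
  "path_in S x y g \<Longrightarrow> loop_class S g = loop_class S h \<longleftrightarrow> homotopic_paths S g h"
  unfolding loop_class_def
  by (metis (mono_tags, lifting) Collect_cong homotopic_paths_refl_in homotopic_paths_sym homotopic_paths_trans mem_Collect_eq)

lemma pi1_eq: "pi1 S x = loop_class S ` {g. path_in S x x g}"
  by (simp add: pi1_def path_in_def)

lemma pi1_map_loop_class:
  assumes g: "path_in S x y g" and f: "continuous_on S f" "f ` S \<subseteq> T"
  shows "pi1_map T f (loop_class S g) = loop_class T (f \<circ> g)"
proof -
  have "loop_class T (f \<circ> h) = loop_class T (f \<circ> g)" if "h \<in> loop_class S g" for h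
  proof -
    have "homotopic_paths T (f \<circ> g) (f \<circ> h)"
      using that f by (intro homotopic_paths_continuous_image[of S]) (auto simp: loop_class_def)
    then show ?thesis using loop_class_eq_iff[OF path_in_compose[OF g f]] by metis
  qed
  moreover have "g \<in> loop_class S g" using homotopic_paths_refl_in[OF g] by (simp add: loop_class_def)
  ultimately show ?thesis unfolding pi1_map_def by blast
qed

lemma pi1_transport_loop_class:
  assumes s: "path_in S x y s" and g: "path_in S y y g"
  shows "pi1_transport S s (loop_class S g) = loop_class S (conjugate_path s g)"
proof -
  have "loop_class S (conjugate_path s h) = loop_class S (conjugate_path s g)" if "h \<in> loop_class S g" for h
    using homotopic_paths_conjugate[OF _ s g] loop_class_eq_iff[OF path_in_conjugate[OF s g]] that
    unfolding loop_class_def by (metis mem_Collect_eq)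
  moreover have "g \<in> loop_class S g" using homotopic_paths_refl_in[OF g] by (simp add: loop_class_def)
  ultimately show ?thesis unfolding pi1_transport_def conjugate_path_def by blast
qed

lemma diagonal_subgroup_eq:
  "diagonal_subgroup Y m y0 = (\<lambda>a. loop_class (power_space Y m) (diagonal_map m \<circ> a)) ` {a. path_in Y y0 y0 a}"
proof -
  have c: "continuous_on Y (diagonal_map m)" "diagonal_map m ` Y \<subseteq> power_space Y m"
    by (rule continuous_on_into_power[where m = m and Y = Y])
      (auto simp: diagonal_map_def power_space_def)
  show ?thesis
    unfolding diagonal_subgroup_def pi1_eq image_image
    by (rule image_cong[OF refl]) (use pi1_map_loop_class[OF _ c] in blast)
qed

text \<open>
  The loops of \<open>H\<close> at \<open>h0\<close> project exactly to the diagonal loops, up to homotopy. For a lift \<open>l\<close> of \<open>f\<close>,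
  a path in \<open>H\<close> from \<open>l z\<close> to \<open>h0\<close> projects to a path that conjugates the loops into the diagonal; here
  path connectedness of \<open>H\<close> enters. Conversely a path \<open>s\<close> that conjugates the loops at \<open>f z\<close> into the
  diagonal lifts, reversed, to a path from \<open>h0\<close>, and its end is the value over \<open>z\<close> required in
  the lifting criterion.
\<close>

theorem has_lift_diagonal_iff:
  assumes D: "diagonal_covering H r G m y0" and G: "locally path_connected G" and y0: "y0 \<in> G"
    and P: "locally path_connected P" and f: "continuous_on P f" "f ` P \<subseteq> power_space G m"
  shows "has_lift H r P f \<longleftrightarrow> diagonal_on_loops G m y0 P f"
proof
  let ?S = "power_space G m" and ?d = "diagonal_map m y0"
  obtain h0 where cov: "covering_space H r ?S" and H: "connected H" and h0: "h0 \<in> H" "r h0 = ?d"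
    and eq: "pi1_map ?S r ` pi1 H h0 = diagonal_subgroup G m y0"
    using D unfolding diagonal_covering_def by blast
  have r: "continuous_on H r" "r ` H \<subseteq> ?S"
    using covering_space_imp_continuous[OF cov] covering_space_imp_surjective[OF cov] by auto
  have eq': "(\<lambda>k. loop_class ?S (r \<circ> k)) ` {k. path_in H h0 h0 k} =
      (\<lambda>a. loop_class ?S (diagonal_map m \<circ> a)) ` {a. path_in G y0 y0 a}"
  proof -
    have "pi1_map ?S r ` pi1 H h0 = (\<lambda>k. loop_class ?S (r \<circ> k)) ` {k. path_in H h0 h0 k}"
      unfolding pi1_eq image_image by (rule image_cong[OF refl]) (use pi1_map_loop_class[OF _ r] in blast)
    then show ?thesis using eq unfolding diagonal_subgroup_eq by metis
  qed
  have to_diag: "\<exists>a. path_in G y0 y0 a \<and> homotopic_paths ?S (r \<circ> k) (diagonal_map m \<circ> a)"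
    if k: "path_in H h0 h0 k" for k
  proof -
    obtain a where "path_in G y0 y0 a" "loop_class ?S (r \<circ> k) = loop_class ?S (diagonal_map m \<circ> a)"
      using eq' k by (metis (mono_tags, lifting) image_iff mem_Collect_eq)
    then show ?thesis using loop_class_eq_iff[OF path_in_compose[OF k r]] by metis
  qed
  have from_diag: "\<exists>k. path_in H h0 h0 k \<and> homotopic_paths ?S (diagonal_map m \<circ> a) (r \<circ> k)"
    if a: "path_in G y0 y0 a" for a
  proof -
    obtain k where "path_in H h0 h0 k" "loop_class ?S (diagonal_map m \<circ> a) = loop_class ?S (r \<circ> k)"
      using eq' a by (metis (mono_tags, lifting) image_iff mem_Collect_eq)
    then show ?thesis using loop_class_eq_iff[OF path_in_diagonal[OF a]] by metis
  qed
  {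
    assume "has_lift H r P f"
    then obtain l where l: "continuous_on P l" "l ` P \<subseteq> H" "\<And>x. x \<in> P \<Longrightarrow> r (l x) = f x"
      unfolding has_lift_def by blast
    have "path_connected H"
      by (rule connected_locally_path_connected_imp_path_connected[OF H
          locally_path_connected_covering[OF cov locally_path_connected_power_space[OF G]]])
    show "diagonal_on_loops G m y0 P f"
      unfolding diagonal_on_loops_def
    proof
      fix z assume z: "z \<in> P"
      then have lz: "l z \<in> H" using l by auto
      obtain s where s: "path_in H (l z) h0 s"
        using \<open>path_connected H\<close> lz h0(1) unfolding path_connected_def path_in_def by blast
      note rs = path_in_reversepath[OF s]
      have s': "path_in ?S (f z) ?d (r \<circ> s)"
        using path_in_compose[OF s r] l(3)[OF z] h0(2) by simp
      show "\<exists>s. path_in ?S (f z) ?d s \<and> (\<forall>g. path_in P z z g \<longrightarrow> (\<exists>a. path_in G y0 y0 a \<and>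
           homotopic_paths ?S (f \<circ> g) (conjugate_path s (diagonal_map m \<circ> a))))"
      proof (intro exI[of _ "r \<circ> s"] conjI allI impI s')
        fix g assume g: "path_in P z z g"
        have lg: "path_in H (l z) (l z) (l \<circ> g)" by (rule path_in_compose[OF g l(1,2)])
        define k where "k = conjugate_path (reversepath s) (l \<circ> g)"
        have k: "path_in H h0 h0 k" unfolding k_def by (rule path_in_conjugate[OF rs lg])
        obtain a where a: "path_in G y0 y0 a" "homotopic_paths ?S (r \<circ> k) (diagonal_map m \<circ> a)"
          using to_diag[OF k] by blast
        have "homotopic_paths ?S (f \<circ> g) (r \<circ> (l \<circ> g))"
        proof (rule homotopic_paths_eq)
          show "(f \<circ> g) t = (r \<circ> (l \<circ> g)) t" if "t \<in> {0..1}" for t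
            using l(3) path_in_mem[OF g that] by simp
        qed (use path_in_compose[OF g f] in \<open>auto simp: path_in_def\<close>)
        also have "homotopic_paths ?S (r \<circ> (l \<circ> g)) (r \<circ> conjugate_path s k)"
          unfolding k_def using r
          by (intro homotopic_paths_continuous_image[OF homotopic_paths_conjugate_inverse[OF s lg]]) auto
        also have "homotopic_paths ?S (r \<circ> conjugate_path s k) (conjugate_path (r \<circ> s) (diagonal_map m \<circ> a))"
          unfolding compose_conjugate_path
          by (rule homotopic_paths_conjugate[OF a(2) path_in_compose[OF s r] path_in_compose[OF k r]])
        finally show "\<exists>a. path_in G y0 y0 a \<and>
            homotopic_paths ?S (f \<circ> g) (conjugate_path (r \<circ> s) (diagonal_map m \<circ> a))"
          using a(1) by blast
      qed
    qed
  }
  assume L: "diagonal_on_loops G m y0 P f"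
  show "has_lift H r P f"
  proof (rule lifting_criterion[OF cov P f])
    fix z assume z: "z \<in> P"
    then obtain s where s: "path_in ?S (f z) ?d s" and
      L': "\<And>g. path_in P z z g \<Longrightarrow> \<exists>a. path_in G y0 y0 a \<and>
           homotopic_paths ?S (f \<circ> g) (conjugate_path s (diagonal_map m \<circ> a))"
      using L unfolding diagonal_on_loops_def by blast
    have "path_in ?S (r h0) (f z) (reversepath s)"
      using path_in_reversepath[OF s] h0(2) by simp
    from covering_path_lift[OF cov this h0(1)] obtain \<sigma> h where \<sigma>: "path_in H h0 h \<sigma>"
      "\<And>t. t \<in> {0..1} \<Longrightarrow> r (\<sigma> t) = reversepath s t" "r h = f z" by metis
    define t where "t = reversepath \<sigma>"
    have t: "path_in H h h0 t" unfolding t_def by (rule path_in_reversepath[OF \<sigma>(1)])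
    have rt: "homotopic_paths ?S s (r \<circ> t)"
    proof (rule homotopic_paths_eq)
      show "s u = (r \<circ> t) u" if "u \<in> {0..1}" for u
        using \<sigma>(2)[of "1 - u"] that by (simp add: t_def reversepath_def)
    qed (use s in \<open>auto simp: path_in_def\<close>)
    have "\<exists>k. path_in H h h k \<and> homotopic_paths ?S (f \<circ> g) (r \<circ> k)" if g: "path_in P z z g" for g
    proof -
      obtain a where a: "path_in G y0 y0 a"
        and fg: "homotopic_paths ?S (f \<circ> g) (conjugate_path s (diagonal_map m \<circ> a))"
        using L'[OF g] by blast
      obtain k where k: "path_in H h0 h0 k" "homotopic_paths ?S (diagonal_map m \<circ> a) (r \<circ> k)"
        using from_diag[OF a] by blast
      note pd = path_in_diagonal[OF a, of m] and rs = path_in_reversepath[OF s]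
      have conj: "homotopic_paths ?S ((diagonal_map m \<circ> a) +++ reversepath s) ((r \<circ> k) +++ reversepath (r \<circ> t))"
        by (rule homotopic_paths_join_in[OF k(2) homotopic_paths_reversepath_D[OF rt] pd rs])
      note fg
      also have "homotopic_paths ?S (conjugate_path s (diagonal_map m \<circ> a)) (conjugate_path (r \<circ> t) (r \<circ> k))"
        unfolding conjugate_path_def by (rule homotopic_paths_join_in[OF rt conj s path_in_join[OF pd rs]])
      finally have "homotopic_paths ?S (f \<circ> g) (r \<circ> conjugate_path t k)"
        unfolding compose_conjugate_path .
      then show ?thesis using path_in_conjugate[OF t k(1)] by blast
    qed
    moreover have "h \<in> H" using path_in_endpoints[OF \<sigma>(1)] by simp
    ultimately show "\<exists>a\<in>H. r a = f z \<and> (\<forall>g. path_in P z z g \<longrightarrow> (\<exists>q. path_in H a a q \<and> homotopic_paths ?S (f \<circ> g) (r \<circ> q)))"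
      using \<sigma>(3) by blast
  qed
qed

section \<open>Monotonicity of sectional categories under fibrewise maps\<close>

lemma secat_mono:
  fixes E :: "'e::topological_space set" and E' :: "'f::topological_space set"
  assumes g: "continuous_on E g" "g ` E \<subseteq> E'" "\<And>x. x \<in> E \<Longrightarrow> p' (g x) = p x"
  shows "secat E' p' B \<le> secat E p B"
  unfolding secat_def
proof (rule Inf_superset_mono, rule subsetI)
  fix x
  assume "x \<in> {enat n |n. \<exists>V. (\<Union>j\<le>n. V j) = B \<and> (\<forall>j\<le>n. openin (top_of_set B) (V j) \<and>
      (\<exists>s. continuous_on (V j) s \<and> s ` V j \<subseteq> E \<and> (\<forall>b\<in>V j. p (s b) = b)))}"
  then obtain n V where x: "x = enat n" and V: "(\<Union>j\<le>n. V j) = B" "\<forall>j\<le>n. openin (top_of_set B) (V j) \<and>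
      (\<exists>s. continuous_on (V j) s \<and> s ` V j \<subseteq> E \<and> (\<forall>b\<in>V j. p (s b) = b))" by auto
  have "\<exists>s. continuous_on (V j) s \<and> s ` V j \<subseteq> E' \<and> (\<forall>b\<in>V j. p' (s b) = b)" if "j \<le> n" for j
  proof -
    obtain s where s: "continuous_on (V j) s" "s ` V j \<subseteq> E" "\<forall>b\<in>V j. p (s b) = b"
      using V(2) \<open>j \<le> n\<close> by blast
    have "continuous_on (V j) (g \<circ> s)" using s g(1) by (intro continuous_on_compose) (auto intro: continuous_on_subset)
    moreover have "(g \<circ> s) ` V j \<subseteq> E'" using s(2) g(2) by auto
    moreover have "\<forall>b\<in>V j. p' ((g \<circ> s) b) = b" using s(2,3) g(3) by auto
    ultimately show ?thesis by blast
  qed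
  then have "\<forall>j\<le>n. openin (top_of_set B) (V j) \<and>
      (\<exists>s. continuous_on (V j) s \<and> s ` V j \<subseteq> E' \<and> (\<forall>b\<in>V j. p' (s b) = b))"
    using V(2) by simp
  then show "x \<in> {enat n |n. \<exists>V. (\<Union>j\<le>n. V j) = B \<and> (\<forall>j\<le>n. openin (top_of_set B) (V j) \<and>
      (\<exists>s. continuous_on (V j) s \<and> s ` V j \<subseteq> E' \<and> (\<forall>b\<in>V j. p' (s b) = b)))}"
    using x V(1) by blast
qed

lemma map_pmf_measures_upto:
  assumes "M \<in> measures_upto E k" "g ` E \<subseteq> E'"
  shows "map_pmf g M \<in> measures_upto E' k"
proof -
  have "card (g ` set_pmf M) \<le> card (set_pmf M)"
    using assms by (intro card_image_le) (auto simp: measures_upto_def)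
  then show ?thesis using assms by (auto simp: measures_upto_def)
qed

lemma dsecat_mono:
  fixes T :: "'e set \<Rightarrow> nat \<Rightarrow> 'e pmf topology" and T' :: "'f set \<Rightarrow> nat \<Rightarrow> 'f pmf topology"
  assumes g: "g ` E \<subseteq> E'" "\<And>x. x \<in> E \<Longrightarrow> p' (g x) = p x"
    and cont: "\<And>k. k \<ge> 1 \<Longrightarrow> continuous_map (T E k) (T' E' k) (map_pmf g)"
  shows "dsecat T' E' p' B \<le> dsecat T E p B"
  unfolding dsecat_def
proof (rule Inf_superset_mono, rule subsetI)
  fix x
  assume "x \<in> {enat n |n. \<exists>s. continuous_map (top_of_set B) (subtopology (T E (n + 1)) (fibre_measures E p (n + 1))) s \<and>
       (\<forall>b\<in>B. fibre_projection p (s b) = b)}"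
  then obtain n s where x: "x = enat n"
    and s: "continuous_map (top_of_set B) (subtopology (T E (n + 1)) (fibre_measures E p (n + 1))) s"
      "\<forall>b\<in>B. fibre_projection p (s b) = b" by blast
  have fib: "map_pmf g M \<in> fibre_measures E' p' k \<and> fibre_projection p' (map_pmf g M) = fibre_projection p M"
    if M: "M \<in> fibre_measures E p k" for M k
  proof -
    have sub: "set_pmf M \<subseteq> E" using M by (auto simp: fibre_measures_def measures_upto_def)
    then have "p' ` set_pmf (map_pmf g M) = p ` set_pmf M"
      using g(2) by (force simp: image_image)
    moreover have "\<exists>b. \<forall>x\<in>set_pmf (map_pmf g M). p' x = b"
      using M sub g(2) unfolding fibre_measures_def by force
    ultimately show ?thesis
      using M map_pmf_measures_upto[OF _ g(1)] unfolding fibre_measures_def fibre_projection_def by auto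
  qed
  have s_fib: "s b \<in> fibre_measures E p (n + 1)" if "b \<in> B" for b
    using s(1) that by (auto simp: continuous_map_in_subtopology image_subset_iff)
  have "continuous_map (top_of_set B) (T E (n + 1)) s"
    using s(1) by (simp add: continuous_map_in_subtopology)
  then have "continuous_map (top_of_set B) (T' E' (n + 1)) (map_pmf g \<circ> s)"
    by (rule continuous_map_compose) (simp add: cont)
  then have "continuous_map (top_of_set B) (subtopology (T' E' (n + 1)) (fibre_measures E' p' (n + 1))) (map_pmf g \<circ> s)"
    unfolding continuous_map_in_subtopology using s_fib fib by auto
  moreover have "\<forall>b\<in>B. fibre_projection p' ((map_pmf g \<circ> s) b) = b"
    using s(2) fib[OF s_fib] by simp
  ultimately show "x \<in> {enat n |n. \<exists>s. continuous_map (top_of_set B)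
      (subtopology (T' E' (n + 1)) (fibre_measures E' p' (n + 1))) s \<and> (\<forall>b\<in>B. fibre_projection p' (s b) = b)}"
    using x by blast
qed

text \<open>
  For a point of the simplex, \<open>embed_pmf\<close> is a genuine distribution, supported on its vertices.
\<close>

lemma set_pmf_embed_simplex:
  assumes "l \<in> standard_simplex (k - 1)" "k \<ge> 1"
  shows "set_pmf (embed_pmf l) \<subseteq> {..<k}"
proof -
  have l: "\<And>i. 0 \<le> l i" "\<And>i. i > k - 1 \<Longrightarrow> l i = 0" "(\<Sum>i\<le>k - 1. l i) = 1"
    using assms(1) by (auto simp: standard_simplex_def)
  have "(\<integral>\<^sup>+ i. ennreal (l i) \<partial>count_space UNIV) = (\<integral>\<^sup>+ i. ennreal (l i) \<partial>count_space {..k - 1})"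
  proof -
    have "(\<integral>\<^sup>+ i. ennreal (l i) \<partial>count_space UNIV) = (\<integral>\<^sup>+ i. ennreal (l i) * indicator {..k - 1} i \<partial>count_space UNIV)"
      using l(2) by (intro nn_integral_cong) (auto simp: indicator_def not_le)
    then show ?thesis by (simp add: nn_integral_count_space_indicator)
  qed
  also have "\<dots> = (\<Sum>i\<le>k - 1. ennreal (l i))" by (simp add: nn_integral_count_space_finite)
  also have "\<dots> = 1" using l by (simp add: sum_ennreal)
  finally have "set_pmf (embed_pmf l) = {i. l i \<noteq> 0}"
    by (intro set_embed_pmf l(1))
  then show ?thesis using l(2) assms(2) by (force simp: not_le)
qed

lemma weighted_sum_in_measures_upto:
  assumes z: "z \<in> join_domain E k" and k: "k \<ge> 1"
  shows "weighted_sum z \<in> measures_upto E k"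
proof -
  obtain x l where xl: "z = (x, l)" by (cases z)
  have sub: "set_pmf (embed_pmf l) \<subseteq> {..<k}"
    using set_pmf_embed_simplex[of l k] z k by (simp add: xl join_domain_def)
  have fin: "finite (set_pmf (embed_pmf l))" using finite_subset[OF sub] by simp
  have "card (x ` set_pmf (embed_pmf l)) \<le> card (set_pmf (embed_pmf l))"
    by (rule card_image_le[OF fin])
  also have "\<dots> \<le> k" using card_mono[OF _ sub] by simp
  finally have "card (x ` set_pmf (embed_pmf l)) \<le> k" .
  moreover have "x ` set_pmf (embed_pmf l) \<subseteq> E"
    using sub z by (auto simp: xl join_domain_def PiE_iff)
  ultimately show ?thesis using fin by (simp add: xl weighted_sum_def measures_upto_def)
qed

lemma topspace_symmetric_join:
  assumes "k \<ge> 1"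
  shows "topspace (symmetric_join_topology E k) = measures_upto E k"
proof
  show "topspace (symmetric_join_topology E k) \<subseteq> measures_upto E k"
    using openin_topspace[of "symmetric_join_topology E k"] unfolding openin_symmetric_join_topology by simp
  have "{z \<in> join_domain E k. weighted_sum z \<in> measures_upto E k} = join_domain E k"
    using weighted_sum_in_measures_upto[OF _ assms] by blast
  then have "openin (symmetric_join_topology E k) (measures_upto E k)"
    unfolding openin_symmetric_join_topology by simp
  then show "measures_upto E k \<subseteq> topspace (symmetric_join_topology E k)" by (rule openin_subset)
qed

text \<open>
  The push-forward is covered by the continuous map \<open>\<Phi>\<close> of \<open>E\<^sup>k \<times> \<Delta>\<^sup>k\<^sup>-\<^sup>1\<close> that applies \<open>g\<close> to all points.
\<close>

lemma continuous_map_symmetric_join: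
  fixes E :: "'e::topological_space set" and E' :: "'f::topological_space set"
  assumes g: "continuous_on E g" "g ` E \<subseteq> E'" and k: "k \<ge> 1"
  shows "continuous_map (symmetric_join_topology E k) (symmetric_join_topology E' k) (map_pmf g)"
proof -
  let ?D = "join_domain E k" and ?D' = "join_domain E' k"
  define \<Phi> where "\<Phi> = (\<lambda>z :: (nat \<Rightarrow> 'e) \<times> (nat \<Rightarrow> real). ((\<lambda>i\<in>{..<k}. g (fst z i)), snd z))"
  have DE: "fst z i \<in> E" if "z \<in> ?D" "i < k" for z i
    using that PiE_mem[of "fst z" "{..<k}" "\<lambda>_. E" i] by (simp add: join_domain_def mem_Times_iff)
  have \<Phi>_im: "\<Phi> z \<in> ?D'" if z: "z \<in> ?D" for z
  proof -
    have "(\<lambda>i\<in>{..<k}. g (fst z i)) \<in> (\<Pi>\<^sub>E i\<in>{..<k}. E')"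
      using DE[OF z] g(2) unfolding restrict_PiE_iff by blast
    then show ?thesis using z by (simp add: \<Phi>_def join_domain_def mem_Times_iff)
  qed
  have \<Phi>_sum: "weighted_sum (\<Phi> z) = map_pmf g (weighted_sum z)" if z: "z \<in> ?D" for z
  proof -
    have "set_pmf (embed_pmf (snd z)) \<subseteq> {..<k}"
      using set_pmf_embed_simplex[of "snd z" k] z k by (simp add: join_domain_def mem_Times_iff)
    then have "map_pmf (\<lambda>i\<in>{..<k}. g (fst z i)) (embed_pmf (snd z)) = map_pmf (\<lambda>i. g (fst z i)) (embed_pmf (snd z))"
      by (intro map_pmf_cong refl) auto
    then show ?thesis by (simp add: \<Phi>_def weighted_sum_def case_prod_unfold map_pmf_comp)
  qed
  have \<Phi>_cont: "continuous_on ?D \<Phi>"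
  proof -
    have "continuous_on ?D (\<lambda>z. \<lambda>i\<in>{..<k}. g (fst z i))"
    proof (rule continuous_on_coordinatewise_then_product)
      fix i
      show "continuous_on ?D (\<lambda>z. (\<lambda>i\<in>{..<k}. g (fst z i)) i)"
      proof (cases "i < k")
        case True
        have "continuous_on ?D ((\<lambda>x. x i) \<circ> fst)"
          by (rule continuous_on_compose[OF continuous_on_fst[OF continuous_on_id] continuous_on_power_component])
        moreover have "continuous_on (((\<lambda>x. x i) \<circ> fst) ` ?D) g"
          using DE[OF _ True] by (intro continuous_on_subset[OF g(1)]) auto
        ultimately have "continuous_on ?D (g \<circ> ((\<lambda>x. x i) \<circ> fst))"
          by (rule continuous_on_compose)
        then show ?thesis using True by (simp add: comp_def)
      next
        case False
        then show ?thesis by simp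
      qed
    qed
    from continuous_on_Pair[OF this continuous_on_snd[OF continuous_on_id]] show ?thesis
      unfolding \<Phi>_def .
  qed
  show ?thesis
    unfolding continuous_map_def topspace_symmetric_join[OF k]
  proof (intro conjI allI impI)
    show "map_pmf g \<in> measures_upto E k \<rightarrow> measures_upto E' k"
      using map_pmf_measures_upto[OF _ g(2)] by auto
    fix W assume W: "openin (symmetric_join_topology E' k) W"
    let ?V = "{M \<in> measures_upto E k. map_pmf g M \<in> W}"
    have W': "openin (top_of_set ?D') {z \<in> ?D'. weighted_sum z \<in> W}"
      using W unfolding openin_symmetric_join_topology by blast
    have "weighted_sum z \<in> ?V \<longleftrightarrow> \<Phi> z \<in> {z \<in> ?D'. weighted_sum z \<in> W}" if "z \<in> ?D" for z
      using \<Phi>_sum[OF that] \<Phi>_im[OF that] weighted_sum_in_measures_upto[OF that k] by simp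
    then have "{z \<in> ?D. weighted_sum z \<in> ?V} = ?D \<inter> \<Phi> -` {z \<in> ?D'. weighted_sum z \<in> W}"
      by blast
    moreover have "\<Phi> \<in> ?D \<rightarrow> ?D'" using \<Phi>_im by simp
    then have "openin (top_of_set ?D) (?D \<inter> \<Phi> -` {z \<in> ?D'. weighted_sum z \<in> W})"
      by (rule continuous_openin_preimage[OF \<Phi>_cont _ W'])
    ultimately show "openin (symmetric_join_topology E k) ?V"
      unfolding openin_symmetric_join_topology[of E] by simp
  qed
qed

text \<open>
  The inequalities in the infimum that defines the Levy-Prokhorov distance, for one radius \<open>r\<close>.
\<close>

definition lp_close :: "('e::topological_space \<Rightarrow> 'e \<Rightarrow> real) \<Rightarrow> 'e set \<Rightarrow> 'e pmf \<Rightarrow> 'e pmf \<Rightarrow> real \<Rightarrow> bool" where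
  "lp_close d E M N r \<longleftrightarrow> (\<forall>A \<in> sets (restrict_space borel E).
        measure_pmf.prob M A \<le> measure_pmf.prob N {x\<in>E. \<exists>a\<in>A. d a x < r} + r \<and>
        measure_pmf.prob N A \<le> measure_pmf.prob M {x\<in>E. \<exists>a\<in>A. d a x < r} + r)"

lemma lp_close_mono:
  assumes "lp_close d E M N r" "r \<le> s"
  shows "lp_close d E M N s"
  unfolding lp_close_def
proof (intro ballI)
  fix A assume A: "A \<in> sets (restrict_space borel E)"
  have "measure_pmf.prob K {x\<in>E. \<exists>a\<in>A. d a x < r} \<le> measure_pmf.prob K {x\<in>E. \<exists>a\<in>A. d a x < s}" for K
    using assms(2) by (intro measure_pmf.finite_measure_mono) (auto intro: order_less_le_trans)
  then show "measure_pmf.prob M A \<le> measure_pmf.prob N {x\<in>E. \<exists>a\<in>A. d a x < s} + s \<and>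
        measure_pmf.prob N A \<le> measure_pmf.prob M {x\<in>E. \<exists>a\<in>A. d a x < s} + s"
    using assms(1) A assms(2) unfolding lp_close_def by (meson add_mono order_trans)
qed

lemma lp_close_sym: "lp_close d E M N r \<longleftrightarrow> lp_close d E N M r"
  unfolding lp_close_def by blast

lemma levy_prokhorov_alt: "levy_prokhorov d E M N = Inf {r. r > 0 \<and> lp_close d E M N r}"
  by (simp add: levy_prokhorov_def lp_close_def)

lemma lp_close_one: "lp_close d E M N 1"
  unfolding lp_close_def by (simp add: add_increasing)

lemma lp_bdd: "bdd_below {r. r > 0 \<and> lp_close d E M N r}"
  by (rule bdd_belowI[of _ 0]) auto

lemma levy_prokhorov_less_iff: "levy_prokhorov d E M N < \<epsilon> \<longleftrightarrow> (\<exists>r. 0 < r \<and> r < \<epsilon> \<and> lp_close d E M N r)"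
proof -
  have "1 \<in> {r. r > 0 \<and> lp_close d E M N r}" using lp_close_one by simp
  then have "{r. r > 0 \<and> lp_close d E M N r} \<noteq> {}" by blast
  then show ?thesis
    unfolding levy_prokhorov_alt using cInf_less_iff[OF _ lp_bdd, of d E M N \<epsilon>] by auto
qed

lemma levy_prokhorov_less_imp_close:
  "levy_prokhorov d E M N < \<epsilon> \<Longrightarrow> lp_close d E M N \<epsilon>"
  unfolding levy_prokhorov_less_iff using lp_close_mono by fastforce

lemma levy_prokhorov_nonneg: "0 \<le> levy_prokhorov d E M N"
proof -
  have "1 \<in> {r. r > 0 \<and> lp_close d E M N r}" using lp_close_one by simp
  then have "{r. r > 0 \<and> lp_close d E M N r} \<noteq> {}" by blast
  then show ?thesis unfolding levy_prokhorov_alt by (intro cInf_greatest) auto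
qed

lemma metrizes_openin:
  assumes "metrizes d E" 
  shows "openin (top_of_set E) U \<longleftrightarrow> U \<subseteq> E \<and> (\<forall>x\<in>U. \<exists>r>0. \<forall>y\<in>E. d x y < r \<longrightarrow> y \<in> U)"
proof -
  interpret Metric_space E d using assms by (simp add: metrizes_def)
  have eq: "top_of_set E = mtopology" using assms by (simp add: metrizes_def)
  have ball: "mball x r \<subseteq> U \<longleftrightarrow> (\<forall>y\<in>E. d x y < r \<longrightarrow> y \<in> U)" if "x \<in> E" for x r
    using that by (auto simp: subset_iff)
  show ?thesis
  proof (cases "U \<subseteq> E")
    case True
    then show ?thesis unfolding eq openin_mtopology using ball by (metis subsetD)
  next
    case False
    then show ?thesis unfolding eq openin_mtopology by simp
  qed
qed

lemma openin_in_restricted_borel: "openin (top_of_set E) U \<Longrightarrow> U \<in> sets (restrict_space borel E)"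
  by (auto simp: sets_restrict_space openin_open)

lemma metrizes_finite_sets:
  assumes "metrizes d E" "finite A" "A \<subseteq> E"
  shows "A \<in> sets (restrict_space borel E)"
proof -
  interpret Metric_space E d using assms by (simp add: metrizes_def)
  have top: "mtopology = top_of_set E" using assms by (simp add: metrizes_def)
  have "closedin mtopology A"
    using assms(2,3) Hausdorff_space_mtopology by (intro closedin_Hausdorff_finite) auto
  then have "closedin (top_of_set E) A" unfolding top .
  then obtain T where "closed T" "A = E \<inter> T" by (auto simp: closedin_closed)
  then show ?thesis by (auto simp: sets_restrict_space)
qed

lemma metrizes_thickening_open:
  assumes "metrizes d E" "A \<subseteq> E"
  shows "openin (top_of_set E) {x\<in>E. \<exists>a\<in>A. d a x < r}"
proof -
  interpret Metric_space E d using assms by (simp add: metrizes_def)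
  show ?thesis
    unfolding metrizes_openin[OF assms(1)]
  proof (intro conjI ballI)
    fix x assume "x \<in> {x\<in>E. \<exists>a\<in>A. d a x < r}"
    then obtain a where a: "x \<in> E" "a \<in> A" "d a x < r" by blast
    have "d a y < r" if "y \<in> E" "d x y < r - d a x" for y
      using triangle[of a x y] a assms(2) that by auto
    then show "\<exists>s>0. \<forall>y\<in>E. d x y < s \<longrightarrow> y \<in> {x\<in>E. \<exists>a\<in>A. d a x < r}"
      using a by (intro exI[of _ "r - d a x"]) auto
  qed auto
qed

text \<open>
  The \<open>s\<close>-neighbourhood of the \<open>r\<close>-neighbourhood of \<open>A\<close> lies in the \<open>(r + s)\<close>-neighbourhood. The
  \<open>r\<close>-neighbourhood is open, hence again a Borel set.
\<close>

lemma lp_close_trans: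
  assumes E: "metrizes d E" and MN: "lp_close d E M N r" and NK: "lp_close d E N K s"
  shows "lp_close d E M K (r + s)"
proof -
  interpret Metric_space E d using E by (simp add: metrizes_def)
  have *: "measure_pmf.prob M A \<le> measure_pmf.prob K {x\<in>E. \<exists>a\<in>A. d a x < r + s} + (r + s)"
    if A: "A \<in> sets (restrict_space borel E)" and MN: "lp_close d E M N r" and NK: "lp_close d E N K s"
    for M N K A r s
  proof -
    let ?B = "{x\<in>E. \<exists>a\<in>A. d a x < r}"
    have AE: "A \<subseteq> E" using A by (auto simp: sets_restrict_space)
    have B: "?B \<in> sets (restrict_space borel E)"
      by (rule openin_in_restricted_borel[OF metrizes_thickening_open[OF E AE]])
    have "measure_pmf.prob M A \<le> measure_pmf.prob N ?B + r" using MN A unfolding lp_close_def by blast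
    also have "\<dots> \<le> (measure_pmf.prob K {x\<in>E. \<exists>b\<in>?B. d b x < s} + s) + r"
      using conjunct1[OF NK[unfolded lp_close_def, rule_format, OF B]] by linarith
    also have "measure_pmf.prob K {x\<in>E. \<exists>b\<in>?B. d b x < s} \<le> measure_pmf.prob K {x\<in>E. \<exists>a\<in>A. d a x < r + s}"
    proof (rule measure_pmf.finite_measure_mono)
      show "{x\<in>E. \<exists>b\<in>?B. d b x < s} \<subseteq> {x\<in>E. \<exists>a\<in>A. d a x < r + s}"
      proof safe
        fix x b a assume *: "x \<in> E" "b \<in> E" "a \<in> A" "d a b < r" "d b x < s"
        then have "d a x < r + s" using triangle[of a b x] AE by auto
        then show "\<exists>a\<in>A. d a x < r + s" using * by blast
      qed
    qed auto
    finally show ?thesis by simp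
  qed
  show ?thesis
    unfolding lp_close_def using *[OF _ MN NK] *[OF _ NK[unfolded lp_close_sym[of d E N]] MN[unfolded lp_close_sym[of d E M]]]
    by (auto simp: add.commute)
qed

text \<open>
  For the distinctness axiom, take a radius below the distance from \<open>x\<close> to the other support points of
  \<open>N\<close>; then closeness on \<open>{x}\<close> compares the weights of \<open>x\<close> alone.
\<close>

lemma levy_prokhorov_metric:
  assumes E: "metrizes d E"
  shows "Metric_space (measures_upto E k) (levy_prokhorov d E)"
proof -
  interpret Metric_space E d using E by (simp add: metrizes_def)
  have le: "pmf M x \<le> pmf N x" if M: "M \<in> measures_upto E k" and N: "N \<in> measures_upto E k"
    and z: "levy_prokhorov d E M N = 0" for M N x
  proof (cases "x \<in> set_pmf M")
    case True
    then have x: "x \<in> E" using M by (auto simp: measures_upto_def)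
    have finN: "finite (set_pmf N)" "set_pmf N \<subseteq> E" using N by (auto simp: measures_upto_def)
    obtain \<delta> where \<delta>: "\<delta> > 0" "\<And>y. y \<in> set_pmf N \<Longrightarrow> y \<noteq> x \<Longrightarrow> \<delta> \<le> d x y"
    proof (cases "set_pmf N - {x} = {}")
      case True then show thesis using that[of 1] by auto
    next
      case False
      let ?D = "d x ` (set_pmf N - {x})"
      have "finite ?D" "?D \<noteq> {}" using finN False by auto
      moreover have "0 < d x y" if "y \<in> set_pmf N" "y \<noteq> x" for y
        using mdist_pos_less[of x y] that x finN by auto
      ultimately have "Min ?D > 0" "\<And>y. y \<in> set_pmf N \<Longrightarrow> y \<noteq> x \<Longrightarrow> Min ?D \<le> d x y" by auto
      then show thesis using that by blast
    qed
    have "pmf M x \<le> pmf N x + r" if r: "0 < r" "r < \<delta>" for r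
    proof -
      have "lp_close d E M N r" using z r levy_prokhorov_less_imp_close[of d E M N r] by simp
      then have "measure_pmf.prob M {x} \<le> measure_pmf.prob N {y\<in>E. \<exists>a\<in>{x}. d a y < r} + r"
        using metrizes_finite_sets[OF E, of "{x}"] x unfolding lp_close_def by blast
      also have "measure_pmf.prob N {y\<in>E. \<exists>a\<in>{x}. d a y < r} = measure_pmf.prob N ({y\<in>E. \<exists>a\<in>{x}. d a y < r} \<inter> set_pmf N)"
        by (simp add: measure_Int_set_pmf)
      also have "\<dots> \<le> measure_pmf.prob N {x}"
      proof (rule measure_pmf.finite_measure_mono)
        show "{y\<in>E. \<exists>a\<in>{x}. d a y < r} \<inter> set_pmf N \<subseteq> {x}"
          using \<delta>(2) r(2) by fastforce
      qed simp
      finally show ?thesis by (simp add: measure_pmf_single)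
    qed
    then have "pmf M x \<le> pmf N x + min \<epsilon> (\<delta> / 2)" if "\<epsilon> > 0" for \<epsilon>
      using that \<delta>(1) by simp
    then have "pmf M x \<le> pmf N x + \<epsilon>" if "\<epsilon> > 0" for \<epsilon>
      using that by fastforce
    then show ?thesis by (rule field_le_epsilon)
  next
    case False
    then show ?thesis by (simp add: set_pmf_iff)
  qed
  show ?thesis
  proof
    show "0 \<le> levy_prokhorov d E M N" for M N by (rule levy_prokhorov_nonneg)
    show sym: "levy_prokhorov d E M N = levy_prokhorov d E N M" for M N
      unfolding levy_prokhorov_alt by (simp add: lp_close_sym)
    show "levy_prokhorov d E M N = 0 \<longleftrightarrow> M = N" if MN: "M \<in> measures_upto E k" "N \<in> measures_upto E k" for M N
    proof
      assume "levy_prokhorov d E M N = 0"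
      then show "M = N" using le MN sym by (intro pmf_eqI antisym) metis+
    next
      assume "M = N"
      have "lp_close d E M M r" if "r > 0" for r
        unfolding lp_close_def
      proof (intro ballI)
        fix A assume A: "A \<in> sets (restrict_space borel E)"
        then have AE: "A \<subseteq> E" by (auto simp: sets_restrict_space)
        have "A \<subseteq> {x\<in>E. \<exists>a\<in>A. d a x < r}" using AE that by (auto intro!: bexI simp: subset_iff)
        then have "measure_pmf.prob M A \<le> measure_pmf.prob M {x\<in>E. \<exists>a\<in>A. d a x < r}"
          by (intro measure_pmf.finite_measure_mono) auto
        then show "measure_pmf.prob M A \<le> measure_pmf.prob M {x\<in>E. \<exists>a\<in>A. d a x < r} + r \<and>
          measure_pmf.prob M A \<le> measure_pmf.prob M {x\<in>E. \<exists>a\<in>A. d a x < r} + r" using that by simp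
      qed
      then have "levy_prokhorov d E M M < \<epsilon>" if "\<epsilon> > 0" for \<epsilon>
        unfolding levy_prokhorov_less_iff using that dense by blast
      then show "levy_prokhorov d E M N = 0"
        using levy_prokhorov_nonneg[of d E M M] \<open>M = N\<close> by (metis less_irrefl order_le_less)
    qed
    show "levy_prokhorov d E M K \<le> levy_prokhorov d E M N + levy_prokhorov d E N K" for M N K
    proof (rule field_le_epsilon)
      fix \<epsilon> :: real assume e: "\<epsilon> > 0"
      obtain r where r: "r < levy_prokhorov d E M N + \<epsilon>/2" "0 < r" "lp_close d E M N r"
        using levy_prokhorov_less_iff[of d E M N "levy_prokhorov d E M N + \<epsilon>/2"] e by auto
      obtain s where s: "s < levy_prokhorov d E N K + \<epsilon>/2" "0 < s" "lp_close d E N K s"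
        using levy_prokhorov_less_iff[of d E N K "levy_prokhorov d E N K + \<epsilon>/2"] e by auto
      have "levy_prokhorov d E M K < levy_prokhorov d E M N + levy_prokhorov d E N K + \<epsilon>"
        unfolding levy_prokhorov_less_iff
        using lp_close_trans[OF E r(3) s(3)] r s by (intro exI[of _ "r + s"]) auto
      then show "levy_prokhorov d E M K \<le> levy_prokhorov d E M N + levy_prokhorov d E N K + \<epsilon>" by simp
    qed
  qed
qed

text \<open>
  Finite supports make this elementary: it suffices to test closeness on finite sets of support points,
  and to control \<open>g\<close> near the support of one of the two measures. By symmetry of the metric this serves both
  inequalities.
\<close>

lemma lp_close_map_pmf:
  assumes E: "metrizes d E" and E': "metrizes d' E'" and g: "g ` E \<subseteq> E'"
    and M: "M \<in> measures_upto E k" and N: "N \<in> measures_upto E k" and MN: "lp_close d E M N r"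
    and near: "\<And>x y. x \<in> set_pmf M \<Longrightarrow> y \<in> E \<Longrightarrow> d x y < r \<Longrightarrow> d' (g x) (g y) < s" and rs: "r \<le> s"
  shows "lp_close d' E' (map_pmf g M) (map_pmf g N) s"
proof -
  interpret Metric_space E d using E by (simp add: metrizes_def)
  interpret E': Metric_space E' d' using E' by (simp add: metrizes_def)
  have push: "measure_pmf.prob K (g -` A) \<le> measure_pmf.prob L (g -` {x\<in>E'. \<exists>a\<in>A. d' a x < s}) + s"
    if K: "K \<in> measures_upto E k" and L: "L \<in> measures_upto E k" and KL: "lp_close d E K L r"
      and near: "\<And>x y. x \<in> set_pmf K \<Longrightarrow> y \<in> set_pmf L \<Longrightarrow> d x y < r \<Longrightarrow> d' (g x) (g y) < s" for K L A
  proof -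
    let ?A = "g -` A \<inter> set_pmf K"
    have fin: "finite ?A" "?A \<subseteq> E" and LE: "set_pmf L \<subseteq> E" using K L by (auto simp: measures_upto_def)
    have "measure_pmf.prob K (g -` A) = measure_pmf.prob K ?A" by (simp add: measure_Int_set_pmf)
    also have "\<dots> \<le> measure_pmf.prob L {x\<in>E. \<exists>a\<in>?A. d a x < r} + r"
      using KL metrizes_finite_sets[OF E fin] unfolding lp_close_def by blast
    also have "measure_pmf.prob L {x\<in>E. \<exists>a\<in>?A. d a x < r} = measure_pmf.prob L ({x\<in>E. \<exists>a\<in>?A. d a x < r} \<inter> set_pmf L)"
      by (simp add: measure_Int_set_pmf)
    also have "\<dots> \<le> measure_pmf.prob L (g -` {x\<in>E'. \<exists>a\<in>A. d' a x < s})"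
    proof (rule measure_pmf.finite_measure_mono)
      show "{x\<in>E. \<exists>a\<in>?A. d a x < r} \<inter> set_pmf L \<subseteq> g -` {x\<in>E'. \<exists>a\<in>A. d' a x < s}"
      proof (rule subsetI)
        fix y assume "y \<in> {x\<in>E. \<exists>a\<in>?A. d a x < r} \<inter> set_pmf L"
        then obtain x where y: "y \<in> E" "y \<in> set_pmf L" and x: "g x \<in> A" "x \<in> set_pmf K" "d x y < r"
          by blast
        have "g y \<in> E'" using y(1) g by blast
        then show "y \<in> g -` {x\<in>E'. \<exists>a\<in>A. d' a x < s}"
          using near[OF x(2) y(2) x(3)] x(1) by blast
      qed
    qed simp
    finally show ?thesis using rs by linarith
  qed
  have ME: "set_pmf M \<subseteq> E" and NE: "set_pmf N \<subseteq> E" using M N by (auto simp: measures_upto_def)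
  have 1: "d' (g x) (g y) < s" if "x \<in> set_pmf M" "y \<in> set_pmf N" "d x y < r" for x y
    using near that NE by blast
  have 2: "d' (g x) (g y) < s" if "x \<in> set_pmf N" "y \<in> set_pmf M" "d x y < r" for x y
    using 1[of y x] that commute[of x y] E'.commute[of "g x" "g y"] by simp
  show ?thesis
    unfolding lp_close_def measure_map_pmf
  proof (intro ballI conjI)
    fix A
    show "measure_pmf.prob M (g -` A) \<le> measure_pmf.prob N (g -` {x\<in>E'. \<exists>a\<in>A. d' a x < s}) + s"
      by (rule push[OF M N MN 1])
    show "measure_pmf.prob N (g -` A) \<le> measure_pmf.prob M (g -` {x\<in>E'. \<exists>a\<in>A. d' a x < s}) + s"
      by (rule push[OF N M lp_close_sym[THEN iffD1, OF MN] 2])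
  qed
qed

text \<open>
  Continuity of \<open>g\<close> at the finitely many support points of \<open>M\<close> gives a common radius.
\<close>

lemma continuous_map_levy_prokhorov:
  assumes E: "metrizes d E" and E': "metrizes d' E'" and g: "continuous_on E g" "g ` E \<subseteq> E'"
  shows "continuous_map (levy_prokhorov_topology d E k) (levy_prokhorov_topology d' E' k) (map_pmf g)"
proof -
  interpret Metric_space E d using E by (simp add: metrizes_def)
  interpret E': Metric_space E' d' using E' by (simp add: metrizes_def)
  interpret M: Metric_space "measures_upto E k" "levy_prokhorov d E" by (rule levy_prokhorov_metric[OF E])
  interpret M': Metric_space "measures_upto E' k" "levy_prokhorov d' E'" by (rule levy_prokhorov_metric[OF E'])
  show ?thesis
    unfolding levy_prokhorov_topology_def continuous_map_def
  proof (intro conjI allI impI)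
    show "map_pmf g \<in> topspace M.mtopology \<rightarrow> topspace M'.mtopology"
      using map_pmf_measures_upto[OF _ g(2)] by auto
    fix W assume W: "openin M'.mtopology W"
    show "openin M.mtopology {M \<in> topspace M.mtopology. map_pmf g M \<in> W}"
      unfolding M.openin_mtopology M.topspace_mtopology
    proof (intro conjI allI impI)
      fix M assume "M \<in> {M \<in> measures_upto E k. map_pmf g M \<in> W}"
      then have M: "M \<in> measures_upto E k" "map_pmf g M \<in> W" by auto
      obtain \<epsilon> where e: "\<epsilon> > 0" "M'.mball (map_pmf g M) \<epsilon> \<subseteq> W"
        using W M(2) unfolding M'.openin_mtopology by blast
      have fin: "finite (set_pmf M)" "set_pmf M \<subseteq> E" using M by (auto simp: measures_upto_def)
      have "\<exists>\<delta>>0. \<forall>y\<in>E. d x y < \<delta> \<longrightarrow> d' (g x) (g y) < \<epsilon> / 2" if x: "x \<in> set_pmf M" for x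
      proof -
        have gx: "g x \<in> E'" "x \<in> E" using x fin g(2) by auto
        have "openin (top_of_set E') {y\<in>E'. \<exists>a\<in>{g x}. d' a y < \<epsilon> / 2}"
          using gx by (intro metrizes_thickening_open[OF E']) auto
        then have "openin (top_of_set E) (E \<inter> g -` {y\<in>E'. \<exists>a\<in>{g x}. d' a y < \<epsilon> / 2})"
          using g by (intro continuous_openin_preimage) auto
        moreover have "x \<in> E \<inter> g -` {y\<in>E'. \<exists>a\<in>{g x}. d' a y < \<epsilon> / 2}"
          using gx e by simp
        ultimately obtain r where "r > 0" "\<forall>y\<in>E. d x y < r \<longrightarrow> y \<in> E \<inter> g -` {y\<in>E'. \<exists>a\<in>{g x}. d' a y < \<epsilon> / 2}"
          unfolding metrizes_openin[OF E] by blast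
        then show ?thesis by (intro exI[of _ r]) auto
      qed
      then obtain \<delta> where \<delta>: "\<And>x. x \<in> set_pmf M \<Longrightarrow> \<delta> x > 0"
        "\<And>x y. x \<in> set_pmf M \<Longrightarrow> y \<in> E \<Longrightarrow> d x y < \<delta> x \<Longrightarrow> d' (g x) (g y) < \<epsilon> / 2" by metis
      define r where "r = min (\<epsilon> / 2) (Min (\<delta> ` set_pmf M))"
      have r: "r > 0" "r \<le> \<epsilon> / 2" "\<And>x. x \<in> set_pmf M \<Longrightarrow> r \<le> \<delta> x"
        using e(1) \<delta>(1) fin(1) set_pmf_not_empty[of M] by (auto simp: r_def min.coboundedI2)
      have "N \<in> {M \<in> measures_upto E k. map_pmf g M \<in> W}" if N: "N \<in> M.mball M r" for N
      proof -
        have N': "N \<in> measures_upto E k" "levy_prokhorov d E M N < r" using N by (auto simp: M.in_mball)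
        have "lp_close d' E' (map_pmf g M) (map_pmf g N) (\<epsilon> / 2)"
        proof (rule lp_close_map_pmf[OF E E' g(2) M(1) N'(1) levy_prokhorov_less_imp_close[OF N'(2)] _ r(2)])
          show "d' (g x) (g y) < \<epsilon> / 2" if "x \<in> set_pmf M" "y \<in> E" "d x y < r" for x y
            using \<delta>(2)[OF that(1,2)] r(3)[OF that(1)] that(3) by simp
        qed
        then have "levy_prokhorov d' E' (map_pmf g M) (map_pmf g N) < \<epsilon>"
          unfolding levy_prokhorov_less_iff using e(1) by (intro exI[of _ "\<epsilon> / 2"]) auto
        then have "map_pmf g N \<in> M'.mball (map_pmf g M) \<epsilon>"
          using map_pmf_measures_upto[OF _ g(2)] M(1) N'(1) by (simp add: M'.in_mball)
        then show ?thesis using e(2) N'(1) by blast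
      qed
      then show "\<exists>r>0. M.mball M r \<subseteq> {M \<in> measures_upto E k. map_pmf g M \<in> W}" using r(1) by blast
    qed auto
  qed
qed

section \<open>Comparison of the invariants\<close>

lemma tuple_map_continuous:
  assumes "\<And>i. i \<in> {1..m} \<Longrightarrow> continuous_on X (f i) \<and> f i ` X \<subseteq> Y"
  shows "continuous_on X (tuple_map m f)" "tuple_map m f ` X \<subseteq> power_space Y m"
proof -
  show im: "tuple_map m f ` X \<subseteq> power_space Y m"
    using assms by (fastforce simp: tuple_map_def power_space_def)
  show "continuous_on X (tuple_map m f)"
    by (rule continuous_on_into_power[where m = m and Y = Y]) (use assms im in \<open>auto simp: tuple_map_def\<close>)
qed

lemma section_of_pullback_iff_has_lift:
  assumes "V \<subseteq> X"
  shows "(\<exists>s. continuous_on V s \<and> s ` V \<subseteq> pullback X f E p \<and> (\<forall>b\<in>V. fst (s b) = b)) \<longleftrightarrow> has_lift E p V f"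
proof
  assume "\<exists>s. continuous_on V s \<and> s ` V \<subseteq> pullback X f E p \<and> (\<forall>b\<in>V. fst (s b) = b)"
  then obtain s where s: "continuous_on V s" "s ` V \<subseteq> pullback X f E p" "\<And>b. b \<in> V \<Longrightarrow> fst (s b) = b" by blast
  have "snd (s b) \<in> E \<and> p (snd (s b)) = f b" if "b \<in> V" for b
    using s(2,3) that by (force simp: pullback_def)
  moreover have "continuous_on V (snd \<circ> s)" using s(1) by (intro continuous_on_compose continuous_intros)
  ultimately show "has_lift E p V f" unfolding has_lift_def by (intro exI[of _ "snd \<circ> s"]) auto
next
  assume "has_lift E p V f"
  then obtain l where l: "continuous_on V l" "l ` V \<subseteq> E" "\<And>x. x \<in> V \<Longrightarrow> p (l x) = f x"
    unfolding has_lift_def by blast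
  have "continuous_on V (\<lambda>x. (x, l x))" by (intro continuous_on_Pair continuous_on_id l(1))
  moreover have "(\<lambda>x. (x, l x)) ` V \<subseteq> pullback X f E p" using l(2,3) assms by (auto simp: pullback_def)
  ultimately show "\<exists>s. continuous_on V s \<and> s ` V \<subseteq> pullback X f E p \<and> (\<forall>b\<in>V. fst (s b) = b)"
    by (intro exI[of _ "\<lambda>x. (x, l x)"]) simp
qed

lemma diagonal_on_loops_iff_pi1:
  assumes f: "continuous_on V f" "f ` V \<subseteq> power_space Y m"
  shows "diagonal_on_loops Y m y0 V f \<longleftrightarrow>
     (\<forall>u\<in>V. \<exists>s. path s \<and> path_image s \<subseteq> power_space Y m \<and>
        pathstart s = f u \<and> pathfinish s = diagonal_map m y0 \<and>
        pi1_map (power_space Y m) f ` pi1 V u \<subseteq> pi1_transport (power_space Y m) s ` diagonal_subgroup Y m y0)"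
proof -
  let ?S = "power_space Y m"
  have "pi1_map ?S f ` pi1 V u \<subseteq> pi1_transport ?S s ` diagonal_subgroup Y m y0 \<longleftrightarrow>
     (\<forall>g. path_in V u u g \<longrightarrow> (\<exists>a. path_in Y y0 y0 a \<and>
           homotopic_paths ?S (f \<circ> g) (conjugate_path s (diagonal_map m \<circ> a))))"
    if s: "path_in ?S (f u) (diagonal_map m y0) s" for u s
  proof -
    have "pi1_map ?S f ` pi1 V u = (\<lambda>g. loop_class ?S (f \<circ> g)) ` {g. path_in V u u g}"
      unfolding pi1_eq image_image by (rule image_cong[OF refl]) (use pi1_map_loop_class[OF _ f] in blast)
    moreover have "pi1_transport ?S s ` diagonal_subgroup Y m y0 =
        (\<lambda>a. loop_class ?S (conjugate_path s (diagonal_map m \<circ> a))) ` {a. path_in Y y0 y0 a}"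
      unfolding diagonal_subgroup_eq image_image
      by (rule image_cong[OF refl]) (use pi1_transport_loop_class[OF s path_in_diagonal] in blast)
    moreover have "loop_class ?S (f \<circ> g) = loop_class ?S (conjugate_path s (diagonal_map m \<circ> a)) \<longleftrightarrow>
        homotopic_paths ?S (f \<circ> g) (conjugate_path s (diagonal_map m \<circ> a))" if "path_in V u u g" for g a
      by (rule loop_class_eq_iff[OF path_in_compose[OF that f]])
    ultimately show ?thesis by (auto simp: image_subset_iff image_iff)
  qed
  note eq = this
  show ?thesis
    unfolding diagonal_on_loops_def
  proof (intro ball_cong refl iff_exI)
    fix u s
    show "(path_in ?S (f u) (diagonal_map m y0) s \<and>
            (\<forall>g. path_in V u u g \<longrightarrow> (\<exists>a. path_in Y y0 y0 a \<and>
           homotopic_paths ?S (f \<circ> g) (conjugate_path s (diagonal_map m \<circ> a))))) =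
        (path s \<and> path_image s \<subseteq> ?S \<and> pathstart s = f u \<and> pathfinish s = diagonal_map m y0 \<and>
        pi1_map ?S f ` pi1 V u \<subseteq> pi1_transport ?S s ` diagonal_subgroup Y m y0)"
      using eq[of u s] unfolding path_in_def[of ?S] by blast
  qed
qed

text \<open>
  Open subsets of \<open>X\<close> are locally path connected, so the lifting criterion applies to each of them.
\<close>

lemma diag_dist_eq_secat:
  assumes D: "diagonal_covering H r Y m y0" and Y: "locally path_connected Y" and y0: "y0 \<in> Y"
    and X: "locally path_connected X" and f: "continuous_on X (tuple_map m f)" "tuple_map m f ` X \<subseteq> power_space Y m"
  shows "diag_dist X Y y0 m f = diag_dist_secat X m f H r"
proof -
  have "(\<forall>u\<in>V. \<exists>s. path s \<and> path_image s \<subseteq> power_space Y m \<and>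
        pathstart s = tuple_map m f u \<and> pathfinish s = diagonal_map m y0 \<and>
        pi1_map (power_space Y m) (tuple_map m f) ` pi1 V u
           \<subseteq> pi1_transport (power_space Y m) s ` diagonal_subgroup Y m y0) \<longleftrightarrow>
     (\<exists>s. continuous_on V s \<and> s ` V \<subseteq> pullback X (tuple_map m f) H r \<and> (\<forall>b\<in>V. fst (s b) = b))"
    if V: "openin (top_of_set X) V" for V
  proof -
    have VX: "V \<subseteq> X" by (rule openin_imp_subset[OF V])
    have fV: "continuous_on V (tuple_map m f)" "tuple_map m f ` V \<subseteq> power_space Y m"
      using f VX by (auto intro: continuous_on_subset)
    show ?thesis
      unfolding section_of_pullback_iff_has_lift[OF VX] diagonal_on_loops_iff_pi1[OF fV, symmetric]
      by (rule has_lift_diagonal_iff[OF D Y y0 locally_open_subset[OF X V] fV, symmetric])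
  qed
  then show ?thesis
    unfolding diag_dist_def diag_dist_secat_def secat_def by (simp cong: conj_cong)
qed

text \<open>
  The heart of the theorem: the two coverings of \<open>G\<^sup>m\<close>, the diagonal one and the pullback of the universal
  one along \<open>F_seq\<close>, impose the same condition on a map that is to be lifted.
\<close>

theorem has_lift_diagonal_iff_universal:
  assumes H: "H_space G mu e" and inv: "right_inversion G mu e eta"
    and G: "path_connected G" "locally path_connected G" and m: "m \<ge> 1" and y0: "y0 \<in> G"
    and U: "universal_covering U q (power_space G (m - 1))" and D: "diagonal_covering K r G m y0"
    and P: "locally path_connected P" and f: "continuous_on P f" "f ` P \<subseteq> power_space G m"
  shows "has_lift K r P f \<longleftrightarrow> has_lift U q P (F_seq mu eta m \<circ> f)"
proof -
  note F = F_seq_continuous[OF H inv, of m]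
  have "continuous_on P (F_seq mu eta m \<circ> f)"
    using F(1) f by (intro continuous_on_compose) (auto intro: continuous_on_subset)
  moreover have "(F_seq mu eta m \<circ> f) ` P \<subseteq> power_space G (m - 1)"
    using F(2) f(2) by fastforce
  ultimately show ?thesis
    unfolding has_lift_diagonal_iff[OF D G(2) y0 P f]
    using has_lift_universal_iff_null[OF U P] diagonal_on_loops_iff_null[OF H inv G(1) m y0 f] by blast
qed

theorem theorem7p6:
  fixes G :: "'g::topological_space set" and mu :: "'g \<times> 'g \<Rightarrow> 'g" and e y0 :: 'g
    and eta :: "'g \<Rightarrow> 'g" and m :: nat
    and X :: "'x::topological_space set" and f :: "nat \<Rightarrow> 'x \<Rightarrow> 'g"
    and U :: "'u::topological_space set" and q :: "'u \<Rightarrow> nat \<Rightarrow> 'g"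
    and H :: "'h::topological_space set" and r :: "'h \<Rightarrow> nat \<Rightarrow> 'g"
  assumes "path_connected G" and "locally path_connected G" and "semilocally_simply_connected G"
    and "group_like G mu e eta \<or> (CW_complex G \<and> H_space G mu e \<and> right_inversion G mu e eta)"
    and "m \<ge> 2"
    and "\<And>i. i \<in> {1..m} \<Longrightarrow> continuous_on X (f i) \<and> f i ` X \<subseteq> G"
    and "y0 \<in> G"
    and "universal_covering U q (power_space G (m - 1))"
    and "diagonal_covering H r G m y0"
  shows "(locally path_connected X \<longrightarrow>
            diag_dist X G y0 m f = cat_one X (F_seq mu eta m \<circ> tuple_map m f) U q) \<and>
         diag_dist_secat X m f H r = cat_one X (F_seq mu eta m \<circ> tuple_map m f) U q \<and>
         ddiag_dist symmetric_join_topology X m f H r =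
           dcat_one symmetric_join_topology X (F_seq mu eta m \<circ> tuple_map m f) U q \<and>
         (\<forall>d d'. metrizes d (pullback X (tuple_map m f) H r) \<longrightarrow>
                 metrizes d' (pullback X (F_seq mu eta m \<circ> tuple_map m f) U q) \<longrightarrow>
            ddiag_dist (levy_prokhorov_topology d) X m f H r =
            dcat_one (levy_prokhorov_topology d') X (F_seq mu eta m \<circ> tuple_map m f) U q)"
proof -
  let ?F = "F_seq mu eta m" and ?S = "power_space G m" and ?T = "power_space G (m - 1)" and ?t = "tuple_map m f"
  have Hsp: "H_space G mu e" and inv: "right_inversion G mu e eta"
    using assms(4) by (auto simp: group_like_def)
  note F = F_seq_continuous[OF Hsp inv, of m]
  note t = tuple_map_continuous[of m X f G, OF assms(6)]
  have m: "m \<ge> 1" using assms(5) by simp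
  have covU: "covering_space U q ?T" using assms(8) by (simp add: universal_covering_def)
  have covH: "covering_space H r ?S" using assms(9) by (simp add: diagonal_covering_def)
  have lpcS: "locally path_connected ?S" by (rule locally_path_connected_power_space[OF assms(2)])
  have r: "continuous_on H r" "r ` H \<subseteq> ?S"
    using covering_space_imp_continuous[OF covH] covering_space_imp_surjective[OF covH] by auto
  note lift_iff = has_lift_diagonal_iff_universal[OF Hsp inv assms(1,2) m assms(7-9)]
  \<comment> \<open>the identity of \<open>H\<close> lifts \<open>r\<close>, so \<open>F_seq \<circ> r\<close> lifts to \<open>U\<close>: a map from \<open>H\<close> to the pullback over \<open>G\<^sup>m\<close>\<close>
  have "has_lift H r H r" unfolding has_lift_def by (intro exI[of _ "\<lambda>x. x"]) simp
  then have "has_lift U q H (?F \<circ> r)"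
    using lift_iff[OF locally_path_connected_covering[OF covH lpcS] r] by simp
  then obtain \<phi> where \<phi>: "continuous_on H \<phi>" "\<phi> ` H \<subseteq> U" "\<And>h. h \<in> H \<Longrightarrow> q (\<phi> h) = ?F (r h)"
    unfolding has_lift_def by auto
  \<comment> \<open>conversely the pullback has a tautological lift to \<open>U\<close>, so its projection lifts to \<open>H\<close>\<close>
  let ?P = "pullback ?S ?F U q"
  have "continuous_on ?P fst" "fst ` ?P \<subseteq> ?S" by (auto simp: pullback_def intro: continuous_intros)
  moreover have "has_lift U q ?P (?F \<circ> fst)"
    unfolding has_lift_def by (intro exI[of _ snd]) (auto simp: pullback_def intro: continuous_intros)
  ultimately have "has_lift H r ?P fst"
    using lift_iff[OF locally_path_connected_pullback[OF covU lpcS F]] by blast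
  then obtain \<psi> where \<psi>: "continuous_on ?P \<psi>" "\<psi> ` ?P \<subseteq> H" "\<And>z. z \<in> ?P \<Longrightarrow> r (\<psi> z) = fst z"
    unfolding has_lift_def by blast
  let ?E = "pullback X ?t H r" and ?E' = "pullback X (?F \<circ> ?t) U q"
  \<comment> \<open>pulled back to \<open>X\<close>: fibrewise maps in both directions\<close>
  define \<alpha> where "\<alpha> = (\<lambda>z :: 'x \<times> 'h. (fst z, \<phi> (snd z)))"
  define \<beta> where "\<beta> = (\<lambda>z :: 'x \<times> 'u. (fst z, \<psi> (?t (fst z), snd z)))"
  have \<alpha>: "continuous_on ?E \<alpha>" "\<alpha> ` ?E \<subseteq> ?E'" "\<And>z. fst (\<alpha> z) = fst z"
  proof -
    show "continuous_on ?E \<alpha>"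
      unfolding \<alpha>_def
      by (intro continuous_on_Pair continuous_on_fst continuous_on_id
          continuous_on_compose2[OF \<phi>(1) continuous_on_snd[OF continuous_on_id]]) (auto simp: pullback_def)
    show "\<alpha> ` ?E \<subseteq> ?E'"
      using \<phi>(2,3) by (auto simp: \<alpha>_def pullback_def)
  qed (simp add: \<alpha>_def)
  have in_P: "(?t (fst z), snd z) \<in> ?P" if "z \<in> ?E'" for z
    using that t(2) by (auto simp: pullback_def)
  have \<beta>: "continuous_on ?E' \<beta>" "\<beta> ` ?E' \<subseteq> ?E" "\<And>z. fst (\<beta> z) = fst z"
  proof -
    have "continuous_on ?E' (\<lambda>z. ?t (fst z))"
      by (rule continuous_on_compose2[OF t(1) continuous_on_fst[OF continuous_on_id]]) (auto simp: pullback_def)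
    then have "continuous_on ?E' (\<lambda>z. (?t (fst z), snd z))"
      by (intro continuous_on_Pair continuous_on_snd continuous_on_id)
    then have "continuous_on ?E' (\<lambda>z. \<psi> (?t (fst z), snd z))"
      by (rule continuous_on_compose2[OF \<psi>(1)]) (use in_P in blast)
    then show "continuous_on ?E' \<beta>"
      unfolding \<beta>_def by (intro continuous_on_Pair continuous_on_fst continuous_on_id)
    show "\<beta> ` ?E' \<subseteq> ?E"
    proof
      fix w assume "w \<in> \<beta> ` ?E'"
      then obtain z where z: "z \<in> ?E'" "w = \<beta> z" by blast
      have "fst z \<in> X" using z(1) by (auto simp: pullback_def)
      moreover have "\<psi> (?t (fst z), snd z) \<in> H" using \<psi>(2) in_P[OF z(1)] by blast
      moreover have "r (\<psi> (?t (fst z), snd z)) = ?t (fst z)" using \<psi>(3)[OF in_P[OF z(1)]] by simp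
      ultimately show "w \<in> ?E" by (simp add: z(2) \<beta>_def pullback_def)
    qed
  qed (simp add: \<beta>_def)
  have sec: "diag_dist_secat X m f H r = cat_one X (?F \<circ> ?t) U q"
    unfolding diag_dist_secat_def cat_one_def
    by (intro antisym secat_mono[OF \<alpha>(1,2)] secat_mono[OF \<beta>(1,2)] \<alpha>(3) \<beta>(3))
  have dist: "diag_dist X G y0 m f = diag_dist_secat X m f H r" if "locally path_connected X"
    by (rule diag_dist_eq_secat[OF assms(9,2,7) that t])
  have join: "ddiag_dist symmetric_join_topology X m f H r = dcat_one symmetric_join_topology X (?F \<circ> ?t) U q"
    unfolding ddiag_dist_def dcat_one_def
    by (intro antisym dsecat_mono[OF \<alpha>(2)] dsecat_mono[OF \<beta>(2)] \<alpha>(3) \<beta>(3)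
        continuous_map_symmetric_join[OF \<alpha>(1,2)] continuous_map_symmetric_join[OF \<beta>(1,2)])
  have lp: "ddiag_dist (levy_prokhorov_topology d) X m f H r = dcat_one (levy_prokhorov_topology d') X (?F \<circ> ?t) U q"
    if d: "metrizes d ?E" and d': "metrizes d' ?E'" for d d'
    unfolding ddiag_dist_def dcat_one_def
    by (intro antisym dsecat_mono[OF \<alpha>(2)] dsecat_mono[OF \<beta>(2)] \<alpha>(3) \<beta>(3)
        continuous_map_levy_prokhorov[OF d d' \<alpha>(1,2)] continuous_map_levy_prokhorov[OF d' d \<beta>(1,2)])
  show ?thesis using sec dist join lp by simp
qed

end
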